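(* Let $\beta_1,\beta_2,\delta_1,\delta_2\ge 0$ and $\alpha_1,\alpha_2,\gamma_1,\gamma_2>0$ be real, and let $|\sigma|<1$. Let $f=h+\overline{g}\in K_{\hat H^o}$. Write $W_i=W_{(\alpha_i,\beta_i),(\gamma_i,\delta_i)}$ for $i=1,2$. If $$W_1''(1)+2W_1'(1)+W_2''(1)\le 4,$$ then $L(f)=H+\overline{\sigma G}\in C_{\hat H}$.
   Context: $D=\{z\in\mathbb C:|z|<1\}$. $\hat H$ is the class of complex-valued harmonic functions $f=h+\overline g$ on $D$ with $h,g$ analytic in $D$, $h(z)=z+\sum_{n=2}^\infty A_nz^n$, $g(z)=\sum_{n=1}^\infty B_nz^n$, $|B_1|<1$. $S_{\hat H}$ is the class of sense-preserving univalent functions in $\hat H$, and $S_{\hat H^o}$ is the subclass with $g'(0)=B_1=0$. $K_{\hat H^o}$ is the class of $f\in S_{\hat H^o}$ such that $f(D)$ is convex. A domain is close-to-convex if its complement can be written as a union of non-crossing half-lines (half-lines with pairwise disjoint relative interiors). $C_{\hat H}$ is the class of $f\in S_{\hat H}$ such that $f(D)$ is close-to-convex. Normalized four-parameter Wright function: for real $a,c>0$ and $b,d\ge0$, $$W_{(a,b),(c,d)}(z)=z+\sum_{n=2}^\infty\frac{\Gamma(a)\Gamma(c)}{\Gamma(a+(n-1)b)\,\Gamma(c+(n-1)d)}z^n .$$ $W'(1),W''(1)$ denote the sums at $z=1$ of the termwise derivatives of this series; a hypothesis involving them is understood to include that they are finite (automatic if $b+d>0$). The operator $L$ (depending on $\alpha_i,\beta_i,\gamma_i,\delta_i$,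 $i=1,2$, and $\sigma$) is $L(f)=H+\overline{\sigma G}$, where $H=h*W_{(\alpha_1,\beta_1),(\gamma_1,\delta_1)}$ and $G=g*W_{(\alpha_2,\beta_2),(\gamma_2,\delta_2)}$; here $*$ is the Hadamard product $\left(\sum a_nz^n\right)*\left(\sum b_nz^n\right)=\sum a_nb_nz^n$. *)

theory Defs
  imports "HOL-Complex_Analysis.Complex_Analysis"
begin

abbreviation unit_disc :: "complex set"
  where "unit_disc \<equiv> ball 0 1"

(* All predicates and classes below depend only on the values on the disc of the
   total functions involved. For given f, h and g are unique on the disc because g 0 = 0. *)
definition harmonic_parts ::
  "(complex \<Rightarrow> complex) \<Rightarrow> (complex \<Rightarrow> complex) \<Rightarrow> (complex \<Rightarrow> complex) \<Rightarrow> bool"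
  where "harmonic_parts f h g \<longleftrightarrow>
    h holomorphic_on unit_disc \<and> g holomorphic_on unit_disc \<and>
    h 0 = 0 \<and> deriv h 0 = 1 \<and> g 0 = 0 \<and> cmod (deriv g 0) < 1 \<and>
    (\<forall>z\<in>unit_disc. f z = h z + cnj (g z))"

definition harmonic_class :: "(complex \<Rightarrow> complex) set"
  where "harmonic_class = {f. \<exists>h g. harmonic_parts f h g}"

(* Positive Jacobian: with f = u + \<i> v, the derivative applied to 1 and \<i> gives
   u_x + \<i> v_x and u_y + \<i> v_y, so the imaginary part is u_x v_y - v_x u_y.
   For f = h + cnj g it equals |h'|^2 - |g'|^2. *)
definition sense_preserving_on :: "complex set \<Rightarrow> (complex \<Rightarrow> complex) \<Rightarrow> bool"
  where "sense_preserving_on S f \<longleftrightarrow>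
    (\<forall>z\<in>S. f differentiable (at z) \<and>
      0 < Im (cnj (frechet_derivative f (at z) 1) * frechet_derivative f (at z) \<i>))"

definition S_harmonic :: "(complex \<Rightarrow> complex) set"
  where "S_harmonic =
    {f \<in> harmonic_class. sense_preserving_on unit_disc f \<and> inj_on f unit_disc}"

definition S_harmonic0 :: "(complex \<Rightarrow> complex) set"
  where "S_harmonic0 = {f \<in> S_harmonic. \<exists>h g. harmonic_parts f h g \<and> deriv g 0 = 0}"

definition K_harmonic0 :: "(complex \<Rightarrow> complex) set"
  where "K_harmonic0 = {f \<in> S_harmonic0. convex (f ` unit_disc)}"

definition half_line :: "complex set \<Rightarrow> bool"
  where "half_line R \<longleftrightarrow> (\<exists>p u. u \<noteq> 0 \<and> R = {p + of_real t * u | t. t \<ge> 0})"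

definition close_to_convex :: "complex set \<Rightarrow> bool"
  where "close_to_convex S \<longleftrightarrow> open S \<and> connected S \<and> S \<noteq> {} \<and>
    (\<exists>\<R>. (\<forall>R\<in>\<R>. half_line R) \<and>
         pairwise (\<lambda>R R'. disjnt (rel_interior R) (rel_interior R')) \<R> \<and>
         - S = \<Union>\<R>)"

definition C_harmonic :: "(complex \<Rightarrow> complex) set"
  where "C_harmonic = {f \<in> S_harmonic. close_to_convex (f ` unit_disc)}"

(* The series is polymorphic so that it can be summed at the real point 1 and also be
   multiplied with complex Taylor series. *)
definition wright_fps :: "real \<Rightarrow> real \<Rightarrow> real \<Rightarrow> real \<Rightarrow> 'a :: real_algebra_1 fps"
  where "wright_fps a b c d = Abs_fps (\<lambda>n.
    if n = 0 then 0 else if n = 1 then 1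
    else of_real (Gamma a * Gamma c /
           (Gamma (a + (real n - 1) * b) * Gamma (c + (real n - 1) * d))))"

definition hadamard :: "'a :: comm_semiring_1 fps \<Rightarrow> 'a fps \<Rightarrow> 'a fps"
  where "hadamard F G = Abs_fps (\<lambda>n. fps_nth F n * fps_nth G n)"

(* The operator acts on f through its analytic part h and co-analytic part g. *)
definition wright_operator ::
  "real \<Rightarrow> real \<Rightarrow> real \<Rightarrow> real \<Rightarrow> real \<Rightarrow> real \<Rightarrow> real \<Rightarrow> real \<Rightarrow> complex \<Rightarrow>
   (complex \<Rightarrow> complex) \<Rightarrow> (complex \<Rightarrow> complex) \<Rightarrow> complex \<Rightarrow> complex"
  where "wright_operator \<alpha>1 \<beta>1 \<gamma>1 \<delta>1 \<alpha>2 \<beta>2 \<gamma>2 \<delta>2 \<sigma> h g z =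
    eval_fps (hadamard (fps_expansion h 0) (wright_fps \<alpha>1 \<beta>1 \<gamma>1 \<delta>1)) z +
    cnj (\<sigma> * eval_fps (hadamard (fps_expansion g 0) (wright_fps \<alpha>2 \<beta>2 \<gamma>2 \<delta>2)) z)"

end

theory Submission
  imports Defs
begin

text \<open>
  The heart of the matter are the sharp Clunie--Sheil-Small bounds |A_n| \<le> (n+1)/2 and
  |B_n| \<le> (n-1)/2 for f = h + cnj g in the convex class.  They follow from a flow statement:
  there are unimodular l and \<zeta> such that Re (l f) increases along the hyperbolic flow of the disc
  from -\<zeta> to \<zeta>.  Differentiating the flow at time 0 gives
  Re ((l h' + cnj l g') (\<zeta> - cnj \<zeta> z^2)) \<ge> 0, and writing g' = \<omega> h' with |\<omega>(z)| < 1 and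
  \<omega>(0) = 0 majorizes h' by (1 - z)^(-3) and g' by z (1 - z)^(-3).

  For the flow statement one exhausts f(D) by relatively compact convex domains and uniformizes their
  preimages, so that f extends continuously to the circle.  Half-planes meet a convex
  domain in connected sets, hence Re (l f) is unimodal on the circle; by connectedness of the set of
  directions some Re (l f) attains its maximum and minimum at antipodal points, and then it increases
  along the flow on the circle, hence inside by the minimum principle.

  With these bounds the hypothesis says that the sum of n (|a_n| + |b_n|) over n \<ge> 2 is below 1 for
  the coefficients of L(f), strictly because |\<sigma>| < 1.  So L(f) is the identity plus a strict contraction,
  and the half-lines starting at the boundary values at \<zeta> in direction \<zeta> fill the complement of its
  image without crossing.
\<close>

section \<open>Length and area\<close>

text \<open>The exhaustion is made in the image and pulled back, because a harmonic map with convex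
  image need not send smaller concentric discs onto convex sets. Composing f with an analytic
  Riemann map keeps the form h + cnj g, so each piece is again a harmonic map of the disc; as the
  pieces grow, the normalized Riemann maps tend to the identity. Antipodality is what makes the
  bounds sharp: the vector field of the flow is then \<zeta> - cnj \<zeta> z^2, and dividing the
  majorant (1 + z) / (1 - z) of a function with positive real part by 1 - z^2 leaves only (1 -
  z)^(-2). The third power comes from a factor 1 / (1 + c \<omega>) with |c| = 1. The constant 4:
  the bounds give n |A_n| \<le> n (n + 1) / 2 and n |B_n| \<le> n (n - 1) / 2. Since n (n + 1) = n
  (n - 1) + 2 n, summation over n \<ge> 2 against the Wright coefficients gives (W1''(1) + 2 (W1'(1)
  - 1) + W2''(1)) / 2, which is at most (4 - 2) / 2 = 1. As W2''(1) > 0, the factor |\<sigma>| < 1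
  in front of it makes the inequality strict.\<close>

definition vec_of_complex :: "complex \<Rightarrow> real^2"
  where "vec_of_complex z = vector [Re z, Im z]"

text \<open>The measure of a differentiable image and the crossing theorem
  \<open>fashoda_interlace\<close> live on \<open>real^2\<close>, so the plane is carried between
  the two types.\<close>

definition complex_of_vec :: "real^2 \<Rightarrow> complex"
  where "complex_of_vec v = Complex (v$1) (v$2)"

lemma vec_of_complex_nth [simp]:
  "vec_of_complex z $ 1 = Re z" "vec_of_complex z $ 2 = Im z"
  by (simp_all add: vec_of_complex_def)

lemma complex_of_vec_simps [simp]:
  "Re (complex_of_vec v) = v$1" "Im (complex_of_vec v) = v$2"
  "complex_of_vec (vec_of_complex z) = z" "vec_of_complex (complex_of_vec v) = v"
  by (simp_all add: complex_of_vec_def complex_eq_iff vec_eq_iff forall_2)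

lemma linear_vec_of_complex: "linear vec_of_complex"
  by (rule linearI) (simp_all add: vec_eq_iff forall_2)

lemma linear_complex_of_vec: "linear complex_of_vec"
  by (rule linearI) (simp_all add: complex_eq_iff)

lemmas bounded_linear_vec_of_complex = linear_conv_bounded_linear[THEN iffD1, OF linear_vec_of_complex]
lemmas bounded_linear_complex_of_vec = linear_conv_bounded_linear[THEN iffD1, OF linear_complex_of_vec]

lemma det_mult_complex:
  "det (matrix (\<lambda>v. vec_of_complex (c * complex_of_vec v))) = (cmod c)\<^sup>2"
  by (simp add: det_2 matrix_def axis_def cmod_power2) (simp add: power2_eq_square)

text \<open>The integral of |\<phi>'|^2 is the area of the image, because the real Jacobian of an
  injective holomorphic map is |\<phi>'|^2. The image is open and bounded, so this area is finite,
  and finiteness is all that the length-area argument wants.\<close>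

lemma has_integral_area:
  assumes S: "open S" and hol: "\<phi> holomorphic_on S" and inj: "inj_on \<phi> S"
    and bdd: "bounded (\<phi> ` S)"
  shows "\<exists>m. ((\<lambda>v. (cmod (deriv \<phi> (complex_of_vec v)))\<^sup>2) has_integral m) (complex_of_vec -` S)"
proof -
  define G where "G v = vec_of_complex (\<phi> (complex_of_vec v))" for v
  let ?T = "complex_of_vec -` S"
  have opT: "open ?T"
    using S bounded_linear_complex_of_vec by (simp add: continuous_open_vimage linear_continuous_at)
  have img: "G ` ?T = complex_of_vec -` (\<phi> ` S)"
    unfolding G_def
    by (auto simp: image_iff) (metis complex_of_vec_simps(3,4) vimageI)
  have "open (\<phi> ` S)"
    using open_mapping_thm3[OF hol S inj] .
  then have "open (G ` ?T)"
    unfolding img using bounded_linear_complex_of_vec by (simp add: continuous_open_vimage linear_continuous_at)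
  moreover have "bounded (G ` ?T)"
  proof -
    have "G ` ?T \<subseteq> vec_of_complex ` (\<phi> ` S)" by (auto simp: G_def)
    then show ?thesis
      using bounded_linear_image[OF bdd bounded_linear_vec_of_complex] bounded_subset by blast
  qed
  ultimately have meas: "G ` ?T \<in> lmeasurable"
    by (simp add: lmeasurable_open)
  have der: "(G has_derivative (\<lambda>w. vec_of_complex (deriv \<phi> (complex_of_vec v) * complex_of_vec w))) (at v within ?T)"
    if "v \<in> ?T" for v
  proof -
    have "(\<phi> has_field_derivative deriv \<phi> (complex_of_vec v)) (at (complex_of_vec v))"
      using that hol S by (simp add: holomorphic_derivI)
    then have 1: "(\<phi> has_derivative (*) (deriv \<phi> (complex_of_vec v))) (at (complex_of_vec v))"
      by (simp add: has_field_derivative_def)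
    have 2: "(complex_of_vec has_derivative complex_of_vec) (at v within ?T)"
      by (rule bounded_linear_imp_has_derivative[OF bounded_linear_complex_of_vec])
    have 3: "((\<lambda>v. \<phi> (complex_of_vec v)) has_derivative (\<lambda>w. deriv \<phi> (complex_of_vec v) * complex_of_vec w)) (at v within ?T)"
      using has_derivative_compose[OF 2 1] by simp
    show ?thesis
      unfolding G_def by (rule bounded_linear.has_derivative[OF bounded_linear_vec_of_complex 3])
  qed
  have inj': "inj_on G ?T"
    by (rule inj_onI) (metis (no_types, lifting) G_def complex_of_vec_simps(3,4) inj inj_onD vimageD)
  have "?T \<in> sets lebesgue"
    using opT by auto
  from has_measure_differentiable_image[OF this der inj'] meas
  show ?thesis
    unfolding det_mult_complex by auto
qed

text \<open>The area integral is taken over \<open>real^2\<close>, whereas Tonelli's theorem speaks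
  of a product measure; agreement on boxes identifies the two Lebesgue measures.\<close>

lemma lborel_pair_eq: "(lborel :: (real \<times> real) measure) = distr lborel borel (\<lambda>v::real^2. (v$1, v$2))"
proof (rule lborel_eqI)
  fix l u :: "real \<times> real"
  assume le: "\<And>b. b \<in> Basis \<Longrightarrow> l \<bullet> b \<le> u \<bullet> b"
  have [measurable]: "(\<lambda>v::real^2. (v$1, v$2)) \<in> lborel \<rightarrow>\<^sub>M borel"
    by (simp add: borel_measurable_continuous_onI continuous_intros)
  have eq: "(\<lambda>v::real^2. (v$1, v$2)) -` box l u = box (vector [fst l, snd l]) (vector [fst u, snd u])"
    by (auto simp: mem_box_cart forall_2 mem_box Basis_prod_def inner_prod_def)
  have le': "fst l \<le> fst u" "snd l \<le> snd u"
    using le[of "(1,0)"] le[of "(0,1)"] by (auto simp: Basis_prod_def inner_prod_def)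
  have "emeasure (distr lborel borel (\<lambda>v::real^2. (v$1, v$2))) (box l u) =
      emeasure lborel (box (vector [fst l, snd l]) (vector [fst u, snd u] :: real^2))"
    by (subst emeasure_distr) (auto simp: eq)
  also have "\<dots> = ennreal ((fst u - fst l) * (snd u - snd l))"
  proof -
    have B: "(Basis :: (real^2) set) = {axis 1 1, axis 2 1}"
      by (auto simp: Basis_vec_def exhaust_2) (metis exhaust_2)
    show ?thesis
      using le' by (simp add: emeasure_lborel_box_eq B inner_axis axis_eq_axis)
  qed
  also have "\<dots> = (\<Prod>b\<in>Basis. (u - l) \<bullet> b)"
    by (simp add: Basis_prod_def inner_prod_def mult.commute)
  finally show "emeasure (distr lborel borel (\<lambda>v::real^2. (v$1, v$2))) (box l u) = (\<Prod>b\<in>Basis. (u - l) \<bullet> b)" .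
qed simp


text \<open>Length-area argument: finite area of the image forces some vertical segment far to the left to
  have an arbitrarily short image.\<close>

lemma short_crosscut_strip:
  assumes hol: "\<phi> holomorphic_on {w. 0 < Im w \<and> Im w < pi}"
    and inj: "inj_on \<phi> {w. 0 < Im w \<and> Im w < pi}"
    and bdd: "bounded (\<phi> ` {w. 0 < Im w \<and> Im w < pi})"
    and "e > 0"
  obtains x where "x < X"
    "\<And>y1 y2. \<lbrakk>0 < y1; y1 < pi; 0 < y2; y2 < pi\<rbrakk> \<Longrightarrow> cmod (\<phi> (Complex x y1) - \<phi> (Complex x y2)) \<le> e"
proof -
  define S where "S = {w. 0 < Im w \<and> Im w < pi}"
  have hol: "\<phi> holomorphic_on S" and inj: "inj_on \<phi> S" and bdd: "bounded (\<phi> ` S)"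
    using assms by (auto simp: S_def)
  have opS: "open S"
  proof -
    have "S = Im -` {0<..<pi}" by (auto simp: S_def)
    then show ?thesis by (simp add: open_vimage continuous_intros)
  qed
  have cderiv: "continuous_on S (deriv \<phi>)"
    using hol opS by (intro holomorphic_on_imp_continuous_on holomorphic_deriv)
  obtain m where "((\<lambda>v. (cmod (deriv \<phi> (complex_of_vec v)))\<^sup>2) has_integral m) (complex_of_vec -` S)"
    using has_integral_area[OF opS hol inj bdd] by blast
  then have int: "((\<lambda>v. if v \<in> complex_of_vec -` S then (cmod (deriv \<phi> (complex_of_vec v)))\<^sup>2 else 0) has_integral m) UNIV"
    by (simp only: has_integral_restrict_UNIV)
  \<comment> \<open>Extension by zero makes the integrand a Borel function on the whole plane, so
    that it can be integrated column by column.\<close>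
  define K where "K p = (if Complex (fst p) (snd p) \<in> S then (cmod (deriv \<phi> (Complex (fst p) (snd p))))\<^sup>2 else 0)" for p
  have K_eq: "(if v \<in> complex_of_vec -` S then (cmod (deriv \<phi> (complex_of_vec v)))\<^sup>2 else 0) = K (v$1, v$2)" for v
    by (simp add: K_def complex_of_vec_def)
  have cC: "continuous_on A (\<lambda>p. Complex (fst p) (snd p))" for A
    by (intro continuous_intros)
  have Kmeas [measurable]: "K \<in> borel_measurable borel"
  proof -
    have op: "open {p. Complex (fst p) (snd p) \<in> S}"
      using open_vimage[OF opS cC[of UNIV]] by (simp add: vimage_def)
    have "continuous_on {p. Complex (fst p) (snd p) \<in> S} (\<lambda>p. (cmod (deriv \<phi> (Complex (fst p) (snd p))))\<^sup>2)"
      by (intro continuous_intros continuous_on_compose2[OF cderiv cC]) auto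
    from borel_measurable_continuous_on_indicator[OF _ this] op
    have "(\<lambda>x. indicat_real {p. Complex (fst p) (snd p) \<in> S} x *\<^sub>R (cmod (deriv \<phi> (Complex (fst x) (snd x))))\<^sup>2) \<in> borel_measurable borel"
      by simp
    moreover have "(\<lambda>x. indicat_real {p. Complex (fst p) (snd p) \<in> S} x *\<^sub>R (cmod (deriv \<phi> (Complex (fst x) (snd x))))\<^sup>2) = K"
      by (auto simp: K_def fun_eq_iff indicator_def)
    ultimately show ?thesis by simp
  qed
  have Knn: "0 \<le> K p" for p by (simp add: K_def)
  have meas2 [measurable]: "(\<lambda>v::real^2. (v$1, v$2)) \<in> borel_measurable borel"
    by (simp add: borel_measurable_continuous_onI continuous_intros)
  have "(\<integral>\<^sup>+v. ennreal (K (v$1, v$2)) \<partial>(lborel :: (real^2) measure)) = ennreal m"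
    using int unfolding K_eq
    by (intro nn_integral_has_integral_lborel) (use Knn in auto)
  then have "(\<integral>\<^sup>+p. ennreal (K p) \<partial>(lborel :: (real \<times> real) measure)) = ennreal m"
    by (subst lborel_pair_eq, subst nn_integral_distr) auto
  then have "(\<integral>\<^sup>+p. ennreal (K p) \<partial>((lborel :: real measure) \<Otimes>\<^sub>M (lborel :: real measure))) = ennreal m"
    by (simp add: lborel_prod)
  moreover have "(\<lambda>p. ennreal (K p)) \<in> borel_measurable ((lborel :: real measure) \<Otimes>\<^sub>M (lborel :: real measure))"
    by (simp add: lborel_prod)
  ultimately have iter: "(\<integral>\<^sup>+x. (\<integral>\<^sup>+y. ennreal (K (x, y)) \<partial>lborel) \<partial>lborel) = ennreal m"
    by (subst lborel.nn_integral_fst) auto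
  \<comment> \<open>A column of height pi on which the integral of |\<phi>'|^2 is at most c = pi
    \<epsilon>^2 has an image of length at most pi \<epsilon> = e.\<close>
  define \<epsilon> where "\<epsilon> = e / pi"
  have eps: "\<epsilon> > 0" "\<epsilon> * pi = e" using \<open>e > 0\<close> by (auto simp: \<epsilon>_def)
  define c where "c = pi * \<epsilon>\<^sup>2"
  have "c > 0" using eps by (simp add: c_def)
  \<comment> \<open>Otherwise every column left of X contributes at least c, and c times the
    infinite length of the half-line exceeds the finite area.\<close>
  have "\<exists>x<X. (\<integral>\<^sup>+y. ennreal (K (x, y)) \<partial>lborel) \<le> ennreal c"
  proof (rule ccontr)
    assume "\<not> ?thesis"
    then have gt: "\<And>x. x < X \<Longrightarrow> ennreal c \<le> (\<integral>\<^sup>+y. ennreal (K (x, y)) \<partial>lborel)" by force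
    have "(\<integral>\<^sup>+x. ennreal c * indicator {..<X} x \<partial>lborel) \<le> (\<integral>\<^sup>+x. (\<integral>\<^sup>+y. ennreal (K (x, y)) \<partial>lborel) \<partial>lborel)"
      by (intro nn_integral_mono) (auto simp: indicator_def gt)
    moreover have "(\<integral>\<^sup>+x. ennreal c * indicator {..<X} x \<partial>lborel) = ennreal c * emeasure lborel {..<X}"
      by (rule nn_integral_cmult_indicator) auto
    moreover have "emeasure lborel {..<X} = \<infinity>"
    proof -
      have n: "ennreal (real n) \<le> emeasure lborel {..<X}" for n
      proof -
        have "emeasure lborel {X - n - 1 .. X - 1} \<le> emeasure lborel {..<X}"
          by (intro emeasure_mono) auto
        then show ?thesis by simp
      qed
      show ?thesis
      proof (cases "emeasure lborel {..<X}")
        case (real r)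
        obtain k where "r < real k" using reals_Archimedean2 by blast
        then show ?thesis using n[of k] real by simp
      qed simp
    qed
    ultimately show False
      using iter \<open>c > 0\<close> by (simp add: ennreal_mult_top top_unique)
  qed
  then obtain x where x: "x < X" "(\<integral>\<^sup>+y. ennreal (K (x, y)) \<partial>lborel) \<le> ennreal c" by blast
  have main: "cmod (\<phi> (Complex x y1) - \<phi> (Complex x y2)) \<le> e" if "0 < y1" "y1 \<le> y2" "y2 < pi" for y1 y2
  proof -
    have inS: "Complex x y \<in> S" if "y \<in> {y1..y2}" for y
      using that \<open>0 < y1\<close> \<open>y2 < pi\<close> by (auto simp: S_def)
    define k where "k y = (cmod (deriv \<phi> (Complex x y)))\<^sup>2" for y
    have cont: "continuous_on {y1..y2} (\<lambda>y. deriv \<phi> (Complex x y))"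
      by (intro continuous_on_compose2[OF cderiv] continuous_intros) (use inS in auto)
    then have "continuous_on {y1..y2} k"
      unfolding k_def by (intro continuous_intros)
    then have kint: "k integrable_on {y1..y2}" by (rule integrable_continuous_interval)
    have "ennreal (integral {y1..y2} k) = (\<integral>\<^sup>+y. ennreal (k y) * indicator {y1..y2} y \<partial>lborel)"
    proof (rule nn_integral_has_integral_lebesgue'[symmetric])
      show "(k has_integral integral {y1..y2} k) {y1..y2}" using kint by (rule integrable_integral)
    qed (simp add: k_def)
    also have "\<dots> \<le> (\<integral>\<^sup>+y. ennreal (K (x, y)) \<partial>lborel)"
      using inS by (intro nn_integral_mono) (auto simp: indicator_def K_def k_def)
    also note x(2)
    finally have kle: "integral {y1..y2} k \<le> c"
      using \<open>c > 0\<close> by (simp add: ennreal_le_iff)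
    have "((\<lambda>y. deriv \<phi> (Complex x y) * \<i>) has_integral (\<phi> (Complex x y2) - \<phi> (Complex x y1))) {y1..y2}"
    proof (rule fundamental_theorem_of_calculus)
      show "y1 \<le> y2" by fact
      fix y assume y: "y \<in> {y1..y2}"
      have 1: "(\<phi> has_field_derivative deriv \<phi> (Complex x y)) (at (Complex x y))"
        using inS[OF y] hol opS by (simp add: holomorphic_derivI)
      have "(Complex x has_vector_derivative \<i>) (at y within {y1..y2})"
        unfolding has_vector_derivative_def Complex_eq
        by (auto intro!: derivative_eq_intros simp: scaleR_conv_of_real)
      from field_vector_diff_chain_within[OF this has_field_derivative_at_within[OF 1]]
      show "((\<lambda>y. \<phi> (Complex x y)) has_vector_derivative deriv \<phi> (Complex x y) * \<i>) (at y within {y1..y2})"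
        by (simp add: o_def mult.commute)
    qed
    then have int': "(\<lambda>y. deriv \<phi> (Complex x y) * \<i>) integrable_on {y1..y2}"
      and eq: "\<phi> (Complex x y2) - \<phi> (Complex x y1) = integral {y1..y2} (\<lambda>y. deriv \<phi> (Complex x y) * \<i>)"
      by (auto simp: has_integral_iff)
    \<comment> \<open>In place of the Cauchy-Schwarz inequality: |\<phi>'| \<le> \<epsilon> / 2 +
      |\<phi>'|^2 / (2 \<epsilon>) pointwise, from (|\<phi>'| - \<epsilon>)^2 \<ge> 0.\<close>
    have "cmod (\<phi> (Complex x y2) - \<phi> (Complex x y1)) \<le> integral {y1..y2} (\<lambda>y. \<epsilon> / 2 + k y / (2 * \<epsilon>))"
      unfolding eq
    proof (rule integral_norm_bound_integral[OF int'])
      show "(\<lambda>y. \<epsilon> / 2 + k y / (2 * \<epsilon>)) integrable_on {y1..y2}"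
        using kint by (intro integrable_add integrable_on_divide) auto
      fix y
      have "0 \<le> (cmod (deriv \<phi> (Complex x y)) - \<epsilon>)\<^sup>2" by simp
      then show "cmod (deriv \<phi> (Complex x y) * \<i>) \<le> \<epsilon> / 2 + k y / (2 * \<epsilon>)"
        using eps(1) by (simp add: k_def norm_mult field_simps power2_eq_square)
    qed
    also have "\<dots> = (y2 - y1) * (\<epsilon> / 2) + integral {y1..y2} k / (2 * \<epsilon>)"
      using kint \<open>y1 \<le> y2\<close> by (subst integral_add) (auto intro!: integrable_on_divide)
    also have "\<dots> \<le> pi * (\<epsilon> / 2) + c / (2 * \<epsilon>)"
      using that kle eps by (intro add_mono mult_right_mono divide_right_mono) auto
    also have "\<dots> = e"
      using eps by (simp add: c_def field_simps power2_eq_square)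
    finally show ?thesis by (simp add: norm_minus_commute)
  qed
  show ?thesis
  proof (rule that[OF x(1)])
    fix y1 y2 :: real assume "0 < y1" "y1 < pi" "0 < y2" "y2 < pi"
    then show "cmod (\<phi> (Complex x y1) - \<phi> (Complex x y2)) \<le> e"
      using main[of y1 y2] main[of y2 y1] by (cases "y1 \<le> y2") (auto simp: norm_minus_commute)
  qed
qed

text \<open>The exponential maps the strip onto the upper half-plane, and a Cayley transform maps
  that onto the disc with 0 going to \<zeta>. For z = M w one has |\<zeta> - z| / |\<zeta> + z| =
  exp (Re w), so the vertical segment at abscissa x becomes the arc with \<kappa> = exp x, and
  moving left in the strip means approaching \<zeta>.\<close>

lemma short_crosscut_disc:
  assumes hol: "\<phi> holomorphic_on ball 0 1" and inj: "inj_on \<phi> (ball 0 1)"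
    and bdd: "bounded (\<phi> ` ball 0 1)" and \<zeta>: "cmod \<zeta> = 1" and "e > 0" "\<kappa>0 > 0"
  obtains \<kappa> where "0 < \<kappa>" "\<kappa> < \<kappa>0"
    "\<And>z1 z2. \<lbrakk>cmod z1 < 1; cmod z2 < 1; cmod (\<zeta> - z1) = \<kappa> * cmod (\<zeta> + z1); cmod (\<zeta> - z2) = \<kappa> * cmod (\<zeta> + z2)\<rbrakk>
        \<Longrightarrow> cmod (\<phi> z1 - \<phi> z2) \<le> e"
proof -
  define S where "S = {w. 0 < Im w \<and> Im w < pi}"
  define M where "M w = \<zeta> * (\<i> - exp w) / (\<i> + exp w)" for w
  have \<zeta>0: "\<zeta> \<noteq> 0" using \<zeta> by auto
  have Imexp: "Im (exp w) > 0" if "w \<in> S" for w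
    using that by (auto simp: S_def Im_exp sin_gt_zero)
  have nz: "\<i> + exp w \<noteq> 0" if "w \<in> S" for w
    using Imexp[OF that] by (auto simp: complex_eq_iff)
  have Mball: "M w \<in> ball 0 1" if "w \<in> S" for w
  proof -
    have "(cmod (\<i> - exp w))\<^sup>2 < (cmod (\<i> + exp w))\<^sup>2"
      using Imexp[OF that] unfolding cmod_power2 by (simp add: power2_eq_square algebra_simps)
    then have "cmod (\<i> - exp w) < cmod (\<i> + exp w)"
      using power2_less_imp_less by fastforce
    then show ?thesis using nz[OF that] by (simp add: M_def norm_mult norm_divide \<zeta> divide_simps)
  qed
  have Mhol: "M holomorphic_on S"
    unfolding M_def by (intro holomorphic_intros) (use nz in auto)
  have Minj: "inj_on M S"
  proof (rule inj_onI)
    fix w1 w2 assume w: "w1 \<in> S" "w2 \<in> S" "M w1 = M w2"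
    have "(\<i> - exp w1) * (\<i> + exp w2) = (\<i> - exp w2) * (\<i> + exp w1)"
      using w(3) nz[OF w(1)] nz[OF w(2)] \<zeta>0 by (simp add: M_def divide_simps mult_ac)
    then have "exp w1 = exp w2"
      by (simp add: algebra_simps)
    moreover have "Ln (exp w1) = w1" "Ln (exp w2) = w2"
      using w by (auto simp: S_def intro!: Ln_exp)
    ultimately show "w1 = w2" by metis
  qed
  have img: "M ` S \<subseteq> ball 0 1" using Mball by auto
  have 1: "(\<phi> \<circ> M) holomorphic_on {w. 0 < Im w \<and> Im w < pi}"
    using holomorphic_on_compose_gen[OF Mhol hol img] by (simp add: S_def)
  have 2: "inj_on (\<phi> \<circ> M) {w. 0 < Im w \<and> Im w < pi}"
    using comp_inj_on[OF Minj inj_on_subset[OF inj img]] by (simp add: S_def)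
  have "(\<phi> \<circ> M) ` S \<subseteq> \<phi> ` ball 0 1" using img by auto
  then have 3: "bounded ((\<phi> \<circ> M) ` {w. 0 < Im w \<and> Im w < pi})"
    using bounded_subset[OF bdd] by (simp add: S_def)
  obtain x where x: "x < ln \<kappa>0"
    "\<And>y1 y2. \<lbrakk>0 < y1; y1 < pi; 0 < y2; y2 < pi\<rbrakk> \<Longrightarrow> cmod ((\<phi> \<circ> M) (Complex x y1) - (\<phi> \<circ> M) (Complex x y2)) \<le> e"
    using short_crosscut_strip[OF 1 2 3 \<open>e > 0\<close>] by blast
  \<comment> \<open>The inverse of \<open>M\<close>: v = \<i> (\<zeta> - z) / (\<zeta> + z) undoes
    the Cayley transform. It lies in the upper half-plane because |z| < 1, hence its logarithm lies
    in the strip.\<close>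
  have pre: "\<exists>y. 0 < y \<and> y < pi \<and> z = M (Complex x y)" if z: "cmod z < 1" "cmod (\<zeta> - z) = exp x * cmod (\<zeta> + z)" for z
  proof -
    have sum0: "\<zeta> + z \<noteq> 0"
    proof
      assume "\<zeta> + z = 0"
      then have "z = - \<zeta>" by (simp add: add_eq_0_iff)
      then show False using z \<zeta> by simp
    qed
    have diff0: "\<zeta> - z \<noteq> 0" using z sum0 by force
    define v where "v = \<i> * ((\<zeta> - z) / (\<zeta> + z))"
    have "Re ((\<zeta> - z) * cnj (\<zeta> + z)) = (cmod \<zeta>)\<^sup>2 - (cmod z)\<^sup>2"
      unfolding cmod_power2 by (simp add: power2_eq_square algebra_simps)
    also have "\<dots> > 0" using z \<zeta> by (simp add: abs_square_less_1)
    finally have "Re ((\<zeta> - z) / (\<zeta> + z)) > 0" by (simp only: Re_complex_div_gt_0)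
    then have Imv: "Im v > 0" unfolding v_def by (subst Im_i_times)
    have v0: "v \<noteq> 0" using Imv by auto
    have "Re (Ln v) = x"
      using v0 z sum0 by (simp add: v_def norm_mult norm_divide)
    then have eq: "Complex x (Im (Ln v)) = Ln v" by (simp add: complex_eq_iff)
    have im: "0 < Im (Ln v)" "Im (Ln v) < pi" using Imv Im_Ln_pos_lt[OF v0] by auto
    have "M (Ln v) = \<zeta> * (\<i> - v) / (\<i> + v)"
      using v0 by (simp add: M_def)
    also have "\<dots> = z"
    proof -
      have "\<i> - v = \<i> * (2 * z / (\<zeta> + z))" "\<i> + v = \<i> * (2 * \<zeta> / (\<zeta> + z))"
        using sum0 by (simp_all add: v_def field_simps)
      then show ?thesis using sum0 \<zeta>0 by simp
    qed
    finally show ?thesis using im eq by metis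
  qed
  show ?thesis
  proof (rule that[of "exp x"])
    show "exp x < \<kappa>0" using x(1) \<open>\<kappa>0 > 0\<close> by (metis exp_less_cancel_iff exp_ln)
    fix z1 z2 assume "cmod z1 < 1" "cmod z2 < 1" "cmod (\<zeta> - z1) = exp x * cmod (\<zeta> + z1)" "cmod (\<zeta> - z2) = exp x * cmod (\<zeta> + z2)"
    then show "cmod (\<phi> z1 - \<phi> z2) \<le> e"
      using pre[of z1] pre[of z2] x(2) by auto
  qed auto
qed

section \<open>Boundary extension of conformal maps onto convex harmonic images\<close>

text \<open>The circle |\<zeta> - z| = \<kappa> |\<zeta> + z| separates \<zeta> from 0.  If its image lies in a \<delta>-ball B, then, by
  convexity, every point of the image domain at distance more than C \<delta> from B is joined to f 0 outside B, so
  the part of the disc near \<zeta> is mapped near B.\<close>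

lemma boundary_Cauchy:
  fixes f g :: "complex \<Rightarrow> complex"
  assumes homeo: "homeomorphism (ball 0 1) \<Omega> f g" and conv: "convex \<Omega>"
    and bdd: "\<And>w. w \<in> \<Omega> \<Longrightarrow> cmod w \<le> R" and "\<rho> > 0" "ball 0 \<rho> \<subseteq> \<Omega>" and f0: "f 0 = 0"
    and crosscut: "\<And>e \<kappa>0. \<lbrakk>e > 0; \<kappa>0 > 0\<rbrakk> \<Longrightarrow> \<exists>\<kappa>>0. \<kappa> < \<kappa>0 \<and>
      (\<forall>z1 z2. cmod z1 < 1 \<longrightarrow> cmod z2 < 1 \<longrightarrow> cmod (\<zeta> - z1) = \<kappa> * cmod (\<zeta> + z1) \<longrightarrow>
         cmod (\<zeta> - z2) = \<kappa> * cmod (\<zeta> + z2) \<longrightarrow> cmod (f z1 - f z2) \<le> e)"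
    and \<zeta>: "cmod \<zeta> = 1" and "\<epsilon> > 0"
  shows "\<exists>\<eta>>0. \<forall>z\<in>ball 0 1. \<forall>z'\<in>ball 0 1. dist z \<zeta> < \<eta> \<longrightarrow> dist z' \<zeta> < \<eta> \<longrightarrow> dist (f z) (f z') < \<epsilon>"
proof -
  define r where "r = \<rho> / 2"
  have r: "r > 0" "r < \<rho>" using \<open>\<rho> > 0\<close> by (auto simp: r_def)
  have "0 \<in> \<Omega>" using \<open>\<rho> > 0\<close> assms(5) by auto
  then have "R \<ge> 0" using bdd[of 0] by simp
  \<comment> \<open>If both the segment from w to 0 and the detour below meet the \<delta>-ball
    around p, the estimate obtained is |w - p| \<le> (2 \<delta> / r) (r + R) + \<delta>, which is
    at most C \<delta>. In \<delta>, the first term of the minimum keeps \<open>B\<close> inside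
    \<Omega> and the second yields 2 C \<delta> < \<epsilon>.\<close>
  define C where "C = 3 + 2 * (r + R) / r"
  have "C \<ge> 3" using r \<open>R \<ge> 0\<close> by (simp add: C_def)
  define \<delta> where "\<delta> = min ((\<rho> - r) / 3) (\<epsilon> / (3 * C))"
  have \<delta>: "\<delta> > 0" "r + 2 * \<delta> < \<rho>" "2 * C * \<delta> < \<epsilon>"
  proof -
    show "\<delta> > 0" using r \<open>\<epsilon> > 0\<close> \<open>C \<ge> 3\<close> by (simp add: \<delta>_def)
    have "\<delta> \<le> (\<rho> - r) / 3" unfolding \<delta>_def by (rule min.cobounded1)
    then show "r + 2 * \<delta> < \<rho>" using r by simp
    have "\<delta> \<le> \<epsilon> / (3 * C)" unfolding \<delta>_def by (rule min.cobounded2)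
    then have "3 * C * \<delta> \<le> \<epsilon>" using \<open>C \<ge> 3\<close> by (simp add: field_simps)
    moreover have "C * \<delta> > 0" using \<open>\<delta> > 0\<close> \<open>C \<ge> 3\<close> by simp
    ultimately show "2 * C * \<delta> < \<epsilon>" by linarith
  qed
  have gf: "g (f z) = z" if "cmod z < 1" for z
    using homeo that by (auto simp: homeomorphism_def)
  have fg: "f (g w) = w" "cmod (g w) < 1" if "w \<in> \<Omega>" for w
    using homeo that by (auto simp: homeomorphism_def)
  have fO: "f z \<in> \<Omega>" if "cmod z < 1" for z
    using homeo that by (auto simp: homeomorphism_def)
  have cg: "continuous_on \<Omega> g" using homeo by (simp add: homeomorphism_def)
  define B where "B = cball (0::complex) (r + 2 * \<delta>)"
  have B: "B \<subseteq> \<Omega>" using \<delta> assms(5) by (force simp: B_def)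
  have "compact (g ` B)"
    using B cg by (intro compact_continuous_image) (auto simp: B_def intro: continuous_on_subset)
  moreover have "0 \<in> B" using r \<delta> by (simp add: B_def)
  ultimately obtain b where b: "b \<in> B" "\<And>w. w \<in> B \<Longrightarrow> cmod (g w) \<le> cmod (g b)"
    using continuous_attains_sup[of "g ` B" cmod] by (auto intro: continuous_intros)
  \<comment> \<open>Half the distance from the preimage of \<open>B\<close> to the unit circle. As
    |\<zeta> + q| \<le> 2, a point q of a crosscut with \<kappa> < \<kappa>0 lies outside that
    preimage, so f q has modulus above r + 2 \<delta>.\<close>
  define \<kappa>0 where "\<kappa>0 = (1 - cmod (g b)) / 2"
  have \<kappa>0: "\<kappa>0 > 0" "\<kappa>0 \<le> 1/2" using fg[of b] b B by (auto simp: \<kappa>0_def)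
  obtain \<kappa> where \<kappa>: "\<kappa> > 0" "\<kappa> < \<kappa>0" and
    cr: "\<And>z1 z2. \<lbrakk>cmod z1 < 1; cmod z2 < 1; cmod (\<zeta> - z1) = \<kappa> * cmod (\<zeta> + z1); cmod (\<zeta> - z2) = \<kappa> * cmod (\<zeta> + z2)\<rbrakk>
      \<Longrightarrow> cmod (f z1 - f z2) \<le> \<delta>"
    using crosscut[OF \<delta>(1) \<kappa>0(1)] by blast
  \<comment> \<open>The point of the crosscut on the radius towards \<zeta>. Its image p is the
    centre of a \<delta>-ball containing the image of the whole crosscut.\<close>
  define q where "q = \<zeta> * of_real ((1 - \<kappa>) / (1 + \<kappa>))"
  have q: "cmod q < 1" "cmod (\<zeta> - q) = \<kappa> * cmod (\<zeta> + q)"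
  proof -
    have "cmod q = \<bar>(1 - \<kappa>) / (1 + \<kappa>)\<bar>" by (simp only: q_def norm_mult \<zeta> norm_of_real mult_1)
    then show "cmod q < 1" using \<kappa> \<kappa>0 by simp
    have "\<zeta> - q = \<zeta> * of_real (1 - (1 - \<kappa>) / (1 + \<kappa>))" "\<zeta> + q = \<zeta> * of_real (1 + (1 - \<kappa>) / (1 + \<kappa>))"
      by (simp_all add: q_def algebra_simps)
    then have "cmod (\<zeta> - q) = \<bar>1 - (1 - \<kappa>) / (1 + \<kappa>)\<bar>" "cmod (\<zeta> + q) = \<bar>1 + (1 - \<kappa>) / (1 + \<kappa>)\<bar>"
      by (simp_all only: norm_mult \<zeta> norm_of_real mult_1)
    moreover have "1 - (1 - \<kappa>) / (1 + \<kappa>) = \<kappa> * (1 + (1 - \<kappa>) / (1 + \<kappa>))" "0 < 1 + (1 - \<kappa>) / (1 + \<kappa>)"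
      using \<kappa> \<kappa>0 by (simp_all add: field_simps)
    ultimately show "cmod (\<zeta> - q) = \<kappa> * cmod (\<zeta> + q)"
      using \<kappa> by (simp add: abs_mult)
  qed
  define p where "p = f q"
  have p: "cmod p > r + 2 * \<delta>"
  proof (rule ccontr)
    assume "\<not> ?thesis"
    then have "cmod (g p) \<le> cmod (g b)" by (intro b(2)) (simp add: B_def)
    then have le: "cmod q \<le> cmod (g b)" using gf q by (simp add: p_def)
    have "2 * \<kappa>0 \<le> 1 - cmod q" using le by (simp add: \<kappa>0_def)
    also have "\<dots> \<le> cmod (\<zeta> - q)" using norm_triangle_ineq2[of \<zeta> q] \<zeta> by simp
    also have "\<dots> \<le> \<kappa> * 2"
      unfolding q(2) using \<kappa> norm_triangle_ineq[of \<zeta> q] \<zeta> q(1) by (intro mult_left_mono) auto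
    finally show False using \<kappa> by simp
  qed
  have far: "w \<notin> cball p \<delta>" if "cmod w \<le> r" for w
  proof
    assume "w \<in> cball p \<delta>"
    then have "cmod (p - w) \<le> \<delta>" by (simp add: dist_norm)
    then show False using p that \<delta>(1) norm_triangle_ineq2[of p w] by simp
  qed
  \<comment> \<open>Intermediate values: |\<zeta> - g w| - \<kappa> |\<zeta> + g w| is positive at w
    = 0 and negative at w = f z, so a connected set containing both meets the image of the
    crosscut.\<close>
  have avoid: False if K: "connected K" "K \<subseteq> \<Omega>" "K \<inter> cball p \<delta> = {}" "0 \<in> K" "f z \<in> K"
    and z: "cmod z < 1" "cmod (\<zeta> - z) < \<kappa> * cmod (\<zeta> + z)" for K z
  proof -
    have "continuous_on K (\<lambda>w. cmod (\<zeta> - g w) - \<kappa> * cmod (\<zeta> + g w))"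
      using cg K(2) by (intro continuous_intros) (auto intro: continuous_on_subset)
    then have con: "connected ((\<lambda>w. cmod (\<zeta> - g w) - \<kappa> * cmod (\<zeta> + g w)) ` K)"
      using K(1) by (rule connected_continuous_image)
    have g0: "g 0 = 0" using gf[of 0] f0 by simp
    have i0: "1 - \<kappa> \<in> (\<lambda>w. cmod (\<zeta> - g w) - \<kappa> * cmod (\<zeta> + g w)) ` K"
      using K(4) by (intro image_eqI[of _ _ 0]) (auto simp: g0 \<zeta>)
    have i1: "cmod (\<zeta> - z) - \<kappa> * cmod (\<zeta> + z) \<in> (\<lambda>w. cmod (\<zeta> - g w) - \<kappa> * cmod (\<zeta> + g w)) ` K"
      using K(5) by (intro image_eqI[of _ _ "f z"]) (auto simp: gf z)
    have "0 \<in> (\<lambda>w. cmod (\<zeta> - g w) - \<kappa> * cmod (\<zeta> + g w)) ` K"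
      using connectedD_interval[OF con i1 i0, of 0] z \<kappa> \<kappa>0 by simp
    then obtain w where w: "w \<in> K" "cmod (\<zeta> - g w) = \<kappa> * cmod (\<zeta> + g w)" by auto
    then have "cmod (f q - f (g w)) \<le> \<delta>"
      using cr[OF q(1) _ q(2) w(2)] fg K(2) by blast
    then have "w \<in> cball p \<delta>"
      using fg[of w] w K(2) by (auto simp: p_def dist_norm)
    then show False using w K(3) by blast
  qed
  have near: "cmod (f z - p) \<le> C * \<delta>" if z: "cmod z < 1" "cmod (\<zeta> - z) < \<kappa> * cmod (\<zeta> + z)" for z
  proof (rule ccontr)
    assume far_z: "\<not> ?thesis"
    define w where "w = f z"
    have w: "w \<in> \<Omega>" "cmod (w - p) > C * \<delta>" using fO z far_z by (auto simp: w_def)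
    have seg: "closed_segment a b \<subseteq> \<Omega>" if "a \<in> \<Omega>" "b \<in> \<Omega>" for a b
      using conv that by (simp add: closed_segment_subset)
    show False
    proof (cases "closed_segment w 0 \<inter> cball p \<delta> = {}")
      case True
      show False
        by (rule avoid[of "closed_segment w 0" z]) (use True seg w \<open>0 \<in> \<Omega>\<close> z in \<open>auto simp: w_def\<close>)
    next
      case False
      then obtain p' where p': "p' \<in> closed_segment w 0" "p' \<in> cball p \<delta>" by auto
      then obtain a where a: "0 \<le> a" "a \<le> 1" "p' = of_real a * w"
        by (auto simp: closed_segment_def scaleR_conv_of_real) (metis add_diff_cancel_left' add_0 diff_ge_0_iff_ge le_add_diff_inverse of_real_1 of_real_diff diff_le_eq le_add_same_cancel1)
      have "w \<noteq> 0"
        using p'(2) a far[of 0] r by auto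
      \<comment> \<open>The detour leaves w at an angle to the segment towards 0: q0 is w turned by
        a right angle and scaled to norm r. Its second leg, from q0 to 0, stays in the disc of
        radius r, which the ball around p misses.\<close>
      define q0 where "q0 = of_real (r / cmod w) * \<i> * w"
      have q0: "cmod q0 = r" using r \<open>w \<noteq> 0\<close> by (simp add: q0_def norm_mult norm_divide)
      have q0\<Omega>: "q0 \<in> \<Omega>" using q0 r assms(5) by auto
      have s1: "closed_segment w q0 \<inter> cball p \<delta> = {}"
      proof (rule ccontr)
        assume "\<not> ?thesis"
        then obtain x where x: "x \<in> closed_segment w q0" "x \<in> cball p \<delta>" by auto
        then obtain s where s: "0 \<le> s" "s \<le> 1" "x = of_real (1 - s) * w + of_real s * q0"
          by (auto simp: closed_segment_def scaleR_conv_of_real)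
        have "cmod (x - p') \<le> cmod (x - p) + cmod (p' - p)" using norm_triangle_ineq4[of "x - p" "p' - p"] by simp
        also have "\<dots> \<le> 2 * \<delta>" using x(2) p'(2) by (simp add: dist_norm norm_minus_commute)
        finally have xp: "cmod (x - p') \<le> 2 * \<delta>" .
        \<comment> \<open>Division by w separates the components along w and orthogonal to it. The
          orthogonal one is s r / |w|, so closeness of x and p' makes s small, that is, x close to
          w.\<close>
        have e: "(x - p') / w = Complex (1 - s - a) (s * r / cmod w)"
        proof -
          have "x - p' = w * (of_real (1 - s - a) + \<i> * of_real (s * r / cmod w))"
            by (simp add: s a q0_def algebra_simps)
          then show ?thesis using \<open>w \<noteq> 0\<close> by (simp add: Complex_eq)
        qed
        have "s * r / cmod w \<le> cmod ((x - p') / w)"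
          using abs_Im_le_cmod[of "(x - p') / w"] s(1) r by (simp add: e)
        then have "s * r \<le> cmod (x - p')"
          using \<open>w \<noteq> 0\<close> by (simp add: norm_divide divide_simps split: if_splits)
        then have sle: "s \<le> 2 * \<delta> / r" using xp r by (simp add: field_simps)
        have "x - w = of_real s * (q0 - w)" by (simp add: s algebra_simps)
        then have "cmod (x - w) = s * cmod (q0 - w)" using s by (simp add: norm_mult)
        also have "\<dots> \<le> (2 * \<delta> / r) * (r + R)"
          using sle s q0 bdd[OF w(1)] norm_triangle_ineq4[of q0 w] r \<delta> by (intro mult_mono) auto
        finally have "cmod (x - w) \<le> (2 * \<delta> / r) * (r + R)" .
        moreover have "cmod (w - p) \<le> cmod (x - w) + cmod (x - p)"
          using norm_triangle_ineq4[of "x - p" "x - w"] by simp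
        ultimately have "cmod (w - p) \<le> (2 * \<delta> / r) * (r + R) + \<delta>"
          using x(2) by (simp add: dist_norm norm_minus_commute)
        also have "\<dots> \<le> C * \<delta>" using r \<delta> by (simp add: C_def field_simps)
        finally show False using w by simp
      qed
      have s2: "closed_segment q0 0 \<inter> cball p \<delta> = {}"
      proof -
        have "closed_segment q0 0 \<subseteq> cball 0 r"
          using q0 r by (intro closed_segment_subset) auto
        then show ?thesis using far by fastforce
      qed
      show False
      proof (rule avoid[of "closed_segment w q0 \<union> closed_segment q0 0" z])
        show "connected (closed_segment w q0 \<union> closed_segment q0 0)"
          by (intro connected_Un) auto
      qed (use s1 s2 seg w q0\<Omega> \<open>0 \<in> \<Omega>\<close> z in \<open>auto simp: w_def\<close>)
    qed
  qed
  have inN: "cmod (\<zeta> - z) < \<kappa> * cmod (\<zeta> + z)" if "dist z \<zeta> < \<kappa> / 2" for z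
  proof -
    have "2 - cmod (\<zeta> - z) \<le> cmod (\<zeta> + z)"
      using norm_triangle_ineq[of "\<zeta> + z" "\<zeta> - z"] norm_mult[of 2 \<zeta>] \<zeta> by simp
    then have "1 \<le> cmod (\<zeta> + z)" using that \<kappa> \<kappa>0 by (simp add: dist_norm norm_minus_commute)
    then have "\<kappa> * 1 \<le> \<kappa> * cmod (\<zeta> + z)" using \<kappa> by (intro mult_left_mono) auto
    then show ?thesis using that \<kappa>(1) unfolding dist_norm norm_minus_commute[of z] by linarith
  qed
  show ?thesis
  proof (intro exI[of _ "\<kappa> / 2"] conjI ballI impI)
    fix z z' :: complex assume "z \<in> ball 0 1" "z' \<in> ball 0 1" "dist z \<zeta> < \<kappa> / 2" "dist z' \<zeta> < \<kappa> / 2"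
    then have "cmod (f z - p) \<le> C * \<delta>" "cmod (f z' - p) \<le> C * \<delta>"
      using near inN by auto
    then have "dist (f z) (f z') \<le> 2 * C * \<delta>"
      using norm_triangle_ineq4[of "f z - p" "f z' - p"] by (simp add: dist_norm)
    then show "dist (f z) (f z') < \<epsilon>" using \<delta>(3) by simp
  qed (use \<kappa> in auto)
qed

text \<open>Neighbourhoods on which f oscillates by less than \<epsilon> cover the compact closed
  disc. A Lebesgue number of this cover gives uniform continuity on the open disc, hence an
  extension to the closure.\<close>

lemma continuous_extension_cball:
  fixes f :: "complex \<Rightarrow> complex"
  assumes cont: "continuous_on (ball 0 1) f"
    and Cauchy: "\<And>\<zeta> \<epsilon>. \<lbrakk>cmod \<zeta> = 1; \<epsilon> > 0\<rbrakk> \<Longrightarrow>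
      \<exists>\<eta>>0. \<forall>z\<in>ball 0 1. \<forall>z'\<in>ball 0 1. dist z \<zeta> < \<eta> \<longrightarrow> dist z' \<zeta> < \<eta> \<longrightarrow> dist (f z) (f z') < \<epsilon>"
  obtains F where "continuous_on (cball 0 1) F" "\<And>z. z \<in> ball 0 1 \<Longrightarrow> F z = f z"
proof -
  have "uniformly_continuous_on (ball 0 1) f"
    unfolding uniformly_continuous_on_def
  proof (intro allI impI)
    fix \<epsilon> :: real assume "\<epsilon> > 0"
    have "\<exists>\<eta>>0. \<forall>z\<in>ball 0 1. \<forall>z'\<in>ball 0 1. dist z \<zeta> < \<eta> \<longrightarrow> dist z' \<zeta> < \<eta> \<longrightarrow> dist (f z) (f z') < \<epsilon>"
      if "\<zeta> \<in> cball 0 1" for \<zeta>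
    proof (cases "cmod \<zeta> = 1")
      case True
      then show ?thesis using Cauchy \<open>\<epsilon> > 0\<close> by blast
    next
      case False
      then have "\<zeta> \<in> ball 0 1" using that by auto
      then obtain \<eta> where \<eta>: "\<eta> > 0" "\<And>z. z \<in> ball 0 1 \<Longrightarrow> dist z \<zeta> < \<eta> \<Longrightarrow> dist (f z) (f \<zeta>) < \<epsilon> / 2"
        using cont \<open>\<epsilon> > 0\<close> unfolding continuous_on_iff by (meson half_gt_zero)
      then show ?thesis
        by (intro exI[of _ \<eta>] conjI ballI impI) (auto intro!: dist_triangle_half_l[of _ "f \<zeta>" \<epsilon>] simp del: less_divide_eq_numeral1)
    qed
    then obtain \<eta> where \<eta>: "\<And>\<zeta>. \<zeta> \<in> cball 0 1 \<Longrightarrow> \<eta> \<zeta> > 0"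
      "\<And>\<zeta> z z'. \<lbrakk>\<zeta> \<in> cball 0 1; z \<in> ball 0 1; z' \<in> ball 0 1; dist z \<zeta> < \<eta> \<zeta>; dist z' \<zeta> < \<eta> \<zeta>\<rbrakk> \<Longrightarrow> dist (f z) (f z') < \<epsilon>"
      by metis
    obtain e where e: "e > 0" "\<And>x. x \<in> cball (0::complex) 1 \<Longrightarrow> \<exists>G\<in>(\<lambda>\<zeta>. ball \<zeta> (\<eta> \<zeta>)) ` cball 0 1. ball x e \<subseteq> G"
    proof (rule Heine_Borel_lemma[of "cball (0::complex) 1" "(\<lambda>\<zeta>. ball \<zeta> (\<eta> \<zeta>)) ` cball 0 1"])
      show "cball 0 1 \<subseteq> \<Union> ((\<lambda>\<zeta>. ball \<zeta> (\<eta> \<zeta>)) ` cball 0 1)"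
        using \<eta>(1) by fastforce
    qed auto
    show "\<exists>d>0. \<forall>x\<in>ball 0 1. \<forall>x'\<in>ball 0 1. dist x' x < d \<longrightarrow> dist (f x') (f x) < \<epsilon>"
    proof (intro exI[of _ e] conjI ballI impI)
      fix x x' :: complex assume x: "x \<in> ball 0 1" "x' \<in> ball 0 1" "dist x' x < e"
      then obtain \<zeta> where \<zeta>: "\<zeta> \<in> cball 0 1" "ball x e \<subseteq> ball \<zeta> (\<eta> \<zeta>)" using e(2)[of x] by auto
      then have "x \<in> ball \<zeta> (\<eta> \<zeta>)" "x' \<in> ball \<zeta> (\<eta> \<zeta>)" using x e(1) by (auto simp: dist_commute subset_eq)
      then show "dist (f x') (f x) < \<epsilon>" using \<eta>(2)[OF \<zeta>(1)] x by (simp add: dist_commute)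
    qed (use e in auto)
  qed
  then obtain F where "uniformly_continuous_on (closure (ball 0 1)) F" "\<And>x. x \<in> ball 0 1 \<Longrightarrow> f x = F x"
    by (rule uniformly_continuous_on_extension_on_closure) blast
  then show ?thesis using that by (metis closure_ball uniformly_continuous_imp_continuous zero_less_one)
qed

section \<open>Crossing paths and boundary monotonicity\<close>

text \<open>Near each endpoint a short radial segment stays above level c by continuity, and the
  open connected superlevel set is path connected. Meeting the circle only at its ends keeps the
  path away from the pole of the Cayley transform in \<open>boundary_crossing\<close>.\<close>

lemma boundary_path:
  fixes u :: "complex \<Rightarrow> real"
  assumes cont: "continuous_on (cball 0 1) u" and conn: "connected {z \<in> ball 0 1. c < u z}"
    and \<zeta>: "cmod \<zeta>1 = 1" "cmod \<zeta>2 = 1" "c < u \<zeta>1" "c < u \<zeta>2"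
  obtains p where "path p" "pathstart p = \<zeta>1" "pathfinish p = \<zeta>2"
    "\<And>z. z \<in> path_image p \<Longrightarrow> z \<in> cball 0 1 \<and> c < u z"
    "path_image p \<inter> sphere 0 1 \<subseteq> {\<zeta>1, \<zeta>2}"
proof -
  have radial: "\<exists>r. 0 < r \<and> r < 1 \<and> (\<forall>t. r \<le> t \<longrightarrow> t \<le> 1 \<longrightarrow> c < u (of_real t * \<zeta>))"
    if "cmod \<zeta> = 1" "c < u \<zeta>" for \<zeta>
  proof -
    have "continuous_on {0..1} (\<lambda>t. u (of_real t * \<zeta>))"
      by (rule continuous_on_compose2[OF cont]) (auto intro!: continuous_intros simp: norm_mult that)
    moreover have "(1::real) \<in> {0..1}" "0 < u \<zeta> - c" using that by simp_all
    ultimately have "\<exists>d>0. \<forall>t\<in>{0..1}. dist t 1 < d \<longrightarrow> dist (u (of_real t * \<zeta>)) (u (of_real 1 * \<zeta>)) < u \<zeta> - c"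
      unfolding continuous_on_iff by blast
    then obtain d where d: "d > 0" "\<And>t. 0 \<le> t \<Longrightarrow> t \<le> 1 \<Longrightarrow> dist t 1 < d \<Longrightarrow> dist (u (of_real t * \<zeta>)) (u \<zeta>) < u \<zeta> - c"
      by (metis atLeastAtMost_iff mult_1 of_real_1)
    show ?thesis
    proof (intro exI[of _ "max (1/2) (1 - d / 2)"] conjI allI impI)
      fix t assume "max (1/2) (1 - d/2) \<le> t" "t \<le> 1"
      then have "dist (u (of_real t * \<zeta>)) (u \<zeta>) < u \<zeta> - c"
        using d(1) by (intro d(2)) (auto simp: dist_real_def)
      then show "c < u (of_real t * \<zeta>)" unfolding dist_real_def by linarith
    qed (use d(1) in auto)
  qed
  obtain r1 where r1: "0 < r1" "r1 < 1" "\<And>t. r1 \<le> t \<Longrightarrow> t \<le> 1 \<Longrightarrow> c < u (of_real t * \<zeta>1)"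
    using radial[OF \<zeta>(1,3)] by blast
  obtain r2 where r2: "0 < r2" "r2 < 1" "\<And>t. r2 \<le> t \<Longrightarrow> t \<le> 1 \<Longrightarrow> c < u (of_real t * \<zeta>2)"
    using radial[OF \<zeta>(2,4)] by blast
  define a where "a = of_real r1 * \<zeta>1"
  define b where "b = of_real r2 * \<zeta>2"
  have "continuous_on (ball 0 1) u" using cont by (rule continuous_on_subset) auto
  then have "open (u -` {c<..} \<inter> ball 0 1)"
    by (rule continuous_on_open_vimage[OF open_ball, THEN iffD1, rule_format]) simp
  also have "u -` {c<..} \<inter> ball 0 1 = {z \<in> ball 0 1. c < u z}" by auto
  finally have "path_connected {z \<in> ball 0 1. c < u z}"
    using conn by (intro connected_open_path_connected)
  moreover have "a \<in> {z \<in> ball 0 1. c < u z}" "b \<in> {z \<in> ball 0 1. c < u z}"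
    using r1(1,2) r2(1,2) r1(3)[of r1] r2(3)[of r2] \<zeta>(1,2) by (simp_all add: a_def b_def norm_mult)
  ultimately obtain g where g: "path g" "path_image g \<subseteq> {z \<in> ball 0 1. c < u z}" "pathstart g = a" "pathfinish g = b"
    unfolding path_connected_def by blast
  define p where "p = linepath \<zeta>1 a +++ (g +++ linepath b \<zeta>2)"
  have seg: "z \<in> cball 0 1 \<and> c < u z \<and> (cmod z = 1 \<longrightarrow> z = \<zeta>)"
    if z: "z \<in> closed_segment (of_real r * \<zeta>) \<zeta>" and r: "0 < r" "r < 1" "\<And>t. r \<le> t \<Longrightarrow> t \<le> 1 \<Longrightarrow> c < u (of_real t * \<zeta>)"
      and "cmod \<zeta> = 1" for z \<zeta> r
  proof -
    obtain s where s: "0 \<le> s" "s \<le> 1" "z = (1 - s) *\<^sub>R (of_real r * \<zeta>) + s *\<^sub>R \<zeta>"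
      using z by (auto simp: closed_segment_def)
    define t where "t = (1 - s) * r + s"
    have zt: "z = of_real t * \<zeta>" by (simp add: s t_def scaleR_conv_of_real algebra_simps)
    have "t - r = s * (1 - r)" "1 - t = (1 - s) * (1 - r)" by (simp_all add: t_def algebra_simps)
    then have "0 \<le> t - r" "0 \<le> 1 - t" using s(1,2) r(2) by simp_all
    then have t: "r \<le> t" "t \<le> 1" by simp_all
    have "cmod z = t" using t r(1) \<open>cmod \<zeta> = 1\<close> by (simp add: zt norm_mult)
    moreover have "c < u z" unfolding zt by (rule r(3)[OF t])
    ultimately show ?thesis using t by (auto simp: zt)
  qed
  have img: "path_image p \<subseteq> closed_segment a \<zeta>1 \<union> path_image g \<union> closed_segment b \<zeta>2"
    unfolding p_def using g(3,4) by (simp add: path_image_join closed_segment_commute[of \<zeta>1 a]) blast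
  show ?thesis
  proof
    show "path p" "pathstart p = \<zeta>1" "pathfinish p = \<zeta>2"
      using g(1,3,4) by (simp_all add: p_def)
    have cases: "z \<in> cball 0 1 \<and> c < u z \<and> (cmod z = 1 \<longrightarrow> z \<in> {\<zeta>1, \<zeta>2})" if zp: "z \<in> path_image p" for z
    proof -
      consider "z \<in> closed_segment a \<zeta>1" | "z \<in> path_image g" | "z \<in> closed_segment b \<zeta>2"
        using subsetD[OF img zp] by blast
      then show ?thesis
      proof cases
        case 1
        then show ?thesis using seg[OF _ r1 \<zeta>(1), of z] by (simp add: a_def)
      next
        case 2
        then show ?thesis using g(2) by auto
      next
        case 3
        then show ?thesis using seg[OF _ r2 \<zeta>(2), of z] by (simp add: b_def)
      qed
    qed
    show "z \<in> cball 0 1 \<and> c < u z" if "z \<in> path_image p" for z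
      using cases[OF that] by simp
    show "path_image p \<inter> sphere 0 1 \<subseteq> {\<zeta>1, \<zeta>2}"
    proof
      fix z assume "z \<in> path_image p \<inter> sphere 0 1"
      then show "z \<in> {\<zeta>1, \<zeta>2}" using cases[of z] by simp
    qed
  qed
qed

section \<open>Alternating values at four points of the circle\<close>

lemma cot_strict_antimono:
  fixes a b :: real
  assumes "0 < a" "a < b" "b < pi"
  shows "cos b / sin b < cos a / sin a"
proof -
  have "sin a > 0" "sin b > 0" "sin (b - a) > 0" using assms by (auto intro!: sin_gt_zero)
  then show ?thesis by (simp add: divide_simps sin_diff algebra_simps)
qed

text \<open>The factor cis ((\<tau> + s) / 2) cancels and leaves a cotangent. So this Cayley
  transform takes the circle without cis \<tau> to the real line, and it does so increasingly in
  s.\<close>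

lemma cayley_cis:
  assumes "0 < \<tau> - s" "\<tau> - s < 2 * pi"
  shows "\<i> * (cis \<tau> + cis s) / (cis \<tau> - cis s) = of_real (cos ((\<tau> - s) / 2) / sin ((\<tau> - s) / 2))"
proof -
  define m a where "m = (\<tau> + s) / 2" and "a = (\<tau> - s) / 2"
  have eq: "\<tau> = m + a" "s = m + - a" by (simp_all add: m_def a_def field_simps)
  have "cis \<tau> = cis m * cis a" "cis s = cis m * cis (-a)"
    unfolding eq cis_mult by (rule refl)+
  moreover have "cis a + cis (-a) = 2 * of_real (cos a)" "cis a - cis (-a) = 2 * \<i> * of_real (sin a)"
    by (simp_all add: complex_eq_iff)
  ultimately have sum: "cis \<tau> + cis s = cis m * (2 * of_real (cos a))"
    and diff: "cis \<tau> - cis s = cis m * (2 * \<i> * of_real (sin a))"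
    by (metis distrib_left, metis right_diff_distrib)
  have "sin a > 0" using assms by (intro sin_gt_zero) (auto simp: a_def)
  then show ?thesis unfolding sum diff a_def[symmetric] by simp
qed

lemma cis_neq:
  assumes "s < t" "t < s + 2 * pi"
  shows "cis s \<noteq> cis t"
proof
  assume "cis s = cis t"
  then have "cis (t - s) = 1" by (simp add: cis_divide[symmetric])
  moreover have "sin ((t - s) / 2) > 0" using assms by (intro sin_gt_zero) auto
  ultimately show False
    using cos_double_sin[of "(t - s) / 2"] by (simp add: complex_eq_iff diff_divide_distrib[symmetric] right_diff_distrib[symmetric] del: right_diff_distrib_numeral)
qed

text \<open>A path above level c from cis s1 to cis s3 and one below it from cis s2 to cis s4 have
  interlaced ends on the circle, so they meet, at a point where u is both above and below c. The
  Cayley transform puts the four ends in order on the lower edge of a box, as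
  \<open>fashoda_interlace\<close> requires.\<close>

lemma boundary_crossing:
  fixes u :: "complex \<Rightarrow> real"
  assumes cont: "continuous_on (cball 0 1) u"
    and conn: "connected {z \<in> ball 0 1. c < u z}" "connected {z \<in> ball 0 1. u z < c}"
    and s: "s1 < s2" "s2 < s3" "s3 < s4" "s4 < s1 + 2 * pi"
    and u: "c < u (cis s1)" "u (cis s2) < c" "c < u (cis s3)" "u (cis s4) < c"
  shows False
proof -
  \<comment> \<open>The pole goes into the arc from cis s4 back to cis s1, which contains none of
    the other two points.\<close>
  define \<tau> where "\<tau> = (s4 + s1 + 2 * pi) / 2"
  have \<tau>: "s4 < \<tau>" "\<tau> < s1 + 2 * pi" using s by (auto simp: \<tau>_def)
  define M where "M z = \<i> * (cis \<tau> + z) / (cis \<tau> - z)" for z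
  define X where "X s = cos ((\<tau> - s) / 2) / sin ((\<tau> - s) / 2)" for s
  have Mcis: "M (cis s) = of_real (X s)" if "s1 \<le> s" "s \<le> s4" for s
    unfolding M_def X_def by (rule cayley_cis) (use that \<tau> in auto)
  have ne: "cis s \<noteq> cis \<tau>" if "s1 \<le> s" "s \<le> s4" for s
    using cis_neq[of s \<tau>] that \<tau> by force
  have X: "X s < X t" if "s1 \<le> s" "s < t" "t \<le> s4" for s t
    unfolding X_def by (rule cot_strict_antimono) (use that \<tau> s in auto)
  obtain p where p: "path p" "pathstart p = cis s1" "pathfinish p = cis s3"
    "\<And>z. z \<in> path_image p \<Longrightarrow> z \<in> cball 0 1 \<and> c < u z" "path_image p \<inter> sphere 0 1 \<subseteq> {cis s1, cis s3}"
    by (rule boundary_path[OF cont conn(1) norm_cis norm_cis u(1) u(3)]) blast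
  have conn2: "connected {z \<in> ball 0 1. - c < - u z}" using conn(2) by simp
  obtain q where q: "path q" "pathstart q = cis s2" "pathfinish q = cis s4"
    "\<And>z. z \<in> path_image q \<Longrightarrow> z \<in> cball 0 1 \<and> u z < c" "path_image q \<inter> sphere 0 1 \<subseteq> {cis s2, cis s4}"
  proof (rule boundary_path[OF continuous_on_minus[OF cont] conn2 norm_cis norm_cis])
    show "- c < - u (cis s2)" "- c < - u (cis s4)" using u by simp_all
  qed force
  define D where "D = cball 0 1 - {cis \<tau>}"
  have "cis \<tau> \<notin> path_image p" "cis \<tau> \<notin> path_image q"
  proof -
    have "cis \<tau> \<in> sphere 0 1" by simp
    moreover have "cis s1 \<noteq> cis \<tau>" "cis s2 \<noteq> cis \<tau>" "cis s3 \<noteq> cis \<tau>" "cis s4 \<noteq> cis \<tau>"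
      using ne[of s1] ne[of s2] ne[of s3] ne[of s4] s by simp_all
    ultimately show "cis \<tau> \<notin> path_image p" "cis \<tau> \<notin> path_image q"
      using p(5) q(5) by (metis IntI empty_iff insert_iff subsetD)+
  qed
  then have pD: "path_image p \<subseteq> D" and qD: "path_image q \<subseteq> D"
    using p(4) q(4) by (auto simp: D_def)
  have cM: "continuous_on D (\<lambda>z. vec_of_complex (M z))"
  proof -
    have "continuous_on D M" unfolding M_def by (intro continuous_intros) (auto simp: D_def)
    then show ?thesis
      by (rule continuous_on_compose2[OF linear_continuous_on[OF bounded_linear_vec_of_complex]]) auto
  qed
  have ImM: "Im (M z) \<ge> 0" if "z \<in> D" for z
  proof -
    have "Re ((cis \<tau> + z) * cnj (cis \<tau> - z)) = (cmod (cis \<tau>))\<^sup>2 - (cmod z)\<^sup>2"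
      unfolding cmod_power2 by (simp add: power2_eq_square algebra_simps)
    also have "\<dots> \<ge> 0" using that by (simp add: D_def power_le_one)
    finally have "Re ((cis \<tau> + z) / (cis \<tau> - z)) \<ge> 0" by (simp only: Re_complex_div_ge_0)
    then show ?thesis unfolding M_def times_divide_eq_right[symmetric] by (subst Im_i_times)
  qed
  have injM: "z = w" if "z \<in> D" "w \<in> D" "M z = M w" for z w
  proof -
    have "(cis \<tau> + z) * (cis \<tau> - w) = (cis \<tau> + w) * (cis \<tau> - z)"
      using that by (auto simp: M_def D_def field_simps)
    then show ?thesis by (simp add: algebra_simps)
  qed
  define P where "P = (\<lambda>z. vec_of_complex (M z)) \<circ> p"
  define Q where "Q = (\<lambda>z. vec_of_complex (M z)) \<circ> q"
  have PQ: "path P" "path Q"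
    unfolding P_def Q_def
    by (rule path_continuous_image p(1) q(1) continuous_on_subset[OF cM] pD qD)+
  have iP: "path_image P = (\<lambda>z. vec_of_complex (M z)) ` path_image p"
    and iQ: "path_image Q = (\<lambda>z. vec_of_complex (M z)) ` path_image q"
    by (simp_all add: P_def Q_def path_image_compose)
  have "bounded (path_image P \<union> path_image Q)"
    using PQ by (simp add: bounded_path_image)
  then obtain B where B: "\<And>v. v \<in> path_image P \<union> path_image Q \<Longrightarrow> norm v \<le> B"
    by (auto simp: bounded_iff)
  \<comment> \<open>Both image paths are bounded and lie in the closed upper half-plane, hence in
    the box from -B to B by 0 to B; their ends are real and so lie on its lower edge.\<close>
  define a where "a = (vector [- B, 0] :: real^2)"
  define b where "b = (vector [B, B] :: real^2)"
  have ab [simp]: "a$1 = - B" "a$2 = 0" "b$1 = B" "b$2 = B" by (simp_all add: a_def b_def)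
  have box: "v \<in> cbox a b" if "v \<in> path_image P \<union> path_image Q" for v
  proof -
    have "v$2 \<ge> 0" using that ImM pD qD by (auto simp: iP iQ)
    moreover have "\<bar>v$1\<bar> \<le> B" "\<bar>v$2\<bar> \<le> B"
      using B[OF that] component_le_norm_cart[of v] by (meson order_trans)+
    ultimately show ?thesis by (auto simp: mem_box_cart forall_2)
  qed
  have ends: "pathstart P = vec_of_complex (X s1)" "pathfinish P = vec_of_complex (X s3)"
    "pathstart Q = vec_of_complex (X s2)" "pathfinish Q = vec_of_complex (X s4)"
    using s by (auto simp: P_def Q_def pathstart_compose pathfinish_compose p q Mcis)
  obtain v where v: "v \<in> path_image P" "v \<in> path_image Q"
  proof (rule fashoda_interlace[OF PQ])
    show "path_image P \<subseteq> cbox a b" "path_image Q \<subseteq> cbox a b" using box by blast+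
    show "pathstart P $ 1 < pathstart Q $ 1" "pathstart Q $ 1 < pathfinish P $ 1" "pathfinish P $ 1 < pathfinish Q $ 1"
      using s by (simp_all add: ends X)
  qed (simp_all add: ends)
  then obtain z w where zw: "z \<in> path_image p" "w \<in> path_image q" "vec_of_complex (M z) = vec_of_complex (M w)"
    by (auto simp: iP iQ)
  have "M z = M w" using zw(3) by (metis complex_of_vec_simps(3))
  then have "z = w" using injM zw pD qD by blast
  then show False using p(4)[OF zw(1)] q(4)[OF zw(2)] by simp
qed

section \<open>Maximum sets and antipodal extremal points\<close>

lemma sphere_two_points:
  fixes \<zeta>1 \<zeta>2 :: complex
  assumes "cmod \<zeta>1 = 1" "cmod \<zeta>2 = 1" "\<zeta>1 \<noteq> \<zeta>2"
  obtains s t where "s < t" "t < s + 2 * pi" "\<zeta>1 = cis s" "\<zeta>2 = cis t"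
proof -
  have c: "cis (Arg \<zeta>1) = \<zeta>1" "cis (Arg \<zeta>2) = \<zeta>2"
    using assms rcis_cmod_Arg by (metis rcis_def mult_1 of_real_1)+
  have b: "- pi < Arg \<zeta>1" "Arg \<zeta>1 \<le> pi" "- pi < Arg \<zeta>2" "Arg \<zeta>2 \<le> pi"
    by (simp_all add: mpi_less_Arg Arg_le_pi)
  have ne: "Arg \<zeta>1 \<noteq> Arg \<zeta>2" using c assms(3) by metis
  show ?thesis
  proof (cases "Arg \<zeta>1 < Arg \<zeta>2")
    case True
    then show ?thesis using that[of "Arg \<zeta>1" "Arg \<zeta>2"] b c by simp
  next
    case False
    have "cis (Arg \<zeta>2 + 2 * pi) = \<zeta>2"
      using c by (simp add: complex_eq_iff)
    then show ?thesis using that[of "Arg \<zeta>1" "Arg \<zeta>2 + 2 * pi"] b c ne False by simp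
  qed
qed

text \<open>If both arcs between two maximum points contained smaller values, a level between those
  values and the maximum would give the alternating pattern excluded by
  \<open>boundary_crossing\<close>. Hence one whole arc consists of maximum points and joins the
  two.\<close>

lemma connected_max_set:
  fixes u :: "complex \<Rightarrow> real"
  assumes cont: "continuous_on (cball 0 1) u"
    and conn: "\<And>c. connected {z \<in> ball 0 1. c < u z}" "\<And>c. connected {z \<in> ball 0 1. u z < c}"
  shows "connected {\<zeta> \<in> sphere 0 1. \<forall>\<xi>\<in>sphere 0 1. u \<xi> \<le> u \<zeta>}" (is "connected ?M")
proof (rule connected_iff_connected_component[THEN iffD2], intro ballI)
  fix \<zeta>1 \<zeta>2 assume M: "\<zeta>1 \<in> ?M" "\<zeta>2 \<in> ?M"
  show "connected_component ?M \<zeta>1 \<zeta>2"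
  proof (cases "\<zeta>1 = \<zeta>2")
    case True
    then show ?thesis using M by simp
  next
    case False
    then obtain s t where st: "s < t" "t < s + 2 * pi" "\<zeta>1 = cis s" "\<zeta>2 = cis t"
      using sphere_two_points[of \<zeta>1 \<zeta>2] M by auto
    define m where "m = u \<zeta>1"
    have m: "u \<zeta>2 = m" "\<And>x. u (cis x) \<le> m"
      using M by (auto simp: m_def intro: antisym)
    have inM: "cis x \<in> ?M \<longleftrightarrow> u (cis x) = m" for x
      using M m by (auto simp: m_def intro: antisym)
    have con: "connected (cis ` {a..b})" for a b
      by (intro connected_continuous_image continuous_intros) auto
    consider "cis ` {s..t} \<subseteq> ?M" | "cis ` {t..s + 2 * pi} \<subseteq> ?M"
      | a b where "a \<in> {s..t}" "b \<in> {t..s + 2 * pi}" "u (cis a) < m" "u (cis b) < m"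
    proof -
      have "\<exists>x\<in>{a..b}. u (cis x) < m" if "\<not> cis ` {a..b} \<subseteq> ?M" for a b
      proof -
        obtain x where "x \<in> {a..b}" "cis x \<notin> ?M" using \<open>\<not> cis ` {a..b} \<subseteq> ?M\<close> by blast
        then show ?thesis using inM[of x] m(2)[of x] by force
      qed
      then show thesis using that by meson
    qed
    then show ?thesis
    proof cases
      case 1
      then show ?thesis using con[of s t] st
        by (intro connected_componentI[of "cis ` {s..t}"]) auto
    next
      case 2
      have "cis (s + 2 * pi) = cis s" by (simp add: complex_eq_iff)
      then have "cis s \<in> cis ` {t..s + 2 * pi}" using st by (intro image_eqI[of _ _ "s + 2 * pi"]) auto
      then show ?thesis using 2 con[of t "s + 2 * pi"] st
        by (intro connected_componentI[of "cis ` {t..s + 2 * pi}"]) auto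
    next
      case 3
      define c where "c = (max (u (cis a)) (u (cis b)) + m) / 2"
      have c: "u (cis a) < c" "u (cis b) < c" "c < m" using 3 by (auto simp: c_def max_def)
      have um: "u (cis s) = m" "u (cis t) = m" using st m by (auto simp: m_def)
      have "cis (s + 2 * pi) = cis s" by (simp add: complex_eq_iff)
      then have "a \<noteq> s" "a \<noteq> t" "b \<noteq> t" "b \<noteq> s + 2 * pi" using 3 um by auto
      then have "s < a" "a < t" "t < b" "b < s + 2 * pi" using 3 by auto
      then show ?thesis
        using boundary_crossing[OF cont conn[of c], of s a t b] c um by simp
    qed
  qed
qed

text \<open>P consists of the directions having a maximum point and a minimum point, the latter being
  reached from the former by a positive angle of at most pi.  P and -P cover the circle of directions, so they
  meet, and over a common direction the connected set of such pairs contains an antipodal one.\<close>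

lemma antipodal_support:
  fixes \<gamma> :: "complex \<Rightarrow> complex"
  assumes cont: "continuous_on (cball 0 1) \<gamma>"
    and conn: "\<And>l c. cmod l = 1 \<Longrightarrow> connected {z \<in> ball 0 1. c < Re (l * \<gamma> z)}"
    and nonconst: "\<And>l. cmod l = 1 \<Longrightarrow> \<exists>\<xi>\<in>sphere 0 1. \<exists>\<xi>'\<in>sphere 0 1. Re (l * \<gamma> \<xi>) \<noteq> Re (l * \<gamma> \<xi>')"
  obtains l \<zeta> where "cmod l = 1" "cmod \<zeta> = 1"
    "\<And>\<xi>. cmod \<xi> = 1 \<Longrightarrow> Re (l * \<gamma> \<xi>) \<le> Re (l * \<gamma> \<zeta>)"
    "\<And>\<xi>. cmod \<xi> = 1 \<Longrightarrow> Re (l * \<gamma> (- \<zeta>)) \<le> Re (l * \<gamma> \<xi>)"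
proof -
  define S where "S = sphere (0::complex) 1"
  have S: "compact S" "connected S" by (auto simp: S_def intro: connected_sphere)
  have contS: "continuous_on S \<gamma>" using cont by (rule continuous_on_subset) (auto simp: S_def)
  define Max where "Max l = {\<zeta> \<in> S. \<forall>\<xi>\<in>S. Re (l * \<gamma> \<xi>) \<le> Re (l * \<gamma> \<zeta>)}" for l
  have Max_conn: "connected (Max l)" if "cmod l = 1" for l
  proof -
    have "connected {z \<in> ball 0 1. Re (l * \<gamma> z) < c}" for c
    proof -
      have "{z \<in> ball 0 1. Re (l * \<gamma> z) < c} = {z \<in> ball 0 1. - c < Re (- l * \<gamma> z)}" by auto
      then show ?thesis using conn[of "- l" "- c"] that by simp
    qed
    then show ?thesis
      unfolding Max_def S_def using cont conn[OF that]
      by (intro connected_max_set continuous_intros)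
  qed
  have Max_ne: "Max l \<noteq> {}" for l
  proof -
    have "S \<noteq> {}" by (simp add: S_def)
    then have "\<exists>x\<in>S. \<forall>y\<in>S. Re (l * \<gamma> y) \<le> Re (l * \<gamma> x)"
      using S(1) contS by (intro continuous_attains_sup continuous_intros)
    then show ?thesis by (auto simp: Max_def)
  qed
  define K where "K = {(l, \<zeta>, \<eta>) \<in> S \<times> S \<times> S. \<zeta> \<in> Max l \<and> \<eta> \<in> Max (- l) \<and> 0 \<le> Im (\<eta> * cnj \<zeta>)}"
  define P where "P = fst ` K"
  have "closed K"
  proof -
    have clS: "closed (S \<times> S \<times> S)" using S(1) by (intro closed_Times compact_imp_closed) auto
    have g1: "continuous_on (S \<times> S \<times> S) (\<lambda>x. \<gamma> (fst (snd x)))"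
      by (rule continuous_on_compose2[OF contS]) (auto intro!: continuous_intros)
    have g2: "continuous_on (S \<times> S \<times> S) (\<lambda>x. \<gamma> (snd (snd x)))"
      by (rule continuous_on_compose2[OF contS]) (auto intro!: continuous_intros)
    have cl: "closed {x \<in> S \<times> S \<times> S. f x \<le> (g x :: real)}"
      if "continuous_on (S \<times> S \<times> S) f" "continuous_on (S \<times> S \<times> S) g" for f g
      using continuous_on_closed_Collect_le[OF that clS] .
    have K_eq: "K = (S \<times> S \<times> S)
       \<inter> (\<Inter>\<xi>\<in>S. {x \<in> S \<times> S \<times> S. Re (fst x * \<gamma> \<xi>) \<le> Re (fst x * \<gamma> (fst (snd x)))})
       \<inter> (\<Inter>\<xi>\<in>S. {x \<in> S \<times> S \<times> S. Re (- fst x * \<gamma> \<xi>) \<le> Re (- fst x * \<gamma> (snd (snd x)))})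
       \<inter> {x \<in> S \<times> S \<times> S. 0 \<le> Im (snd (snd x) * cnj (fst (snd x)))}"
    proof (rule set_eqI)
      fix x :: "complex \<times> complex \<times> complex"
      obtain l \<zeta> \<eta> where x: "x = (l, \<zeta>, \<eta>)" by (metis surj_pair)
      show "x \<in> K \<longleftrightarrow> x \<in> (S \<times> S \<times> S)
       \<inter> (\<Inter>\<xi>\<in>S. {x \<in> S \<times> S \<times> S. Re (fst x * \<gamma> \<xi>) \<le> Re (fst x * \<gamma> (fst (snd x)))})
       \<inter> (\<Inter>\<xi>\<in>S. {x \<in> S \<times> S \<times> S. Re (- fst x * \<gamma> \<xi>) \<le> Re (- fst x * \<gamma> (snd (snd x)))})
       \<inter> {x \<in> S \<times> S \<times> S. 0 \<le> Im (snd (snd x) * cnj (fst (snd x)))}"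
        unfolding x K_def Max_def
        by (simp only: mem_Collect_eq case_prod_conv Int_iff INT_iff mem_Times_iff fst_conv snd_conv) blast
    qed
    show ?thesis unfolding K_eq
      by (intro closed_Int closed_INT ballI clS cl continuous_intros g1 g2)
  qed
  moreover have "K \<subseteq> S \<times> S \<times> S" by (auto simp: K_def)
  moreover have "compact (S \<times> S \<times> S)" using S(1) by (intro compact_Times)
  ultimately have "compact K" by (metis compact_Int_closed inf.absorb_iff2)
  then have "compact P" unfolding P_def by (intro compact_continuous_image continuous_intros)
  then have clP: "closed P" "closed (uminus ` P)"
    by (auto intro: compact_imp_closed compact_negations)
  have P_sub: "P \<subseteq> S" by (auto simp: P_def K_def)
  \<comment> \<open>Exchanging the maximum point and the minimum point replaces l by -l and reverses
    the sign of Im (\<eta> cnj \<zeta>).\<close>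
  have cover: "l \<in> P \<or> l \<in> uminus ` P" if "l \<in> S" for l
  proof -
    obtain \<zeta> \<eta> where z: "\<zeta> \<in> Max l" "\<eta> \<in> Max (- l)" using Max_ne by blast
    then have inS: "\<zeta> \<in> S" "\<eta> \<in> S" by (auto simp: Max_def)
    show ?thesis
    proof (cases "0 \<le> Im (\<eta> * cnj \<zeta>)")
      case True
      then have "(l, \<zeta>, \<eta>) \<in> K" using z inS that by (simp add: K_def)
      then show ?thesis unfolding P_def by force
    next
      case False
      then have "0 \<le> Im (\<zeta> * cnj \<eta>)" by (simp add: algebra_simps)
      then have "(- l, \<eta>, \<zeta>) \<in> K" using z inS that by (simp add: K_def S_def)
      then have "- l \<in> P" unfolding P_def by force
      then show ?thesis by force
    qed
  qed
  have "P \<noteq> {}" using cover[of 1] by (auto simp: S_def)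
  then obtain l0 where l0: "l0 \<in> P" by blast
  then have "l0 \<in> S" using P_sub by blast
  then have l0': "- l0 \<in> uminus ` P \<inter> S" using l0 by (simp add: S_def)
  have "P \<inter> uminus ` P \<inter> S \<noteq> {}"
  proof
    assume emp: "P \<inter> uminus ` P \<inter> S = {}"
    have "S \<subseteq> P \<union> uminus ` P" using cover by blast
    then have "P \<inter> S = {} \<or> uminus ` P \<inter> S = {}"
      using S(2)[unfolded connected_closed] clP emp by blast
    then show False using l0 l0' \<open>l0 \<in> S\<close> by blast
  qed
  then obtain l where l': "l \<in> P" "l \<in> uminus ` P" "l \<in> S" by blast
  then obtain l2 where "l2 \<in> P" "l = - l2" by blast
  then have l: "l \<in> P" "- l \<in> P" "l \<in> S" using l' by simp_all
  obtain \<zeta>1 \<eta>1 where 1: "\<zeta>1 \<in> Max l" "\<eta>1 \<in> Max (- l)" "0 \<le> Im (\<eta>1 * cnj \<zeta>1)"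
    using l(1) by (auto simp: P_def K_def)
  obtain \<zeta>2 \<eta>2 where 2: "\<zeta>2 \<in> Max (- l)" "\<eta>2 \<in> Max l" "0 \<le> Im (\<eta>2 * cnj \<zeta>2)"
    using l(2) by (auto simp: P_def K_def)
  have l1: "cmod l = 1" using l(3) by (simp add: S_def)
  have "connected (Max l \<times> Max (- l))" using Max_conn[of l] Max_conn[of "- l"] l1 by (intro connected_Times) auto
  then have con: "connected ((\<lambda>x. Im (snd x * cnj (fst x))) ` (Max l \<times> Max (- l)))"
    by (intro connected_continuous_image continuous_intros)
  \<comment> \<open>Membership of l gives a pair with nonnegative value, that of -l, read backwards,
    a pair with nonpositive value, and both lie in one connected product. A pair with value 0 has
    \<eta> = \<zeta> or \<eta> = -\<zeta>; the former would make the real part constant on the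
    circle.\<close>
  have "0 \<in> (\<lambda>x. Im (snd x * cnj (fst x))) ` (Max l \<times> Max (- l))"
  proof (rule connectedD_interval[OF con])
    show "Im (\<zeta>2 * cnj \<eta>2) \<in> (\<lambda>x. Im (snd x * cnj (fst x))) ` (Max l \<times> Max (- l))"
      using 2 by (intro image_eqI[of _ _ "(\<eta>2, \<zeta>2)"]) auto
    show "Im (\<eta>1 * cnj \<zeta>1) \<in> (\<lambda>x. Im (snd x * cnj (fst x))) ` (Max l \<times> Max (- l))"
      using 1 by (intro image_eqI[of _ _ "(\<zeta>1, \<eta>1)"]) auto
    show "Im (\<zeta>2 * cnj \<eta>2) \<le> 0" using 2(3) by (simp add: algebra_simps)
  qed (use 1 in auto)
  then obtain \<zeta> \<eta> where z: "\<zeta> \<in> Max l" "\<eta> \<in> Max (- l)" "Im (\<eta> * cnj \<zeta>) = 0" by auto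
  have n: "cmod \<zeta> = 1" "cmod \<eta> = 1" using z by (auto simp: Max_def S_def)
  then have "cmod (\<eta> * cnj \<zeta>) = 1" by (simp add: norm_mult)
  then have "\<bar>Re (\<eta> * cnj \<zeta>)\<bar> = 1" using z(3) by (metis cmod_eq_Re)
  then have "\<eta> * cnj \<zeta> = 1 \<or> \<eta> * cnj \<zeta> = -1"
    using z(3) by (auto simp: complex_eq_iff abs_if split: if_splits)
  then have "\<eta> * cnj \<zeta> * \<zeta> = \<zeta> \<or> \<eta> * cnj \<zeta> * \<zeta> = - \<zeta>" by auto
  moreover have "\<eta> * cnj \<zeta> * \<zeta> = \<eta>"
    using n(1) complex_norm_square[of \<zeta>] by (simp add: mult_ac)
  ultimately have "\<eta> = \<zeta> \<or> \<eta> = - \<zeta>" by simp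
  moreover have "\<eta> \<noteq> \<zeta>"
  proof
    assume "\<eta> = \<zeta>"
    then have "Re (l * \<gamma> \<xi>) = Re (l * \<gamma> \<zeta>)" if "\<xi> \<in> S" for \<xi>
      using z(1,2) that unfolding Max_def by (auto intro!: antisym)
    then show False using nonconst[OF l1] unfolding S_def by metis
  qed
  ultimately have \<eta>: "\<eta> = - \<zeta>" by simp
  show ?thesis
  proof (rule that[OF l1 n(1)])
    fix \<xi> :: complex assume "cmod \<xi> = 1"
    then have "\<xi> \<in> S" by (simp add: S_def)
    then show "Re (l * \<gamma> \<xi>) \<le> Re (l * \<gamma> \<zeta>)" "Re (l * \<gamma> (- \<zeta>)) \<le> Re (l * \<gamma> \<xi>)"
      using z(1,2) unfolding \<eta> Max_def by auto
  qed
qed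

text \<open>The automorphism of the disc that fixes -1 and 1 and takes 0 to t. Its derivative in t
  at t = 0 is 1 - z^2, the source of the quadratic factor in the coefficient estimates.\<close>

definition hyp_flow :: "real \<Rightarrow> complex \<Rightarrow> complex"
  where "hyp_flow t z = (z + of_real t) / (1 + of_real t * z)"

lemma hyp_flow_denom_nz:
  assumes "0 < t" "t < 1" "cmod z \<le> 1"
  shows "1 + of_real t * z \<noteq> 0"
proof
  assume "1 + of_real t * z = 0"
  then have "of_real t * z = -1" by (simp add: add_eq_0_iff)
  then have "cmod (of_real t * z) = 1" by simp
  then have "t * cmod z = 1" using assms by (simp add: norm_mult)
  moreover have "t * cmod z \<le> t * 1" using assms by (intro mult_left_mono) auto
  ultimately show False using assms by simp
qed

lemma cmod_hyp_flow:
  assumes "0 < t" "t < 1" "cmod z \<le> 1"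
  shows "cmod (hyp_flow t z) \<le> 1" "cmod z = 1 \<Longrightarrow> cmod (hyp_flow t z) = 1" "cmod z < 1 \<Longrightarrow> cmod (hyp_flow t z) < 1"
proof -
  have d: "cmod (1 + of_real t * z) > 0" using hyp_flow_denom_nz[OF assms] by simp
  have eq: "(cmod (1 + of_real t * z))\<^sup>2 - (cmod (z + of_real t))\<^sup>2 = (1 - t\<^sup>2) * (1 - (cmod z)\<^sup>2)"
    unfolding cmod_power2 by (simp add: power2_eq_square algebra_simps)
  have t2: "0 < 1 - t\<^sup>2" using assms by (simp add: abs_square_less_1)
  have c: "cmod (hyp_flow t z) = cmod (z + of_real t) / cmod (1 + of_real t * z)" by (simp add: hyp_flow_def norm_divide)
  have "0 \<le> 1 - (cmod z)\<^sup>2" using assms by (simp add: power_le_one)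
  then have "0 \<le> (1 - t\<^sup>2) * (1 - (cmod z)\<^sup>2)" using t2 by simp
  then have "(cmod (z + of_real t))\<^sup>2 \<le> (cmod (1 + of_real t * z))\<^sup>2" using eq by linarith
  then have "cmod (z + of_real t) \<le> cmod (1 + of_real t * z)" by (rule power2_le_imp_le) simp
  then show "cmod (hyp_flow t z) \<le> 1" using d by (simp add: c)
  show "cmod (hyp_flow t z) = 1" if "cmod z = 1"
  proof -
    have "(cmod (z + of_real t))\<^sup>2 = (cmod (1 + of_real t * z))\<^sup>2" using eq that by simp
    then have "cmod (z + of_real t) = cmod (1 + of_real t * z)" by simp
    then show ?thesis using d by (simp add: c)
  qed
  show "cmod (hyp_flow t z) < 1" if "cmod z < 1"
  proof -
    have "0 < 1 - (cmod z)\<^sup>2" using that by (simp add: abs_square_less_1)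
    then have "0 < (1 - t\<^sup>2) * (1 - (cmod z)\<^sup>2)" using t2 by simp
    then have "(cmod (z + of_real t))\<^sup>2 < (cmod (1 + of_real t * z))\<^sup>2" using eq by linarith
    then have "cmod (z + of_real t) < cmod (1 + of_real t * z)" by (rule power2_less_imp_less) simp
    then show ?thesis using d by (simp add: c)
  qed
qed

text \<open>On the circle the flow keeps the sign of Im and does not lower Re, so a point moves
  along its own half circle towards 1. The positive denominator is multiplied out because only signs
  matter later.\<close>

lemma Re_Im_hyp_flow:
  assumes "0 < t" "t < 1" "cmod z = 1"
  shows "Im (hyp_flow t z) * (cmod (1 + of_real t * z))\<^sup>2 = (1 - t\<^sup>2) * Im z"
    and "(Re (hyp_flow t z) - Re z) * (cmod (1 + of_real t * z))\<^sup>2 = 2 * t * (Im z)\<^sup>2"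
proof -
  have d: "1 + of_real t * z \<noteq> 0" using assms by (intro hyp_flow_denom_nz) auto
  then have "hyp_flow t z * (1 + of_real t * z) = z + of_real t" by (simp add: hyp_flow_def)
  then have "hyp_flow t z * ((1 + of_real t * z) * cnj (1 + of_real t * z)) = (z + of_real t) * cnj (1 + of_real t * z)"
    by (metis mult.assoc)
  then have e: "hyp_flow t z * of_real ((cmod (1 + of_real t * z))\<^sup>2) = (z + of_real t) * cnj (1 + of_real t * z)"
    by (simp only: complex_norm_square)
  have z2: "(Re z)\<^sup>2 + (Im z)\<^sup>2 = 1" using assms(3) cmod_power2[of z] by simp
  show "Im (hyp_flow t z) * (cmod (1 + of_real t * z))\<^sup>2 = (1 - t\<^sup>2) * Im z"
    using arg_cong[OF e, of Im] by (simp add: algebra_simps power2_eq_square)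
  have r: "Re (hyp_flow t z) * (cmod (1 + of_real t * z))\<^sup>2 = Re z + t + t * ((Re z)\<^sup>2 + (Im z)\<^sup>2) + t\<^sup>2 * Re z"
    using arg_cong[OF e, of Re] by (simp add: algebra_simps power2_eq_square)
  have c: "(cmod (1 + of_real t * z))\<^sup>2 = 1 + 2 * t * Re z + t\<^sup>2 * ((Re z)\<^sup>2 + (Im z)\<^sup>2)"
    unfolding cmod_power2 by (simp add: algebra_simps power2_eq_square)
  have "(Re (hyp_flow t z) - Re z) * (cmod (1 + of_real t * z))\<^sup>2
      = (Re z + t + t * 1 + t\<^sup>2 * Re z) - Re z * (1 + 2 * t * Re z + t\<^sup>2 * 1)"
    unfolding left_diff_distrib r unfolding c z2 ..
  also have "\<dots> = 2 * t * (1 - (Re z)\<^sup>2)" by (simp add: algebra_simps power2_eq_square)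
  also have "1 - (Re z)\<^sup>2 = (Im z)\<^sup>2" using z2 by simp
  finally show "(Re (hyp_flow t z) - Re z) * (cmod (1 + of_real t * z))\<^sup>2 = 2 * t * (Im z)\<^sup>2" .
qed

text \<open>Suppose u dropped from z to its image w. If z is not real, then -1, z, w, 1 follow each
  other on a half circle with values low, high, low, high about some level, against
  \<open>boundary_crossing\<close>. If z is real, it is the fixed point 1 or the minimum point
  -1.\<close>

lemma boundary_monotone:
  fixes u :: "complex \<Rightarrow> real"
  assumes cont: "continuous_on (cball 0 1) u"
    and conn: "\<And>c. connected {z \<in> ball 0 1. c < u z}" "\<And>c. connected {z \<in> ball 0 1. u z < c}"
    and max: "\<And>\<xi>. cmod \<xi> = 1 \<Longrightarrow> u \<xi> \<le> u 1" and min: "\<And>\<xi>. cmod \<xi> = 1 \<Longrightarrow> u (-1) \<le> u \<xi>"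
    and t: "0 < t" "t < 1" and z: "cmod z = 1"
  shows "u z \<le> u (hyp_flow t z)"
proof (rule ccontr)
  define w where "w = hyp_flow t z"
  assume "\<not> ?thesis"
  then have less: "u w < u z" by (simp add: w_def)
  define c where "c = (u w + u z) / 2"
  have c: "u w < c" "c < u z" using less by (auto simp: c_def)
  have w: "cmod w = 1" using cmod_hyp_flow(2)[OF t, of z] z by (simp add: w_def)
  have d: "0 < (cmod (1 + of_real t * z))\<^sup>2" using hyp_flow_denom_nz[OF t, of z] z by simp
  have t2: "0 < 1 - t\<^sup>2" using t by (simp add: abs_square_less_1)
  have zw: "cis (Arg z) = z" "cis (Arg w) = w"
    using z w rcis_cmod_Arg[of z] rcis_cmod_Arg[of w] by (simp_all add: rcis_def)
  have hi: "c < u 1" "u (-1) < c" using max[OF z] min[OF w] c by auto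
  have Re: "Re z = cos (Arg z)" "Re w = cos (Arg w)" using zw by (metis cis.sel(1))+
  have lt: "Re z < Re w" if "Im z \<noteq> 0"
  proof -
    have "0 < 2 * t * (Im z)\<^sup>2" using that t by simp
    then have "0 < (Re w - Re z) * (cmod (1 + of_real t * z))\<^sup>2"
      using Re_Im_hyp_flow(2)[OF t z] by (simp add: w_def)
    then show ?thesis using d by (simp add: zero_less_mult_iff)
  qed
  have Imw: "Im w * (cmod (1 + of_real t * z))\<^sup>2 = (1 - t\<^sup>2) * Im z" using Re_Im_hyp_flow(1)[OF t z] by (simp add: w_def)
  consider "Im z = 0" | "Im z > 0" | "Im z < 0" by linarith
  then show False
  proof cases
    case 1
    then have "\<bar>Re z\<bar> = 1" using z by (simp add: cmod_eq_Re)
    then have "z = 1 \<or> z = -1" using 1 by (auto simp: complex_eq_iff abs_if split: if_splits)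
    then show False
    proof
      assume "z = 1"
      moreover have "hyp_flow t 1 = 1" using hyp_flow_denom_nz[OF t, of 1] by (simp add: hyp_flow_def add.commute)
      ultimately show False using less by (simp add: w_def)
    next
      assume "z = -1"
      then show False using c hi by simp
    qed
  next
    case 2
    then have "0 < Im w * (cmod (1 + of_real t * z))\<^sup>2" unfolding Imw using t2 by simp
    then have "0 < Im w" using d by (simp add: zero_less_mult_iff)
    then have args: "0 < Arg z" "Arg z < pi" "0 < Arg w" "Arg w < pi" using 2 Arg_lt_pi by auto
    have "cos (Arg z) < cos (Arg w)" using lt 2 Re by simp
    then have "Arg w < Arg z" using args cos_mono_less_eq[of "Arg z" "Arg w"] by simp
    then show False
      using boundary_crossing[OF cont conn[of c], of 0 "Arg w" "Arg z" pi] args c hi by (simp add: zw)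
  next
    case 3
    then have "Im w * (cmod (1 + of_real t * z))\<^sup>2 < 0" unfolding Imw using t2 by (simp add: mult_pos_neg)
    then have "Im w < 0" using d by (simp add: mult_less_0_iff)
    then have args: "Arg z < 0" "- pi < Arg z" "Arg w < 0" "- pi < Arg w" using 3 by (auto simp: Arg_neg_iff mpi_less_Arg)
    have "cos (- Arg z) < cos (- Arg w)" using lt 3 Re by simp
    then have "- Arg w < - Arg z" using args cos_mono_less_eq[of "- Arg z" "- Arg w"] by simp
    then show False
      using boundary_crossing[OF cont conn[of c], of "Arg z" "Arg w" 0 pi] args c hi by (simp add: zw)
  qed
qed

text \<open>An interior minimum of Re G is a maximum of |exp (-G)|, so the maximum modulus principle
  makes w constant on the disc, by continuity also on the circle, where it is at least b.\<close>

lemma harmonic_min_principle: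
  fixes w :: "complex \<Rightarrow> real"
  assumes cont: "continuous_on (cball 0 1) w" and hol: "G holomorphic_on ball 0 1"
    and eq: "\<And>z. z \<in> ball 0 1 \<Longrightarrow> w z = Re (G z)"
    and bd: "\<And>z. cmod z = 1 \<Longrightarrow> b \<le> w z" and z: "z \<in> cball 0 1"
  shows "b \<le> w z"
proof (rule ccontr)
  assume "\<not> ?thesis"
  then have less: "w z < b" by simp
  obtain z0 where z0: "z0 \<in> cball 0 1" "\<And>y. y \<in> cball 0 1 \<Longrightarrow> w z0 \<le> w y"
    using continuous_attains_inf[OF compact_cball _ cont] by fastforce
  have w0: "w z0 < b" using z0(2)[OF z] less by simp
  then have "cmod z0 \<noteq> 1" using bd[of z0] by auto
  then have in0: "z0 \<in> ball 0 1" using z0(1) by auto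
  have "(\<lambda>z. exp (- G z)) constant_on ball 0 1"
  proof (rule maximum_modulus_principle[of _ _ "ball 0 1" z0])
    show "(\<lambda>z. exp (- G z)) holomorphic_on ball 0 1" using hol by (intro holomorphic_intros)
    fix y :: complex assume y: "y \<in> ball 0 1"
    then have "Re (G z0) \<le> Re (G y)" using z0(2)[of y] eq[OF y] eq[OF in0] by auto
    then show "cmod (exp (- G y)) \<le> cmod (exp (- G z0))" by simp
  qed (use in0 in auto)
  then have const: "exp (- G y) = exp (- G z0)" if "y \<in> ball 0 1" for y
    using that in0 unfolding constant_on_def by metis
  have wc: "w y = w z0" if "y \<in> ball 0 1" for y
  proof -
    have "exp (- Re (G y)) = exp (- Re (G z0))"
      using const[OF that] by (metis norm_exp_eq_Re uminus_complex.sel(1))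
    then show ?thesis using eq that in0 by simp
  qed
  have "w y = w z0" if "y \<in> cball 0 1" for y
    using continuous_constant_on_closure[of "ball 0 1" w "w z0" y] wc cont that by simp
  then have "w 1 = w z0" by simp
  then show False using bd[of 1] w0 by simp
qed

text \<open>After a rotation taking \<zeta> to 1, \<open>boundary_monotone\<close> gives the
  inequality on the circle. The difference of the two sides is the real part of a holomorphic
  function, so the minimum principle carries it inside.\<close>

lemma support_flow:
  fixes \<gamma> h g :: "complex \<Rightarrow> complex"
  assumes cont: "continuous_on (cball 0 1) \<gamma>"
    and hol: "h holomorphic_on ball 0 1" "g holomorphic_on ball 0 1"
    and eq: "\<And>z. z \<in> ball 0 1 \<Longrightarrow> \<gamma> z = h z + cnj (g z)"
    and conn: "\<And>l c. cmod l = 1 \<Longrightarrow> connected {z \<in> ball 0 1. c < Re (l * \<gamma> z)}"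
    and \<rho>: "\<rho> > 0" "ball 0 \<rho> \<subseteq> \<gamma> ` ball 0 1"
  obtains l \<zeta> where "cmod l = 1" "cmod \<zeta> = 1"
    "\<And>t z. \<lbrakk>0 < t; t < 1; cmod z < 1\<rbrakk> \<Longrightarrow> Re (l * \<gamma> z) \<le> Re (l * \<gamma> (\<zeta> * hyp_flow t (z / \<zeta>)))"
proof -
  \<comment> \<open>Re (l cnj g) = Re (cnj l g), so this holomorphic function has the same real part
    as l \<gamma>.\<close>
  define F where "F l z = l * h z + cnj l * g z" for l z
  have F: "F l holomorphic_on ball 0 1" for l
    unfolding F_def using hol by (intro holomorphic_intros)
  have ReF: "Re (l * \<gamma> z) = Re (F l z)" if "z \<in> ball 0 1" for l z
    using eq[OF that] by (simp add: F_def algebra_simps)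
  have nonconst: "\<exists>\<xi>\<in>sphere 0 1. \<exists>\<xi>'\<in>sphere 0 1. Re (l * \<gamma> \<xi>) \<noteq> Re (l * \<gamma> \<xi>')" if l: "cmod l = 1" for l
  proof (rule ccontr)
    assume "\<not> ?thesis"
    then have c: "Re (l * \<gamma> \<xi>) = Re (l * \<gamma> 1)" if "cmod \<xi> = 1" for \<xi>
      using that by (metis mem_sphere_0 norm_one)
    have const: "Re (l * \<gamma> z) = Re (l * \<gamma> 1)" if "z \<in> ball 0 1" for z
    proof (rule antisym)
      have c1: "continuous_on (cball 0 1) (\<lambda>z. Re (l * \<gamma> z))"
        using cont by (intro continuous_intros)
      then have c2: "continuous_on (cball 0 1) (\<lambda>z. - Re (l * \<gamma> z))" by (rule continuous_on_minus)
      have "- F l holomorphic_on ball 0 1" using F[of l] by (simp add: fun_Compl_def holomorphic_on_minus)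
      then have "- Re (l * \<gamma> 1) \<le> - Re (l * \<gamma> z)"
      proof (rule harmonic_min_principle[OF c2])
        show "- Re (l * \<gamma> z) = Re ((- F l) z)" if "z \<in> ball 0 1" for z
          using ReF[OF that] by simp
        show "- Re (l * \<gamma> 1) \<le> - Re (l * \<gamma> z)" if "cmod z = 1" for z
          unfolding c[OF that] ..
        show "z \<in> cball 0 1" using that by simp
      qed
      then show "Re (l * \<gamma> z) \<le> Re (l * \<gamma> 1)" by simp
      show "Re (l * \<gamma> 1) \<le> Re (l * \<gamma> z)"
      proof (rule harmonic_min_principle[OF c1 F[of l] ReF])
        show "Re (l * \<gamma> 1) \<le> Re (l * \<gamma> z)" if "cmod z = 1" for z
          unfolding c[OF that] ..
        show "z \<in> cball 0 1" using that by simp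
      qed
    qed
    \<comment> \<open>Two points of the image at which w \<mapsto> Re (l w) takes the different
      values 0 and \<rho> / 2.\<close>
    have "0 \<in> ball 0 \<rho>" "of_real (\<rho> / 2) * cnj l \<in> ball 0 \<rho>"
      using \<rho>(1) l by (auto simp: norm_mult)
    then have "0 \<in> \<gamma> ` ball 0 1" "of_real (\<rho> / 2) * cnj l \<in> \<gamma> ` ball 0 1" using \<rho>(2) by blast+
    then obtain z1 z2 where z12: "z1 \<in> ball 0 1" "0 = \<gamma> z1" "z2 \<in> ball 0 1" "of_real (\<rho> / 2) * cnj l = \<gamma> z2"
      by (elim imageE) 
    have zero: "Re (l * (of_real (\<rho> / 2) * cnj l)) = Re (l * 0)"
      unfolding z12(2,4) const[OF z12(1)] const[OF z12(3)] ..
    have half: "l * (of_real (\<rho> / 2) * cnj l) = of_real (\<rho> / 2)"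
    proof -
      have "l * cnj l = 1" using l complex_norm_square[of l] by simp
      then show ?thesis using mult.left_commute[of l "of_real (\<rho> / 2)" "cnj l"] by simp
    qed
    show False using zero \<rho>(1) unfolding half by simp
  qed
  obtain l \<zeta> where l: "cmod l = 1" and \<zeta>: "cmod \<zeta> = 1"
    and max: "\<And>\<xi>. cmod \<xi> = 1 \<Longrightarrow> Re (l * \<gamma> \<xi>) \<le> Re (l * \<gamma> \<zeta>)"
    and min: "\<And>\<xi>. cmod \<xi> = 1 \<Longrightarrow> Re (l * \<gamma> (- \<zeta>)) \<le> Re (l * \<gamma> \<xi>)"
    by (rule antipodal_support[OF cont conn nonconst]) blast+
  have \<zeta>0: "\<zeta> \<noteq> 0" using \<zeta> by auto
  define u where "u z = Re (l * \<gamma> (\<zeta> * z))" for z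
  have cont_u: "continuous_on (cball 0 1) u"
    unfolding u_def by (intro continuous_intros continuous_on_compose2[OF cont]) (auto simp: norm_mult \<zeta>)
  have rot: "{z \<in> ball 0 1. P (\<zeta> * z)} = (\<lambda>w. w / \<zeta>) ` {w \<in> ball 0 1. P w}" for P
  proof safe
    fix z assume "z \<in> ball 0 1" "P (\<zeta> * z)"
    then show "z \<in> (\<lambda>w. w / \<zeta>) ` {w \<in> ball 0 1. P w}"
      using \<zeta>0 \<zeta> by (intro image_eqI[of _ _ "\<zeta> * z"]) (auto simp: norm_mult)
  qed (use \<zeta>0 \<zeta> in \<open>auto simp: norm_divide\<close>)
  have conn_rot: "connected {z \<in> ball 0 1. P (\<zeta> * z)}" if "connected {w \<in> ball 0 1. P w}" for P
    unfolding rot using that by (intro connected_continuous_image continuous_intros) (use \<zeta>0 in auto)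
  have conn1: "connected {z \<in> ball 0 1. c < u z}" for c
    unfolding u_def by (rule conn_rot[OF conn[OF l]])
  have conn2: "connected {z \<in> ball 0 1. u z < c}" for c
  proof -
    have "{z \<in> ball 0 1. - c < Re (- l * \<gamma> z)} = {z \<in> ball 0 1. Re (l * \<gamma> z) < c}" by auto
    then have "connected {z \<in> ball 0 1. Re (l * \<gamma> z) < c}" using conn[of "- l" "- c"] l by simp
    then show ?thesis unfolding u_def by (rule conn_rot)
  qed
  have main: "u z \<le> u (hyp_flow t z)" if t: "0 < t" "t < 1" and z: "cmod z < 1" for t z
  proof -
    define w where "w z = u (hyp_flow t z) - u z" for z
    have c: "continuous_on (cball 0 1) (hyp_flow t)"
      unfolding hyp_flow_def by (intro continuous_intros) (use hyp_flow_denom_nz[OF t] in auto)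
    have "continuous_on (cball 0 1) w"
      unfolding w_def
      by (intro continuous_intros cont_u continuous_on_compose2[OF cont_u c]) (use cmod_hyp_flow[OF t] in auto)
    moreover have "(\<lambda>z. F l (\<zeta> * hyp_flow t z) - F l (\<zeta> * z)) holomorphic_on ball 0 1"
    proof -
      have h1: "(\<lambda>z. \<zeta> * hyp_flow t z) holomorphic_on ball 0 1"
        unfolding hyp_flow_def by (intro holomorphic_intros) (use hyp_flow_denom_nz[OF t] in auto)
      have h2: "(\<lambda>z. \<zeta> * z) holomorphic_on ball 0 1" by (intro holomorphic_intros)
      have "(\<lambda>z. \<zeta> * hyp_flow t z) ` ball 0 1 \<subseteq> ball 0 1" "(\<lambda>z. \<zeta> * z) ` ball 0 1 \<subseteq> ball 0 1"
        using cmod_hyp_flow(3)[OF t] \<zeta> by (auto simp: norm_mult)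
      then show ?thesis
        using holomorphic_on_compose_gen[OF h1 F] holomorphic_on_compose_gen[OF h2 F]
        by (intro holomorphic_on_diff) (auto simp: o_def)
    qed
    moreover have "w z = Re (F l (\<zeta> * hyp_flow t z) - F l (\<zeta> * z))" if "z \<in> ball 0 1" for z
    proof -
      have "\<zeta> * hyp_flow t z \<in> ball 0 1" "\<zeta> * z \<in> ball 0 1"
        using that cmod_hyp_flow(3)[OF t, of z] \<zeta> by (auto simp: norm_mult)
      then show ?thesis by (simp only: w_def u_def ReF minus_complex.sel)
    qed
    moreover have "0 \<le> w z" if z: "cmod z = 1" for z
    proof -
      have "u z \<le> u (hyp_flow t z)"
      proof (rule boundary_monotone[OF cont_u conn1 conn2 _ _ t z])
        fix \<xi> :: complex assume "cmod \<xi> = 1"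
        then have "cmod (\<zeta> * \<xi>) = 1" by (simp add: norm_mult \<zeta>)
        then show "u \<xi> \<le> u 1" "u (-1) \<le> u \<xi>" using max min by (simp_all only: u_def) auto
      qed
      then show ?thesis by (simp add: w_def)
    qed
    ultimately have "0 \<le> w z" by (rule harmonic_min_principle) (use z in auto)
    then show ?thesis by (simp add: w_def)
  qed
  show ?thesis
  proof (rule that[OF l \<zeta>])
    fix t :: real and z :: complex assume "0 < t" "t < 1" "cmod z < 1"
    then have "u (z / \<zeta>) \<le> u (hyp_flow t (z / \<zeta>))" by (intro main) (auto simp: norm_divide \<zeta>)
    then show "Re (l * \<gamma> z) \<le> Re (l * \<gamma> (\<zeta> * hyp_flow t (z / \<zeta>)))" using \<zeta>0 by (simp add: u_def)
  qed
qed

section \<open>Exhaustion by Riemann maps\<close>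

text \<open>A disc automorphism moves the preimage of a to 0, and a rotation by cnj d / |d| makes
  the derivative d there positive. The normalization is what lets derivatives tending to 1 force the
  maps themselves towards the identity.\<close>

lemma normalized_Riemann_map:
  assumes S: "open S" "simply_connected S" "S \<noteq> UNIV" "a \<in> S"
  obtains \<phi> where "\<phi> holomorphic_on ball 0 1" "\<phi> ` ball 0 1 = S" "inj_on \<phi> (ball 0 1)" "\<phi> 0 = a"
    "Im (deriv \<phi> 0) = 0" "0 < Re (deriv \<phi> 0)"
proof -
  obtain p q where p: "p holomorphic_on S" and q: "q holomorphic_on ball 0 1"
    and pS: "\<And>z. z \<in> S \<Longrightarrow> p z \<in> ball 0 1" "\<And>z. z \<in> S \<Longrightarrow> q (p z) = z"
    and qS: "\<And>z. z \<in> ball 0 1 \<Longrightarrow> q z \<in> S" "\<And>z. z \<in> ball 0 1 \<Longrightarrow> p (q z) = z"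
  proof -
    have "S \<noteq> {}" using S(4) by blast
    then have "\<exists>f g. f holomorphic_on S \<and> g holomorphic_on ball 0 1 \<and>
        (\<forall>z\<in>S. f z \<in> ball 0 1 \<and> g (f z) = z) \<and> (\<forall>z\<in>ball 0 1. g z \<in> S \<and> f (g z) = z)"
      using Riemann_mapping_theorem[of S] S(1-3) by meson
    then obtain p q where pq: "p holomorphic_on S" "q holomorphic_on ball 0 1"
        "\<forall>z\<in>S. p z \<in> ball 0 1 \<and> q (p z) = z" "\<forall>z\<in>ball 0 1. q z \<in> S \<and> p (q z) = z"
      by (elim exE conjE)
    show ?thesis
      by (rule that[OF pq(1,2)]) (use pq(3,4) in blast)+
  qed
  have pa: "p a \<in> ball 0 1" by (rule pS(1)[OF S(4)])
  obtain m n where mn: "m (p a) = 0" "m holomorphic_on ball 0 1" "m ` ball 0 1 \<subseteq> ball 0 1"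
      "n holomorphic_on ball 0 1" "n ` ball 0 1 \<subseteq> ball 0 1"
      "\<And>z. z \<in> ball 0 1 \<Longrightarrow> m (n z) = z" "\<And>z. z \<in> ball 0 1 \<Longrightarrow> n (m z) = z"
    by (rule ball_biholomorphism_exists[OF pa]) (rule that)
  define \<psi> where "\<psi> = q \<circ> n"
  have \<psi>: "\<psi> holomorphic_on ball 0 1"
    unfolding \<psi>_def using holomorphic_on_compose_gen[OF mn(4) q mn(5)] .
  have \<psi>_inv: "\<psi> (m (p z)) = z" "m (p z) \<in> ball 0 1" if "z \<in> S" for z
  proof -
    have pz: "p z \<in> ball 0 1" using pS(1)[OF that] .
    then show "m (p z) \<in> ball 0 1" using mn(3) by blast
    show "\<psi> (m (p z)) = z" unfolding \<psi>_def o_def mn(7)[OF pz] by (rule pS(2)[OF that])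
  qed
  have inv_\<psi>: "m (p (\<psi> z)) = z" "\<psi> z \<in> S" if "z \<in> ball 0 1" for z
  proof -
    have nz: "n z \<in> ball 0 1" using mn(5) that by blast
    show "m (p (\<psi> z)) = z" unfolding \<psi>_def o_def qS(2)[OF nz] by (rule mn(6)[OF that])
    show "\<psi> z \<in> S" unfolding \<psi>_def o_def by (rule qS(1)[OF nz])
  qed
  have inj_\<psi>: "inj_on \<psi> (ball 0 1)" by (rule inj_on_inverseI[of _ "\<lambda>w. m (p w)"]) (rule inv_\<psi>)
  have \<psi>0: "\<psi> 0 = a" using \<psi>_inv[OF S(4)] mn(1) by simp
  define d where "d = deriv \<psi> 0"
  have d0: "d \<noteq> 0"
    unfolding d_def using holomorphic_injective_imp_regular[OF \<psi> _ inj_\<psi>] by simp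
  define e where "e = cnj d / of_real (cmod d)"
  have e: "cmod e = 1" using d0 by (simp add: e_def norm_divide)
  have e0: "e \<noteq> 0" using e by auto
  define \<phi> where "\<phi> z = \<psi> (e * z)" for z
  have rotb: "e * z \<in> ball 0 1 \<longleftrightarrow> z \<in> ball 0 1" for z by (simp add: norm_mult e)
  have \<phi>: "\<phi> holomorphic_on ball 0 1"
    unfolding \<phi>_def using rotb by (intro holomorphic_on_compose_gen[OF _ \<psi>, unfolded o_def] holomorphic_intros) auto
  have img: "\<phi> ` ball 0 1 = S"
  proof
    show "\<phi> ` ball 0 1 \<subseteq> S" using inv_\<psi>(2) rotb by (auto simp: \<phi>_def)
    show "S \<subseteq> \<phi> ` ball 0 1"
    proof
      fix w assume "w \<in> S"
      then have "\<phi> (m (p w) / e) = w" "m (p w) / e \<in> ball 0 1"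
        using \<psi>_inv[of w] e0 e by (auto simp: \<phi>_def norm_divide)
      then show "w \<in> \<phi> ` ball 0 1" by (metis imageI)
    qed
  qed
  have inj: "inj_on \<phi> (ball 0 1)"
  proof (rule inj_onI)
    fix x y assume xy: "x \<in> ball 0 1" "y \<in> ball 0 1" "\<phi> x = \<phi> y"
    then have "e * x = e * y" using inj_onD[OF inj_\<psi>] rotb by (simp only: \<phi>_def)
    then show "x = y" using e0 by simp
  qed
  have "(\<psi> has_field_derivative d) (at (e * 0))"
    using holomorphic_derivI[OF \<psi>, of 0] by (simp add: d_def)
  then have "(\<phi> has_field_derivative d * e) (at 0)"
    unfolding \<phi>_def by (rule DERIV_chain2) (auto intro!: derivative_eq_intros)
  then have "deriv \<phi> 0 = d * e" by (rule DERIV_imp_deriv)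
  also have "\<dots> = of_real (cmod d)"
  proof -
    have "d * cnj d = of_real (cmod d) * of_real (cmod d)" using complex_norm_square[of d] by (simp add: power2_eq_square)
    then show ?thesis using d0 by (simp add: e_def)
  qed
  finally have "deriv \<phi> 0 = of_real (cmod d)" .
  then show ?thesis using that[OF \<phi> img inj] \<psi>0 d0 by (simp add: \<phi>_def)
qed

text \<open>The length-area argument yields short crosscuts for the conformal map \<phi> only. The
  compact K between \<Omega>' and the image of f makes f uniformly continuous on the preimage of K,
  which contains the range of \<phi>; hence f \<circ> \<phi> has short crosscuts too and extends
  continuously to the circle.\<close>

lemma convex_piece_flow:
  fixes f h g :: "complex \<Rightarrow> complex"
  assumes hol: "h holomorphic_on ball 0 1" "g holomorphic_on ball 0 1"
    and eq: "\<And>z. z \<in> ball 0 1 \<Longrightarrow> f z = h z + cnj (g z)" and f0: "f 0 = 0"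
    and inj: "inj_on f (ball 0 1)"
    and \<Omega>': "convex \<Omega>'" "open \<Omega>'" "\<Omega>' \<subseteq> K" and K: "compact K" "K \<subseteq> f ` ball 0 1"
    and \<rho>: "\<rho> > 0" "ball 0 \<rho> \<subseteq> \<Omega>'"
  obtains \<phi> l \<zeta> where "\<phi> holomorphic_on ball 0 1" "\<phi> ` ball 0 1 = {z \<in> ball 0 1. f z \<in> \<Omega>'}"
    "inj_on \<phi> (ball 0 1)" "\<phi> 0 = 0" "Im (deriv \<phi> 0) = 0" "0 < Re (deriv \<phi> 0)" "cmod l = 1" "cmod \<zeta> = 1"
    "\<And>t z. \<lbrakk>0 < t; t < 1; cmod z < 1\<rbrakk> \<Longrightarrow> Re (l * f (\<phi> z)) \<le> Re (l * f (\<phi> (\<zeta> * hyp_flow t (z / \<zeta>))))"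
proof -
  have contf: "continuous_on (ball 0 1) f"
  proof -
    have "continuous_on (ball 0 1) (\<lambda>z. h z + cnj (g z))"
      using hol by (intro continuous_intros holomorphic_on_imp_continuous_on)
    moreover have "continuous_on (ball 0 1) f \<longleftrightarrow> continuous_on (ball 0 1) (\<lambda>z. h z + cnj (g z))"
      by (rule continuous_on_cong[OF refl eq])
    ultimately show ?thesis by simp
  qed
  obtain fi where fi: "homeomorphism (ball 0 1) (f ` ball 0 1) f fi"
    using invariance_of_domain_homeomorphism[OF open_ball contf _ inj] by auto
  define D where "D = {z \<in> ball 0 1. f z \<in> \<Omega>'}"
  have "open D"
  proof -
    have "open (f -` \<Omega>' \<inter> ball 0 1)" using continuous_on_open_vimage[OF open_ball, of 0 1 f] contf \<Omega>'(2) by blast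
    moreover have "f -` \<Omega>' \<inter> ball 0 1 = D" by (auto simp: D_def)
    ultimately show ?thesis by simp
  qed
  have hom: "homeomorphism D \<Omega>' f fi"
  proof -
    have sub: "\<Omega>' \<subseteq> f ` ball 0 1" using \<Omega>'(3) K(2) by blast
    have D1: "D \<subseteq> ball 0 1" by (auto simp: D_def)
    have "f ` D = \<Omega>'" using sub by (auto simp: D_def)
    then show ?thesis by (rule homeomorphism_of_subsets[OF fi D1 sub])
  qed
  have "simply_connected \<Omega>'" using \<Omega>'(1) by (rule convex_imp_simply_connected)
  then have "simply_connected D"
    using hom homeomorphic_simply_connected homeomorphic_def homeomorphic_sym by metis
  moreover have "D \<noteq> UNIV"
  proof
    assume "D = UNIV"
    then have "(2::complex) \<in> D" by simp
    then show False by (simp add: D_def)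
  qed
  moreover have "0 \<in> D" using \<rho> f0 by (auto simp: D_def)
  ultimately obtain \<phi> where \<phi>: "\<phi> holomorphic_on ball 0 1" "\<phi> ` ball 0 1 = D" "inj_on \<phi> (ball 0 1)" "\<phi> 0 = 0"
    "Im (deriv \<phi> 0) = 0" "0 < Re (deriv \<phi> 0)"
    using normalized_Riemann_map[OF \<open>open D\<close>] by metis
  have \<phi>D: "\<phi> z \<in> D" if "z \<in> ball 0 1" for z using \<phi>(2) that by blast
  have \<phi>b: "\<phi> z \<in> ball 0 1" if "z \<in> ball 0 1" for z using \<phi>D[OF that] by (simp add: D_def)
  define F where "F = f \<circ> \<phi>"
  have contF: "continuous_on (ball 0 1) F"
    unfolding F_def using \<phi>b
    by (intro continuous_on_compose holomorphic_on_imp_continuous_on[OF \<phi>(1)] continuous_on_subset[OF contf]) auto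
  have injF: "inj_on F (ball 0 1)"
    unfolding F_def using \<phi>b by (intro comp_inj_on[OF \<phi>(3)] inj_on_subset[OF inj]) auto
  have imgF: "F ` ball 0 1 = \<Omega>'"
    using hom \<phi>(2) unfolding F_def image_comp[symmetric] homeomorphism_def by simp
  obtain Fi where Fi: "homeomorphism (ball 0 1) \<Omega>' F Fi"
    using invariance_of_domain_homeomorphism[OF open_ball contF _ injF] imgF by auto
  obtain R where R: "\<And>w. w \<in> \<Omega>' \<Longrightarrow> cmod w \<le> R"
    using compact_imp_bounded[OF K(1)] \<Omega>'(3) unfolding bounded_iff by blast
  have cpt: "compact (fi ` K)"
    using fi K by (intro compact_continuous_image) (auto simp: homeomorphism_def intro: continuous_on_subset)
  have fiK: "fi ` K \<subseteq> ball 0 1" using fi K(2) by (auto simp: homeomorphism_def)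
  have DK: "D \<subseteq> fi ` K"
  proof
    fix z assume "z \<in> D"
    then have "fi (f z) = z" "f z \<in> K" using fi \<Omega>'(3) by (auto simp: D_def homeomorphism_def)
    then show "z \<in> fi ` K" by (metis imageI)
  qed
  have uc: "uniformly_continuous_on (fi ` K) f"
    using cpt contf fiK by (intro compact_uniformly_continuous) (auto intro: continuous_on_subset)
  have crosscut: "\<exists>\<kappa>>0. \<kappa> < \<kappa>0 \<and>
      (\<forall>z1 z2. cmod z1 < 1 \<longrightarrow> cmod z2 < 1 \<longrightarrow> cmod (\<zeta> - z1) = \<kappa> * cmod (\<zeta> + z1) \<longrightarrow>
         cmod (\<zeta> - z2) = \<kappa> * cmod (\<zeta> + z2) \<longrightarrow> cmod (F z1 - F z2) \<le> e)"
    if "e > 0" "\<kappa>0 > 0" "cmod \<zeta> = 1" for e \<kappa>0 \<zeta>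
  proof -
    obtain d where d: "d > 0" "\<And>x y. x \<in> fi ` K \<Longrightarrow> y \<in> fi ` K \<Longrightarrow> dist y x < d \<Longrightarrow> dist (f y) (f x) < e"
      using uc \<open>e > 0\<close> unfolding uniformly_continuous_on_def by metis
    have "bounded (\<phi> ` ball 0 1)" using \<phi>(2) DK cpt compact_imp_bounded bounded_subset by metis
    then obtain \<kappa> where \<kappa>: "0 < \<kappa>" "\<kappa> < \<kappa>0"
      "\<And>z1 z2. \<lbrakk>cmod z1 < 1; cmod z2 < 1; cmod (\<zeta> - z1) = \<kappa> * cmod (\<zeta> + z1); cmod (\<zeta> - z2) = \<kappa> * cmod (\<zeta> + z2)\<rbrakk>
        \<Longrightarrow> cmod (\<phi> z1 - \<phi> z2) \<le> d / 2"
      using short_crosscut_disc[OF \<phi>(1) \<phi>(3) _ \<open>cmod \<zeta> = 1\<close>, of "d / 2" \<kappa>0] d(1) \<open>\<kappa>0 > 0\<close> by auto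
    show ?thesis
    proof (intro exI[of _ \<kappa>] conjI allI impI \<kappa>(1,2))
      fix z1 z2 assume z: "cmod z1 < 1" "cmod z2 < 1" "cmod (\<zeta> - z1) = \<kappa> * cmod (\<zeta> + z1)" "cmod (\<zeta> - z2) = \<kappa> * cmod (\<zeta> + z2)"
      have "dist (\<phi> z1) (\<phi> z2) < d" using \<kappa>(3)[OF z] d(1) by (simp add: dist_norm)
      moreover have "\<phi> z1 \<in> fi ` K" "\<phi> z2 \<in> fi ` K" using \<phi>D DK z by auto
      ultimately show "cmod (F z1 - F z2) \<le> e" using d(2)[of "\<phi> z2" "\<phi> z1"] by (simp add: F_def dist_norm)
    qed
  qed
  have F0: "F 0 = 0" using f0 \<phi>(4) by (simp add: F_def)
  obtain \<gamma> where \<gamma>: "continuous_on (cball 0 1) \<gamma>" "\<And>z. z \<in> ball 0 1 \<Longrightarrow> \<gamma> z = F z"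
  proof (rule continuous_extension_cball[OF contF])
    fix \<zeta> :: complex and \<epsilon> :: real assume "cmod \<zeta> = 1" "\<epsilon> > 0"
    then show "\<exists>\<eta>>0. \<forall>z\<in>ball 0 1. \<forall>z'\<in>ball 0 1. dist z \<zeta> < \<eta> \<longrightarrow> dist z' \<zeta> < \<eta> \<longrightarrow> dist (F z) (F z') < \<epsilon>"
      using boundary_Cauchy[OF Fi \<Omega>'(1) R \<rho> F0 crosscut, of \<zeta> \<epsilon>] by blast
  qed blast
  have hol': "h \<circ> \<phi> holomorphic_on ball 0 1" "g \<circ> \<phi> holomorphic_on ball 0 1"
    using \<phi>b by (auto intro!: holomorphic_on_compose_gen[OF \<phi>(1)] hol)
  have eq': "\<gamma> z = (h \<circ> \<phi>) z + cnj ((g \<circ> \<phi>) z)" if "z \<in> ball 0 1" for z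
    using \<gamma>(2)[OF that] eq[OF \<phi>b[OF that]] by (simp add: F_def)
  \<comment> \<open>The superlevel set is the preimage, under a homeomorphism onto \<Omega>', of the
    convex intersection of \<Omega>' with a half-plane.\<close>
  have conn: "connected {z \<in> ball 0 1. c < Re (l * \<gamma> z)}" if "cmod l = 1" for l c
  proof -
    have "{z \<in> ball 0 1. c < Re (l * \<gamma> z)} = {z \<in> ball 0 1. c < Re (l * F z)}" using \<gamma>(2) by auto
    also have "\<dots> = Fi ` (\<Omega>' \<inter> {w. c < Re (l * w)})"
    proof (intro equalityI subsetI)
      fix z assume z: "z \<in> {z \<in> ball 0 1. c < Re (l * F z)}"
      then have "Fi (F z) = z" "F z \<in> \<Omega>'" using Fi unfolding homeomorphism_def by blast+
      then show "z \<in> Fi ` (\<Omega>' \<inter> {w. c < Re (l * w)})" using z by (intro image_eqI[of _ _ "F z"]) auto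
    next
      fix z assume "z \<in> Fi ` (\<Omega>' \<inter> {w. c < Re (l * w)})"
      then obtain w where w: "w \<in> \<Omega>'" "c < Re (l * w)" "z = Fi w" by blast
      then have "F z = w" "z \<in> ball 0 1" using Fi unfolding homeomorphism_def by blast+
      then show "z \<in> {z \<in> ball 0 1. c < Re (l * F z)}" using w by simp
    qed
    also have "connected \<dots>"
    proof (rule connected_continuous_image)
      show "continuous_on (\<Omega>' \<inter> {w. c < Re (l * w)}) Fi"
        using Fi by (auto simp: homeomorphism_def intro: continuous_on_subset)
      have "{w. c < Re (l * w)} = {w. cnj l \<bullet> w > c}"
        by (simp add: inner_complex_def)
      then have "convex {w. c < Re (l * w)}" using convex_halfspace_gt[of c "cnj l"] by simp
      then show "connected (\<Omega>' \<inter> {w. c < Re (l * w)})"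
        using \<Omega>'(1) by (intro convex_connected convex_Int)
    qed
    finally show ?thesis .
  qed
  have "\<gamma> ` ball 0 1 = \<Omega>'" using \<gamma>(2) imgF by simp
  then obtain l \<zeta> where l: "cmod l = 1" "cmod \<zeta> = 1"
    "\<And>t z. \<lbrakk>0 < t; t < 1; cmod z < 1\<rbrakk> \<Longrightarrow> Re (l * \<gamma> z) \<le> Re (l * \<gamma> (\<zeta> * hyp_flow t (z / \<zeta>)))"
    using support_flow[OF \<gamma>(1) hol' eq' conn \<rho>(1)] \<rho>(2) by metis
  show ?thesis
  proof (rule that[OF \<phi>(1) _ \<phi>(3-6) l(1,2)])
    show "\<phi> ` ball 0 1 = {z \<in> ball 0 1. f z \<in> \<Omega>'}" using \<phi>(2) by (simp add: D_def)
    fix t :: real and z :: complex assume t: "0 < t" "t < 1" and z: "cmod z < 1"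
    have "cmod (\<zeta> * hyp_flow t (z / \<zeta>)) < 1"
      using cmod_hyp_flow(3)[OF t, of "z / \<zeta>"] z l(2) by (simp add: norm_mult norm_divide)
    then show "Re (l * f (\<phi> z)) \<le> Re (l * f (\<phi> (\<zeta> * hyp_flow t (z / \<zeta>))))"
      using l(3)[OF t z] \<gamma>(2) z by (simp add: F_def)
  qed
qed

text \<open>Schwarz--Pick for z \<mapsto> \<phi> z / z.\<close>

lemma near_identity:
  assumes hol: "\<phi> holomorphic_on ball 0 1" and b: "\<And>z. cmod z < 1 \<Longrightarrow> cmod (\<phi> z) < 1" and \<phi>0: "\<phi> 0 = 0"
    and d: "deriv \<phi> 0 = of_real d" "0 < d" and z: "cmod z < 1"
  shows "d \<le> 1" "cmod (\<phi> z - z) \<le> (1 - d) * (1 + 2 / (1 - cmod z))"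
proof -
  show d1: "d \<le> 1" using Schwarz_Lemma(2)[OF hol \<phi>0 b, of 0] d by simp
  \<comment> \<open>Equality in the Schwarz lemma makes \<phi> a rotation, and a rotation with
    positive derivative is the identity.\<close>
  have lin: "d = 1" "\<phi> w = w" if "\<forall>z. cmod z < 1 \<longrightarrow> \<phi> z = \<alpha> * z" "cmod \<alpha> = 1" "cmod w < 1" for \<alpha> w
  proof -
    have "((\<lambda>z. \<alpha> * z) has_field_derivative \<alpha>) (at 0)" by (auto intro!: derivative_eq_intros)
    then have "(\<phi> has_field_derivative \<alpha>) (at 0)"
      by (rule has_field_derivative_transform_within_open[of _ _ _ "ball 0 1"]) (use that in auto)
    then have "\<alpha> = of_real d" using d DERIV_imp_deriv by metis
    then have "d = 1" using that(2) d by simp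
    then show "d = 1" "\<phi> w = w" using \<open>\<alpha> = of_real d\<close> that by auto
  qed
  show "cmod (\<phi> z - z) \<le> (1 - d) * (1 + 2 / (1 - cmod z))"
  proof (cases "d = 1")
    case True
    then have "\<exists>\<alpha>. (\<forall>z. cmod z < 1 \<longrightarrow> \<phi> z = \<alpha> * z) \<and> cmod \<alpha> = 1"
      using Schwarz_Lemma(3)[OF hol \<phi>0 b, of 0] d by simp
    then have "\<phi> z = z" using lin(2) z by metis
    then show ?thesis using True by simp
  next
    case False
    then have d1: "d < 1" using d1 by simp
    obtain q where q: "q holomorphic_on ball 0 1" "\<And>z. cmod z < 1 \<Longrightarrow> \<phi> z = z * q z" "deriv \<phi> 0 = q 0"
      by (rule Schwarz3[OF hol \<phi>0]) (rule that)
    have q1: "cmod (q w) < 1" if w: "cmod w < 1" for w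
    proof (cases "w = 0")
      case True
      have "q 0 = of_real d" using q(3) d(1) by simp
      then show ?thesis using True d(2) d1 by simp
    next
      case False
      have "cmod (\<phi> w) \<le> cmod w" using Schwarz_Lemma(1)[OF hol \<phi>0 b w] by simp
      moreover have "cmod (\<phi> w) \<noteq> cmod w"
      proof
        assume "cmod (\<phi> w) = cmod w"
        then have "\<exists>\<alpha>. (\<forall>z. cmod z < 1 \<longrightarrow> \<phi> z = \<alpha> * z) \<and> cmod \<alpha> = 1"
          using Schwarz_Lemma(3)[OF hol \<phi>0 b w] False w by blast
        then show False using lin(1)[OF _ _ w] d1 by auto
      qed
      ultimately have "cmod w * cmod (q w) < cmod w * 1" using q(2)[OF w] by (simp add: norm_mult)
      then show ?thesis using False by (simp add: mult_less_cancel_left)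
    qed
    \<comment> \<open>The disc automorphism carrying q 0 = d to 0, applied after q, so that the
      Schwarz lemma bounds \<open>Q\<close>.\<close>
    define Q where "Q w = (q w - of_real d) / (1 - of_real d * q w)" for w
    have den: "cmod (q w - of_real d) < cmod (1 - of_real d * q w)" if "cmod w < 1" for w
    proof -
      have "(cmod (1 - of_real d * q w))\<^sup>2 - (cmod (q w - of_real d))\<^sup>2 = (1 - d\<^sup>2) * (1 - (cmod (q w))\<^sup>2)"
        unfolding cmod_power2 by (simp add: power2_eq_square algebra_simps)
      also have "\<dots> > 0"
        using q1[OF that] d d1 by (intro mult_pos_pos) (simp_all add: abs_square_less_1)
      finally have "(cmod (q w - of_real d))\<^sup>2 < (cmod (1 - of_real d * q w))\<^sup>2" by simp
      then show ?thesis by (rule power2_less_imp_less) simp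
    qed
    have den0: "1 - of_real d * q w \<noteq> 0" if "cmod w < 1" for w
      using den[OF that] by (metis norm_ge_zero norm_zero not_less)
    have Qhol: "Q holomorphic_on ball 0 1"
      unfolding Q_def using q(1) den0 by (intro holomorphic_intros) auto
    have Qb: "cmod (Q w) < 1" if "cmod w < 1" for w
      using den[OF that] den0[OF that] by (simp add: Q_def norm_divide divide_simps)
    have Q0: "Q 0 = 0" using q(3) d by (simp add: Q_def)
    have "cmod (Q z) \<le> cmod z" using Schwarz_Lemma(1)[OF Qhol Q0 Qb z] by simp
    then have "cmod (q z - of_real d) \<le> cmod z * cmod (1 - of_real d * q z)"
      using den0[OF z] by (simp add: Q_def norm_divide divide_simps)
    also have "1 - of_real d * q z = of_real (1 - d\<^sup>2) - of_real d * (q z - of_real d)"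
      by (simp add: algebra_simps power2_eq_square)
    also have "cmod \<dots> \<le> (1 - d\<^sup>2) + d * cmod (q z - of_real d)"
    proof -
      have "d\<^sup>2 \<le> 1" using d d1 by (simp add: power_le_one)
      then have "cmod (of_real (1 - d\<^sup>2)) = 1 - d\<^sup>2" by (simp only: norm_of_real)
      moreover have "cmod (of_real d * (q z - of_real d)) = d * cmod (q z - of_real d)"
        using d by (simp add: norm_mult)
      ultimately show ?thesis using norm_triangle_ineq4 by metis
    qed
    also have "\<dots> \<le> 2 * (1 - d) + cmod (q z - of_real d)"
    proof -
      have "1 - d\<^sup>2 = (1 + d) * (1 - d)" by (simp add: algebra_simps power2_eq_square)
      also have "\<dots> \<le> 2 * (1 - d)" using d d1 by (intro mult_right_mono) auto
      finally show ?thesis using d1 mult_right_mono[of d 1 "cmod (q z - of_real d)"] by simp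
    qed
    finally have "cmod (q z - of_real d) \<le> cmod z * (2 * (1 - d) + cmod (q z - of_real d))"
      by (simp add: mult_left_mono)
    \<comment> \<open>The distance of q z from d stood on both sides; since |z| < 1 it can be
      absorbed on the left.\<close>
    then have "cmod (q z - of_real d) * (1 - cmod z) \<le> cmod z * (2 * (1 - d))"
      by (simp add: algebra_simps)
    also have "\<dots> \<le> 1 * (2 * (1 - d))" using z d1 by (intro mult_right_mono) auto
    finally have le: "cmod (q z - of_real d) \<le> 2 * (1 - d) / (1 - cmod z)"
      using z by (simp add: field_simps)
    have "\<phi> z - z = z * (q z - 1)" using q(2)[OF z] by (simp add: algebra_simps)
    then have "cmod (\<phi> z - z) \<le> cmod (q z - 1)"
      using z mult_right_mono[of "cmod z" 1 "cmod (q z - 1)"] by (simp add: norm_mult)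
    also have "\<dots> \<le> cmod (q z - of_real d) + cmod (of_real d - 1)"
      using norm_triangle_ineq[of "q z - of_real d" "of_real d - 1"] by simp
    also have "cmod (of_real d - 1) = 1 - d"
      using d1 norm_of_real[of "d - 1", where 'a = complex] by simp
    finally show ?thesis using le by (simp add: algebra_simps)
  qed
qed

text \<open>The inverse of \<phi> precomposed with z \<mapsto> s z maps the disc into itself and
  fixes 0, so by the Schwarz lemma s times its derivative at 0 has modulus at most 1. This drives
  the derivatives of the Riemann maps to 1 as their ranges exhaust the disc.\<close>

lemma deriv_lower_bound:
  assumes hol: "\<phi> holomorphic_on ball 0 1" and inj: "inj_on \<phi> (ball 0 1)" and \<phi>0: "\<phi> 0 = 0"
    and s: "0 < s" "ball 0 s \<subseteq> \<phi> ` ball 0 1"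
  shows "s \<le> cmod (deriv \<phi> 0)"
proof -
  obtain \<psi> where \<psi>: "\<psi> holomorphic_on (\<phi> ` ball 0 1)"
    "\<And>z. z \<in> ball 0 1 \<Longrightarrow> deriv \<phi> z * deriv \<psi> (\<phi> z) = 1" "\<And>z. z \<in> ball 0 1 \<Longrightarrow> \<psi> (\<phi> z) = z"
    using holomorphic_has_inverse[OF hol open_ball inj] by metis
  define \<eta> where "\<eta> z = \<psi> (of_real s * z)" for z
  have sz: "of_real s * z \<in> \<phi> ` ball 0 1" if "cmod z < 1" for z
  proof -
    have "of_real s * z \<in> ball 0 s" using that s(1) by (simp add: norm_mult)
    then show ?thesis using s(2) by blast
  qed
  have \<eta>: "\<eta> holomorphic_on ball 0 1"
    unfolding \<eta>_def using sz
    by (intro holomorphic_on_compose_gen[OF _ \<psi>(1), unfolded o_def] holomorphic_intros) auto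
  have \<eta>b: "cmod (\<eta> z) < 1" if z: "cmod z < 1" for z
  proof -
    obtain w where "w \<in> ball 0 1" "of_real s * z = \<phi> w" using sz[OF z] by blast
    then show ?thesis using \<psi>(3)[of w] by (simp add: \<eta>_def)
  qed
  have \<eta>0: "\<eta> 0 = 0" using \<psi>(3)[of 0] \<phi>0 by (simp add: \<eta>_def)
  have "0 \<in> \<phi> ` ball 0 1" using sz[of 0] by simp
  then have "(\<psi> has_field_derivative deriv \<psi> 0) (at (of_real s * 0))"
    using holomorphic_derivI[OF \<psi>(1) open_mapping_thm3[OF hol open_ball inj]] by simp
  then have "(\<eta> has_field_derivative deriv \<psi> 0 * of_real s) (at 0)"
    unfolding \<eta>_def by (rule DERIV_chain2) (auto intro!: derivative_eq_intros)
  then have "deriv \<eta> 0 = deriv \<psi> 0 * of_real s" by (rule DERIV_imp_deriv)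
  then have le: "cmod (deriv \<psi> 0) * s \<le> 1"
    using Schwarz_Lemma(2)[OF \<eta> \<eta>0 \<eta>b, of 0] s(1) by (simp add: norm_mult)
  have "cmod (deriv \<phi> 0) * cmod (deriv \<psi> 0) = 1"
    using \<psi>(2)[of 0] \<phi>0 by (simp add: norm_mult[symmetric])
  then have "s = cmod (deriv \<phi> 0) * (cmod (deriv \<psi> 0) * s)" by (simp add: mult.assoc[symmetric])
  also have "\<dots> \<le> cmod (deriv \<phi> 0) * 1" using le by (intro mult_left_mono) auto
  finally show ?thesis by simp
qed

text \<open>Each convex piece has its own l and \<zeta>. Compactness of the circle provides a
  subsequence along which both converge, and since the Riemann maps tend to the identity, the
  inequality passes to the limit.\<close>

theorem convex_harmonic_flow:
  fixes f h g :: "complex \<Rightarrow> complex"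
  assumes hol: "h holomorphic_on ball 0 1" "g holomorphic_on ball 0 1"
    and eq: "\<And>z. z \<in> ball 0 1 \<Longrightarrow> f z = h z + cnj (g z)" and f0: "f 0 = 0"
    and inj: "inj_on f (ball 0 1)" and conv: "convex (f ` ball 0 1)"
  obtains l \<zeta> where "cmod l = 1" "cmod \<zeta> = 1"
    "\<And>t z. \<lbrakk>0 < t; t < 1; cmod z < 1\<rbrakk> \<Longrightarrow> Re (l * f z) \<le> Re (l * f (\<zeta> * hyp_flow t (z / \<zeta>)))"
proof -
  define \<Omega> where "\<Omega> = f ` ball 0 1"
  have contf: "continuous_on (ball 0 1) f"
  proof -
    have "continuous_on (ball 0 1) (\<lambda>z. h z + cnj (g z))"
      using hol by (intro continuous_intros holomorphic_on_imp_continuous_on)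
    moreover have "continuous_on (ball 0 1) f \<longleftrightarrow> continuous_on (ball 0 1) (\<lambda>z. h z + cnj (g z))"
      by (rule continuous_on_cong[OF refl eq])
    ultimately show ?thesis by simp
  qed
  have op: "open \<Omega>" unfolding \<Omega>_def by (rule invariance_of_domain[OF contf open_ball inj])
  have conv: "convex \<Omega>" using conv by (simp add: \<Omega>_def)
  have "f 0 \<in> \<Omega>" by (simp add: \<Omega>_def)
  then obtain \<rho>0 where \<rho>0: "\<rho>0 > 0" "ball 0 \<rho>0 \<subseteq> \<Omega>"
    using op f0 open_contains_ball by metis
  \<comment> \<open>Shrinking \<Omega> towards 0 by 1 / \<kappa> n brings its closure inside
    \<Omega>, and the ball in \<open>O'\<close> truncates a possibly unbounded \<Omega>. As \<kappa>
    n \<le> 2 and these balls have radius at least 1, all pieces contain the same ball of radius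
    \<rho>.\<close>
  define \<kappa> where "\<kappa> n = 1 + 1 / (real n + 1)" for n
  have \<kappa>: "1 < \<kappa> n" "\<kappa> n \<le> 2" for n by (auto simp: \<kappa>_def)
  define O' where "O' n = {w. \<kappa> n *\<^sub>R w \<in> \<Omega>} \<inter> ball 0 (real n + 1)" for n
  define K where "K n = {w. \<kappa> n *\<^sub>R w \<in> closure \<Omega>} \<inter> cball 0 (real n + 1)" for n
  define \<rho> where "\<rho> = min (\<rho>0 / 2) 1"
  have \<rho>: "\<rho> > 0" using \<rho>0 by (simp add: \<rho>_def)
  have ball_O: "ball 0 \<rho> \<subseteq> O' n" for n
  proof
    fix w :: complex assume w: "w \<in> ball 0 \<rho>"
    then have "cmod w < \<rho>0 / 2" "cmod w < 1" by (simp_all add: \<rho>_def)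
    moreover have "\<kappa> n * cmod w \<le> 2 * cmod w" using \<kappa>[of n] by (intro mult_right_mono) auto
    ultimately have "\<kappa> n *\<^sub>R w \<in> ball 0 \<rho>0" using \<kappa>[of n] by simp
    then show "w \<in> O' n" using \<rho>0 \<open>cmod w < 1\<close> by (auto simp: O'_def)
  qed
  have vim: "{w. \<kappa> n *\<^sub>R w \<in> X} = (\<lambda>w. \<kappa> n *\<^sub>R w) -` X" for n and X :: "complex set" by auto
  have conv_O: "convex (O' n)" for n
    unfolding O'_def vim
    by (intro convex_Int convex_linear_vimage conv) (auto intro: linearI simp: algebra_simps)
  have open_O: "open (O' n)" for n
    unfolding O'_def vim using op by (intro open_Int open_vimage continuous_intros) auto
  have O_K: "O' n \<subseteq> K n" for n
    using closure_subset[of \<Omega>] by (auto simp: O'_def K_def)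
  have cpt_K: "compact (K n)" for n
    unfolding K_def vim by (intro closed_Int_compact closed_vimage continuous_intros) auto
  \<comment> \<open>A point of the closure of a convex set, moved part of the way towards an
    interior point, here 0, lies in the interior.\<close>
  have K_\<Omega>: "K n \<subseteq> f ` ball 0 1" for n
  proof
    fix w assume "w \<in> K n"
    then have w: "\<kappa> n *\<^sub>R w \<in> closure \<Omega>" by (simp add: K_def)
    have "0 \<in> interior \<Omega>" using \<rho>0 op by (auto simp: interior_open)
    then have "\<kappa> n *\<^sub>R w - (1 - 1 / \<kappa> n) *\<^sub>R (\<kappa> n *\<^sub>R w - 0) \<in> interior \<Omega>"
      using \<kappa>[of n] by (intro mem_interior_closure_convex_shrink[OF conv _ w]) auto
    also have "\<kappa> n *\<^sub>R w - (1 - 1 / \<kappa> n) *\<^sub>R (\<kappa> n *\<^sub>R w - 0) = w"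
      using \<kappa>[of n] by (simp add: algebra_simps)
    finally show "w \<in> f ` ball 0 1" using op by (simp add: interior_open \<Omega>_def)
  qed
  define P where "P n \<phi> l \<zeta> \<longleftrightarrow> \<phi> holomorphic_on ball 0 1 \<and> \<phi> ` ball 0 1 = {z \<in> ball 0 1. f z \<in> O' n} \<and>
    inj_on \<phi> (ball 0 1) \<and> \<phi> 0 = 0 \<and> Im (deriv \<phi> 0) = 0 \<and> 0 < Re (deriv \<phi> 0) \<and> cmod l = 1 \<and> cmod \<zeta> = 1 \<and>
    (\<forall>t z. 0 < t \<longrightarrow> t < 1 \<longrightarrow> cmod z < 1 \<longrightarrow> Re (l * f (\<phi> z)) \<le> Re (l * f (\<phi> (\<zeta> * hyp_flow t (z / \<zeta>)))))"
    for n \<phi> l \<zeta>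
  have "\<exists>\<phi> l \<zeta>. P n \<phi> l \<zeta>" for n
    unfolding P_def
    by (rule convex_piece_flow[OF hol eq f0 inj conv_O open_O O_K cpt_K K_\<Omega> \<rho> ball_O, of n]) blast+
  then obtain \<phi> l \<zeta> where P: "\<And>n. P n (\<phi> n) (l n) (\<zeta> n)" by metis
  have \<phi>: "\<And>n. \<phi> n holomorphic_on ball 0 1" "\<And>n. \<phi> n ` ball 0 1 = {z \<in> ball 0 1. f z \<in> O' n}"
    "\<And>n. inj_on (\<phi> n) (ball 0 1)" "\<And>n. \<phi> n 0 = 0" "\<And>n. Im (deriv (\<phi> n) 0) = 0" "\<And>n. 0 < Re (deriv (\<phi> n) 0)"
    and l\<zeta>: "\<And>n. cmod (l n) = 1" "\<And>n. cmod (\<zeta> n) = 1"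
    using P unfolding P_def by blast+
  have flow: "Re (l n * f (\<phi> n z)) \<le> Re (l n * f (\<phi> n (\<zeta> n * hyp_flow t (z / \<zeta> n))))"
    if "0 < t" "t < 1" "cmod z < 1" for n t z
    using P[of n] that unfolding P_def by blast
  have \<phi>b: "cmod (\<phi> n z) < 1" if "cmod z < 1" for n z
  proof -
    have "\<phi> n z \<in> \<phi> n ` ball 0 1" using that by simp
    then show ?thesis unfolding \<phi>(2) by simp
  qed
  define d where "d n = Re (deriv (\<phi> n) 0)" for n
  have d: "deriv (\<phi> n) 0 = of_real (d n)" "0 < d n" for n
    using \<phi>(5,6)[of n] by (auto simp: d_def complex_eq_iff)
  have d1: "d n \<le> 1" for n
  proof (rule near_identity(1)[of "\<phi> n"])
    show "cmod (\<phi> n z) < 1" if "cmod z < 1" for z using \<phi>b[OF that] .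
    show "cmod 0 < 1" by simp
  qed (rule \<phi>(1) \<phi>(4) d)+
  \<comment> \<open>The image of the closed disc of radius s is compact in \<Omega>, so it lies in
    \<open>O' n\<close> for large n, and the range of \<phi> n contains the disc of radius
    s.\<close>
  have d_ev: "eventually (\<lambda>n. s \<le> d n) sequentially" if s: "0 < s" "s < 1" for s
  proof -
    define C where "C = f ` cball 0 s"
    have cb: "cball 0 s \<subseteq> ball (0::complex) 1" using s by auto
    have C: "compact C" unfolding C_def
      by (intro compact_continuous_image continuous_on_subset[OF contf cb]) auto
    have "C \<subseteq> \<Omega>" unfolding C_def \<Omega>_def using cb by blast
    then obtain e where e: "e > 0" "(\<Union>x\<in>C. ball x e) \<subseteq> \<Omega>"
      using compact_subset_open_imp_ball_epsilon_subset[OF C op] by metis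
    obtain B where B: "B > 0" "\<And>w. w \<in> C \<Longrightarrow> cmod w \<le> B"
      using compact_imp_bounded[OF C] bounded_pos by metis
    obtain N where N: "B / e + B < real N" using reals_Archimedean2 by blast
    have "s \<le> d n" if "n \<ge> N" for n
    proof -
      have n: "B / e < real n" "B < real n"
        using N that B e by (smt (verit) divide_pos_pos of_nat_mono)+
      have "ball 0 s \<subseteq> \<phi> n ` ball 0 1"
      proof
        fix z :: complex assume "z \<in> ball 0 s"
        then have z: "z \<in> ball 0 1" "f z \<in> C" using s by (auto simp: C_def)
        have "dist (f z) (\<kappa> n *\<^sub>R f z) = cmod (f z) / (real n + 1)"
        proof -
          have "f z - \<kappa> n *\<^sub>R f z = - ((1 / (real n + 1)) *\<^sub>R f z)" by (simp add: \<kappa>_def scaleR_left_distrib)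
          then show ?thesis by (simp add: dist_norm)
        qed
        also have "\<dots> \<le> B / (real n + 1)" using B(2)[OF z(2)] by (intro divide_right_mono) auto
        also have "\<dots> < e" using n(1) e(1) B(1) by (simp add: field_simps)
        finally have "\<kappa> n *\<^sub>R f z \<in> ball (f z) e" by simp
        then have "\<kappa> n *\<^sub>R f z \<in> \<Omega>" using e(2) z(2) by blast
        moreover have "cmod (f z) < real n + 1" using B(2)[OF z(2)] n(2) by simp
        ultimately show "z \<in> \<phi> n ` ball 0 1" unfolding \<phi>(2) using z by (simp add: O'_def)
      qed
      then have "s \<le> cmod (deriv (\<phi> n) 0)" by (rule deriv_lower_bound[OF \<phi>(1,3,4) s(1)])
      then show ?thesis using d[of n] by simp
    qed
    then show ?thesis unfolding eventually_sequentially by blast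
  qed
  have dlim: "d \<longlonglongrightarrow> 1"
  proof (rule order_tendstoI)
    fix a :: real assume "a < 1"
    define s where "s = (max a 0 + 1) / 2"
    have "0 < s" "s < 1" "a < s" using \<open>a < 1\<close> by (auto simp: s_def max_def)
    then show "eventually (\<lambda>n. a < d n) sequentially"
      using d_ev[of s] by (auto elim!: eventually_mono)
  next
    fix a :: real assume "1 < a"
    then show "eventually (\<lambda>n. d n < a) sequentially" using d1 by (intro always_eventually) (meson le_less_trans)
  qed
  have "compact (sphere (0::complex) 1 \<times> sphere (0::complex) 1)" by (intro compact_Times) auto
  then have "seq_compact (sphere (0::complex) 1 \<times> sphere (0::complex) 1)" by (rule compact_imp_seq_compact)
  moreover have "\<forall>n. (\<lambda>n. (l n, \<zeta> n)) n \<in> sphere 0 1 \<times> sphere 0 1" using l\<zeta> by simp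
  ultimately obtain L r where L: "L \<in> sphere (0::complex) 1 \<times> sphere (0::complex) 1" "strict_mono r"
    "((\<lambda>n. (l n, \<zeta> n)) \<circ> r) \<longlonglongrightarrow> L"
    by (rule seq_compactE)
  define l0 \<zeta>0 where "l0 = fst L" and "\<zeta>0 = snd L"
  have l0: "cmod l0 = 1" "cmod \<zeta>0 = 1" using L(1) by (auto simp: l0_def \<zeta>0_def)
  have lim: "(\<lambda>n. l (r n)) \<longlonglongrightarrow> l0" "(\<lambda>n. \<zeta> (r n)) \<longlonglongrightarrow> \<zeta>0"
    using tendsto_fst[OF L(3)] tendsto_snd[OF L(3)] by (simp_all add: o_def l0_def \<zeta>0_def)
  have dr: "(\<lambda>n. d (r n)) \<longlonglongrightarrow> 1" using LIMSEQ_subseq_LIMSEQ[OF dlim L(2)] by (simp add: o_def)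
  \<comment> \<open>The arguments may vary with n, because on the right of the flow inequality
    \<zeta> (r n) varies too; the bound of \<open>near_identity\<close> is locally uniform in
    z.\<close>
  have key: "(\<lambda>n. f (\<phi> (r n) (y n))) \<longlonglongrightarrow> f y0" if y: "y \<longlonglongrightarrow> y0" "\<And>n. cmod (y n) < 1" "cmod y0 < 1" for y y0
  proof -
    have "(\<lambda>n. (1 - d (r n)) * (1 + 2 / (1 - cmod (y n)))) \<longlonglongrightarrow> (1 - 1) * (1 + 2 / (1 - cmod y0))"
      using y by (intro tendsto_intros dr) auto
    then have z: "(\<lambda>n. (1 - d (r n)) * (1 + 2 / (1 - cmod (y n)))) \<longlonglongrightarrow> 0" by simp
    have "(\<lambda>n. \<phi> (r n) (y n) - y n) \<longlonglongrightarrow> 0"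
      by (rule Lim_null_comparison[OF _ z])
        (use near_identity(2)[OF \<phi>(1) \<phi>b \<phi>(4) d y(2)] in \<open>auto intro!: always_eventually\<close>)
    then have "(\<lambda>n. (\<phi> (r n) (y n) - y n) + y n) \<longlonglongrightarrow> 0 + y0" using y(1) by (rule tendsto_add)
    then have "(\<lambda>n. \<phi> (r n) (y n)) \<longlonglongrightarrow> y0" by simp
    moreover have "isCont f y0" using contf y(3) by (simp add: continuous_on_eq_continuous_at)
    ultimately show ?thesis by (rule isCont_tendsto_compose[rotated])
  qed
  show ?thesis
  proof (rule that[OF l0])
    fix t :: real and z :: complex assume t: "0 < t" "t < 1" and z: "cmod z < 1"
    have ne: "\<zeta>0 \<noteq> 0" "1 + of_real t * (z / \<zeta>0) \<noteq> 0"
      using l0(2) hyp_flow_denom_nz[OF t, of "z / \<zeta>0"] z by (auto simp: norm_divide)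
    have y: "(\<lambda>n. \<zeta> (r n) * hyp_flow t (z / \<zeta> (r n))) \<longlonglongrightarrow> \<zeta>0 * hyp_flow t (z / \<zeta>0)"
      unfolding hyp_flow_def using ne by (intro tendsto_intros lim)
    have b: "cmod (w * hyp_flow t (z / w)) < 1" if "cmod w = 1" for w
      using cmod_hyp_flow(3)[OF t, of "z / w"] z that by (simp add: norm_mult norm_divide)
    have 1: "(\<lambda>n. Re (l (r n) * f (\<phi> (r n) z))) \<longlonglongrightarrow> Re (l0 * f z)"
      using key[of "\<lambda>_. z" z] z by (intro tendsto_intros lim) auto
    have 2: "(\<lambda>n. Re (l (r n) * f (\<phi> (r n) (\<zeta> (r n) * hyp_flow t (z / \<zeta> (r n)))))) \<longlonglongrightarrow> Re (l0 * f (\<zeta>0 * hyp_flow t (z / \<zeta>0)))"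
      using key[OF y] b l\<zeta>(2) l0(2) by (intro tendsto_intros lim) auto
    show "Re (l0 * f z) \<le> Re (l0 * f (\<zeta>0 * hyp_flow t (z / \<zeta>0)))"
      by (rule LIMSEQ_le[OF 1 2]) (use flow[OF t z] in auto)
  qed
qed

text \<open>The expression is the derivative at t = 0 of Re (l f) along the flow. Were it negative,
  the real part would fall below its initial value for small t > 0.\<close>

lemma convex_harmonic_Re_nonneg:
  fixes f h g :: "complex \<Rightarrow> complex"
  assumes hol: "h holomorphic_on ball 0 1" "g holomorphic_on ball 0 1"
    and eq: "\<And>z. z \<in> ball 0 1 \<Longrightarrow> f z = h z + cnj (g z)" and f0: "f 0 = 0"
    and inj: "inj_on f (ball 0 1)" and conv: "convex (f ` ball 0 1)"
  obtains l \<zeta> where "cmod l = 1" "cmod \<zeta> = 1"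
    "\<And>z. cmod z < 1 \<Longrightarrow> 0 \<le> Re ((l * deriv h z + cnj l * deriv g z) * (\<zeta> - cnj \<zeta> * z\<^sup>2))"
proof -
  obtain l \<zeta> where l: "cmod l = 1" and \<zeta>: "cmod \<zeta> = 1"
    and flow: "\<And>t z. \<lbrakk>0 < t; t < 1; cmod z < 1\<rbrakk> \<Longrightarrow> Re (l * f z) \<le> Re (l * f (\<zeta> * hyp_flow t (z / \<zeta>)))"
    by (rule convex_harmonic_flow[OF hol eq f0 inj conv]) (assumption | rule that)+
  have \<zeta>0: "\<zeta> \<noteq> 0" using \<zeta> by auto
  have \<zeta>i: "1 / \<zeta> = cnj \<zeta>"
    using complex_norm_square[of \<zeta>] \<zeta> \<zeta>0 by (simp add: field_simps)
  define F where "F w = l * h w + cnj l * g w" for w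
  have ReF: "Re (l * f w) = Re (F w)" if "w \<in> ball 0 1" for w
    using eq[OF that] by (simp add: F_def algebra_simps)
  have "0 \<le> Re ((l * deriv h z + cnj l * deriv g z) * (\<zeta> - cnj \<zeta> * z\<^sup>2))" if z: "cmod z < 1" for z
  proof (rule ccontr)
    assume neg: "\<not> ?thesis"
    define a where "a = z / \<zeta>"
    have za: "\<zeta> * a = z" using \<zeta>0 by (simp add: a_def)
    have "(h has_field_derivative deriv h z) (at z)" "(g has_field_derivative deriv g z) (at z)"
      using hol z by (auto intro!: holomorphic_derivI[OF _ open_ball])
    then have dF: "(F has_field_derivative (l * deriv h z + cnj l * deriv g z)) (at z)"
      unfolding F_def by (auto intro!: derivative_eq_intros)
    \<comment> \<open>The flow with complex time, so that the complex chain rule applies; 1 /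
      \<zeta> = cnj \<zeta> turns its velocity \<zeta> (1 - a^2) into \<zeta> - cnj \<zeta>
      z^2.\<close>
    define m where "m \<tau> = \<zeta> * ((a + \<tau>) / (1 + \<tau> * a))" for \<tau>
    have "(m has_field_derivative \<zeta> * (1 - a\<^sup>2)) (at 0)"
      unfolding m_def by (rule derivative_eq_intros refl | simp add: power2_eq_square)+
    moreover have "m 0 = z" by (simp add: m_def za)
    ultimately have "((\<lambda>\<tau>. F (m \<tau>)) has_field_derivative (l * deriv h z + cnj l * deriv g z) * (\<zeta> * (1 - a\<^sup>2))) (at (of_real 0))"
      using DERIV_chain2[of F _ m 0 "\<zeta> * (1 - a\<^sup>2)" UNIV] dF by simp
    moreover have "\<zeta> * (1 - a\<^sup>2) = \<zeta> - cnj \<zeta> * z\<^sup>2"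
      using \<zeta>0 unfolding a_def \<zeta>i[symmetric] by (simp add: field_simps power2_eq_square)
    ultimately have "((\<lambda>\<tau>. F (m \<tau>)) has_field_derivative (l * deriv h z + cnj l * deriv g z) * (\<zeta> - cnj \<zeta> * z\<^sup>2)) (at (of_real 0))"
      by simp
    then have "((\<lambda>t. F (m (of_real t))) has_vector_derivative (l * deriv h z + cnj l * deriv g z) * (\<zeta> - cnj \<zeta> * z\<^sup>2)) (at 0)"
      by (rule has_vector_derivative_real_field)
    then have der: "((\<lambda>t. Re (F (m (of_real t)))) has_field_derivative Re ((l * deriv h z + cnj l * deriv g z) * (\<zeta> - cnj \<zeta> * z\<^sup>2))) (at 0)"
      by (rule has_field_derivative_Re)
    obtain e where e: "e > 0" "\<forall>t>0. t < e \<longrightarrow> Re (F (m (of_real (0 + t)))) < Re (F (m (of_real 0)))"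
    proof -
      have "Re ((l * deriv h z + cnj l * deriv g z) * (\<zeta> - cnj \<zeta> * z\<^sup>2)) < 0" using neg by simp
      from DERIV_neg_dec_right[OF der this] show ?thesis using that by auto
    qed
    define t where "t = min (e / 2) (1/2)"
    have t: "0 < t" "t < 1" "t < e" using e(1) by (auto simp: t_def)
    have "cmod a < 1" using z \<zeta> by (simp add: a_def norm_divide)
    then have "cmod (\<zeta> * hyp_flow t a) < 1" using cmod_hyp_flow(3)[OF t(1,2), of a] \<zeta> by (simp add: norm_mult)
    then have "Re (F z) \<le> Re (F (\<zeta> * hyp_flow t a))"
      using flow[OF t(1,2) z] ReF z by (simp add: a_def)
    moreover have "\<zeta> * hyp_flow t a = m (of_real t)" by (simp add: m_def hyp_flow_def)
    ultimately show False using e(2)[rule_format, OF t(1,3)] \<open>m 0 = z\<close> by simp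
  qed
  then show ?thesis using that[OF l \<zeta>] by blast
qed

section \<open>Coefficient bounds\<close>

text \<open>Pairing p with u^(-n) and with u^n on a circle and adding the conjugate kills the
  analytic half, so that the n-th coefficient becomes an integral against the positive Re p.\<close>

lemma Caratheodory_coeff_bound:
  assumes hol: "p holomorphic_on ball 0 1" and pos: "\<And>z. cmod z < 1 \<Longrightarrow> 0 \<le> Re (p z)" and n: "n \<ge> 1"
  shows "cmod (fps_nth (fps_expansion p 0) n) \<le> 2 * Re (p 0)"
proof -
  define a where "a = fps_nth (fps_expansion p 0) n"
  have main: "cmod a * r ^ n \<le> 2 * Re (p 0)" if r: "0 < r" "r < 1" for r
  proof -
    define u where "u x = of_real r * exp (2 * of_real pi * \<i> * of_real x)" for x :: real
    have ux: "circlepath 0 r x = u x" "vector_derivative (circlepath 0 r) (at x) = 2 * pi * \<i> * u x" for x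
      using vector_derivative_circlepath[of 0 r x] by (simp_all add: circlepath u_def)
    have nu: "cmod (u x) = r" for x using r by (simp add: u_def norm_mult)
    have u0: "u x \<noteq> 0" for x using nu[of x] r by auto
    have cb: "cball 0 r \<subseteq> ball (0::complex) 1" using r by auto
    have c: "continuous_on (cball 0 r) p" and h: "p holomorphic_on ball 0 r"
      using r by (auto intro: continuous_on_subset[OF holomorphic_on_imp_continuous_on[OF hol]]
          holomorphic_on_subset[OF hol])
    have int: "((\<lambda>x. p (u x) / u x ^ k) has_integral (deriv ^^ k) p 0 / fact k) {0..1}" for k
    proof -
      have "((\<lambda>u. p u / (u - 0) ^ Suc k) has_contour_integral 2 * pi * \<i> / fact k * (deriv ^^ k) p 0) (circlepath 0 r)"
        using r by (intro Cauchy_has_contour_integral_higher_derivative_circlepath c h) auto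
      then have "((\<lambda>x. p (u x) / u x ^ Suc k * (2 * pi * \<i> * u x)) has_integral 2 * pi * \<i> / fact k * (deriv ^^ k) p 0) {0..1}"
        by (simp only: has_contour_integral ux diff_zero)
      then have "((\<lambda>x. (1 / (2 * pi * \<i>)) * (p (u x) / u x ^ Suc k * (2 * pi * \<i> * u x))) has_integral
          (1 / (2 * pi * \<i>)) * (2 * pi * \<i> / fact k * (deriv ^^ k) p 0)) {0..1}"
        by (rule has_integral_mult_right)
      then show ?thesis using u0 by (simp add: field_simps)
    qed
    have int0: "((\<lambda>x. p (u x) * u x ^ n) has_integral 0) {0..1}"
    proof -
      have "((\<lambda>u. p u * u ^ (n - 1)) has_contour_integral 0) (circlepath 0 r)"
        using r by (intro Cauchy_theorem_disc_simple[of _ 0 1] holomorphic_intros hol) auto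
      then have "((\<lambda>x. p (u x) * u x ^ (n - 1) * (2 * pi * \<i> * u x)) has_integral 0) {0..1}"
        by (simp only: has_contour_integral ux)
      then have "((\<lambda>x. (1 / (2 * pi * \<i>)) * (p (u x) * u x ^ (n - 1) * (2 * pi * \<i> * u x))) has_integral (1 / (2 * pi * \<i>)) * 0) {0..1}"
        by (rule has_integral_mult_right)
      moreover have "(1 / (2 * pi * \<i>)) * (p (u x) * u x ^ (n - 1) * (2 * pi * \<i> * u x)) = p (u x) * u x ^ n" for x
        using power_minus_mult[of n "u x"] n by (simp add: field_simps)
      ultimately show ?thesis by simp
    qed
    have "((\<lambda>x. cnj (p (u x) * u x ^ n)) has_integral cnj 0) {0..1}"
      using int0 has_integral_cnj[of "\<lambda>x. p (u x) * u x ^ n" 0 "{0..1}"] by (simp add: o_def)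
    \<comment> \<open>On the circle cnj u = r^2 / u, so the conjugate of u^n divided by r^(2 n) is
      u^(-n).\<close>
    then have "((\<lambda>x. of_real (1 / r ^ (2 * n)) * cnj (p (u x) * u x ^ n)) has_integral of_real (1 / r ^ (2 * n)) * cnj 0) {0..1}"
      by (rule has_integral_mult_right)
    moreover have "of_real (1 / r ^ (2 * n)) * cnj (p (u x) * u x ^ n) = cnj (p (u x)) / u x ^ n" for x
    proof -
      have "u x * cnj (u x) = of_real (r\<^sup>2)" using complex_norm_square[of "u x"] nu[of x] by simp
      then have "u x ^ n * cnj (u x) ^ n = of_real (r ^ (2 * n))"
        by (metis of_real_power power_mult power_mult_distrib)
      then have "cnj (u x) ^ n = of_real (r ^ (2 * n)) / u x ^ n" using u0[of x] by (simp add: field_simps)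
      then show ?thesis using r by simp
    qed
    ultimately have int1: "((\<lambda>x. cnj (p (u x)) / u x ^ n) has_integral 0) {0..1}" by simp
    have "((\<lambda>x. p (u x) / u x ^ n + cnj (p (u x)) / u x ^ n) has_integral a + 0) {0..1}"
      using int[of n] int1 unfolding a_def fps_expansion_def fps_nth_Abs_fps by (rule has_integral_add)
    moreover have "p (u x) / u x ^ n + cnj (p (u x)) / u x ^ n = of_real (2 * Re (p (u x))) / u x ^ n" for x
      by (simp add: add_divide_distrib[symmetric] complex_add_cnj)
    ultimately have ia: "((\<lambda>x. of_real (2 * Re (p (u x))) / u x ^ n) has_integral a) {0..1}" by simp
    have "((\<lambda>x. p (u x)) has_integral p 0) {0..1}" using int[of 0] by simp
    then have "((\<lambda>x. Re (p (u x))) has_integral Re (p 0)) {0..1}"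
      using has_integral_linear[OF _ bounded_linear_Re] by (simp add: o_def)
    then have ib: "((\<lambda>x. 2 * Re (p (u x)) / r ^ n) has_integral 2 * Re (p 0) / r ^ n) {0..1}"
      by (intro has_integral_divide has_integral_mult_right)
    have "cmod (integral {0..1} (\<lambda>x. of_real (2 * Re (p (u x))) / u x ^ n)) \<le> integral {0..1} (\<lambda>x. 2 * Re (p (u x)) / r ^ n)"
    proof (rule integral_norm_bound_integral)
      fix x :: real
      have "0 \<le> Re (p (u x))" using pos[of "u x"] nu r by simp
      then show "cmod (of_real (2 * Re (p (u x))) / u x ^ n) \<le> 2 * Re (p (u x)) / r ^ n"
        using nu[of x] by (simp add: norm_divide norm_power norm_mult)
    qed (use ia ib in \<open>auto simp: has_integral_iff\<close>)
    then have "cmod a \<le> 2 * Re (p 0) / r ^ n" by (simp only: integral_unique[OF ia] integral_unique[OF ib])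
    then show ?thesis using r by (simp add: field_simps)
  qed
  have "((\<lambda>r. cmod a * r ^ n) \<longlongrightarrow> cmod a * 1 ^ n) (at_left 1)"
    by (intro tendsto_intros)
  moreover have "eventually (\<lambda>r::real. cmod a * r ^ n \<le> 2 * Re (p 0)) (at_left 1)"
    using eventually_at_left_real[of 0 1] by (auto elim!: eventually_mono intro!: main)
  ultimately have "cmod a * 1 ^ n \<le> 2 * Re (p 0)"
    by (intro tendsto_upperbound) auto
  then show ?thesis by (simp add: a_def)
qed

text \<open>The recurrence Q_n = P_n + d Q_(n-2) adds at most 2 every second step. In terms of
  majorants, (1 + z) / (1 - z) divided by 1 - z^2 is (1 - z)^(-2).\<close>

lemma fps_div_one_minus_square_bound:
  fixes P Q :: "complex fps"
  assumes QP: "Q * (1 - fps_const d * fps_X ^ 2) = P" and d: "cmod d \<le> 1"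
    and P0: "cmod (fps_nth P 0) \<le> 1" and P: "\<And>n. n \<ge> 1 \<Longrightarrow> cmod (fps_nth P n) \<le> 2"
  shows "cmod (fps_nth Q n) \<le> real n + 1"
proof (induction n rule: less_induct)
  case (less n)
  have "fps_nth P n = fps_nth (Q - fps_const d * (Q * fps_X ^ 2)) n"
    unfolding QP[symmetric] by (simp add: algebra_simps)
  then have eq: "fps_nth P n = fps_nth Q n - d * (if n < 2 then 0 else fps_nth Q (n - 2))"
    by (simp add: fps_X_power_mult_right_nth)
  show ?case
  proof (cases "n < 2")
    case True
    then have "fps_nth Q n = fps_nth P n" using eq by simp
    then show ?thesis using True P0 P[of n] by (cases "n = 0") auto
  next
    case False
    have "fps_nth Q n = fps_nth P n + d * fps_nth Q (n - 2)" using eq False by simp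
    then have "cmod (fps_nth Q n) \<le> cmod (fps_nth P n) + cmod d * cmod (fps_nth Q (n - 2))"
      by (metis norm_mult norm_triangle_ineq)
    also have "\<dots> \<le> 2 + 1 * (real (n - 2) + 1)"
      using P[of n] False less[of "n - 2"] d by (intro add_mono mult_mono) auto
    also have "\<dots> = real n + 1" using False by simp
    finally show ?thesis .
  qed
qed

lemma sum_Suc_le: "(\<Sum>i=0..n. real i + 1) = real ((n + 1) * (n + 2)) / 2"
  by (induction n) (auto simp: field_simps)

text \<open>Since g' = \<omega> h', the function p of nonnegative real part factors as l \<zeta> h'
  (1 + c \<omega>) (1 - d z^2). Hence h' is the product of p / (l \<zeta>), 1 / (1 - d z^2) and E =
  1 / (1 + c \<omega>); the first two together are majorized by (1 - z)^(-2), the last by 1 / (1 -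
  z). For g' the last factor becomes \<omega> E = (1 - E) / c.\<close>

lemma convex_harmonic_coeff_bounds:
  fixes f h g :: "complex \<Rightarrow> complex"
  assumes hol: "h holomorphic_on ball 0 1" "g holomorphic_on ball 0 1"
    and eq: "\<And>z. z \<in> ball 0 1 \<Longrightarrow> f z = h z + cnj (g z)" and f0: "f 0 = 0"
    and inj: "inj_on f (ball 0 1)" and conv: "convex (f ` ball 0 1)"
    and h1: "deriv h 0 = 1" and g1: "deriv g 0 = 0"
    and sp: "\<And>z. cmod z < 1 \<Longrightarrow> cmod (deriv g z) < cmod (deriv h z)"
  shows "cmod (fps_nth (fps_expansion h 0) (Suc n)) \<le> (real n + 2) / 2"
    and "cmod (fps_nth (fps_expansion g 0) (Suc n)) \<le> real n / 2"
proof -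
  obtain l \<zeta> where l: "cmod l = 1" and \<zeta>: "cmod \<zeta> = 1"
    and pos: "\<And>z. cmod z < 1 \<Longrightarrow> 0 \<le> Re ((l * deriv h z + cnj l * deriv g z) * (\<zeta> - cnj \<zeta> * z\<^sup>2))"
    by (rule convex_harmonic_Re_nonneg[OF hol eq f0 inj conv]) (assumption | rule that)+
  have l0: "l \<noteq> 0" and \<zeta>0: "\<zeta> \<noteq> 0" using l \<zeta> by auto
  define c where "c = cnj l / l"
  define d where "d = cnj \<zeta> / \<zeta>"
  have c1: "cmod c = 1" and d1: "cmod d = 1" using l \<zeta> by (simp_all add: c_def d_def norm_divide)
  have c0: "c \<noteq> 0" using c1 by auto
  define \<omega> where "\<omega> z = deriv g z / deriv h z" for z
  define E where "E z = 1 / (1 + c * \<omega> z)" for z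
  define p where "p z = (l * deriv h z + cnj l * deriv g z) * (\<zeta> - cnj \<zeta> * z\<^sup>2)" for z
  have h0: "deriv h z \<noteq> 0" if "cmod z < 1" for z using sp[OF that] by auto
  have hol': "deriv h holomorphic_on ball 0 1" "deriv g holomorphic_on ball 0 1"
    using hol by (auto intro: holomorphic_deriv)
  have \<omega>: "\<omega> holomorphic_on ball 0 1"
    unfolding \<omega>_def by (rule holomorphic_on_divide[OF hol'(2,1)]) (use h0 in auto)
  have \<omega>1: "cmod (c * \<omega> z) < 1" if "cmod z < 1" for z
    using sp[OF that] h0[OF that] by (simp add: \<omega>_def norm_mult norm_divide c1)
  have nz: "1 + c * \<omega> z \<noteq> 0" if "cmod z < 1" for z
    using \<omega>1[OF that] by (metis add_eq_0_iff norm_minus_cancel norm_one less_irrefl)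
  have E: "E holomorphic_on ball 0 1"
    unfolding E_def using \<omega> nz by (intro holomorphic_intros) auto
  have p: "p holomorphic_on ball 0 1"
    unfolding p_def
    by (intro holomorphic_on_mult holomorphic_on_add holomorphic_on_diff holomorphic_on_const
        holomorphic_on_power holomorphic_on_ident hol')
  have an: "F analytic_on {0}" if "F holomorphic_on ball 0 1" for F :: "complex \<Rightarrow> complex"
    using that analytic_at[of F 0] open_ball[of "0::complex" 1] centre_in_ball[of "0::complex" 1] by auto
  define FE where "FE = fps_expansion E 0"
  define FP where "FP = fps_const (1 / (l * \<zeta>)) * fps_expansion p 0"
  define Hd where "Hd = fps_deriv (fps_expansion h 0)"
  define Gd where "Gd = fps_deriv (fps_expansion g 0)"
  define D where "D = 1 - fps_const d * fps_X ^ 2"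
  have xE: "E has_fps_expansion FE"
    unfolding FE_def by (intro analytic_at_imp_has_fps_expansion_0 an E)
  have xP: "(\<lambda>z. 1 / (l * \<zeta>) * p z) has_fps_expansion FP"
    unfolding FP_def by (intro fps_expansion_intros analytic_at_imp_has_fps_expansion_0 an p)
  have xH: "deriv h has_fps_expansion Hd" and xG: "deriv g has_fps_expansion Gd"
    unfolding Hd_def Gd_def by (intro has_fps_expansion_deriv analytic_at_imp_has_fps_expansion_0 an hol)+
  have xD: "(\<lambda>z. 1 - d * z ^ 2) has_fps_expansion D"
    unfolding D_def by (intro fps_expansion_intros)
  have fac: "1 / (l * \<zeta>) * p z = deriv h z * (1 + c * \<omega> z) * (1 - d * z\<^sup>2)" if "cmod z < 1" for z
  proof -
    have "p z = (l * (deriv h z * (1 + c * \<omega> z))) * (\<zeta> * (1 - d * z\<^sup>2))"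
      using l0 \<zeta>0 h0[OF that] by (simp add: p_def c_def d_def \<omega>_def field_simps)
    then show ?thesis using l0 \<zeta>0 by simp
  qed
  have ev: "eventually (\<lambda>z::complex. cmod z < 1) (nhds 0)"
    using eventually_nhds_in_open[OF open_ball[of "0::complex" 1]] by simp
  have f1: "Hd * D = FP * FE"
  proof (rule fps_expansion_unique_complex)
    show "(\<lambda>z. deriv h z * (1 - d * z ^ 2)) has_fps_expansion Hd * D"
      by (intro has_fps_expansion_mult xH xD)
    have "(\<lambda>z. (1 / (l * \<zeta>) * p z) * E z) has_fps_expansion FP * FE"
      by (intro has_fps_expansion_mult xP xE)
    moreover have "eventually (\<lambda>z. (1 / (l * \<zeta>) * p z) * E z = deriv h z * (1 - d * z ^ 2)) (nhds 0)"
      using ev by eventually_elim (use fac nz in \<open>simp add: E_def\<close>)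
    ultimately show "(\<lambda>z. deriv h z * (1 - d * z ^ 2)) has_fps_expansion FP * FE"
      by (subst has_fps_expansion_cong) (auto elim: eventually_mono)
  qed
  have f2: "Gd * D = FP * (fps_const (1 / c) * (1 - FE))"
  proof (rule fps_expansion_unique_complex)
    show "(\<lambda>z. deriv g z * (1 - d * z ^ 2)) has_fps_expansion Gd * D"
      by (intro has_fps_expansion_mult xG xD)
    have "(\<lambda>z. (1 / (l * \<zeta>) * p z) * (1 / c * (1 - E z))) has_fps_expansion FP * (fps_const (1 / c) * (1 - FE))"
      by (intro fps_expansion_intros xP xE)
    moreover have "eventually (\<lambda>z. (1 / (l * \<zeta>) * p z) * (1 / c * (1 - E z)) = deriv g z * (1 - d * z ^ 2)) (nhds 0)"
      using ev
    proof eventually_elim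
      case (elim z)
      have "(1 + c * \<omega> z) * (1 - E z) = c * \<omega> z"
        using nz[OF elim] by (simp add: E_def field_simps)
      moreover have "deriv h z * \<omega> z = deriv g z" using h0[OF elim] by (simp add: \<omega>_def)
      moreover have "(1 / (l * \<zeta>) * p z) * (1 / c * (1 - E z))
          = deriv h z * ((1 + c * \<omega> z) * (1 - E z)) / c * (1 - d * z\<^sup>2)"
        unfolding fac[OF elim] by simp
      ultimately show ?case using c0 by simp
    qed
    ultimately show "(\<lambda>z. deriv g z * (1 - d * z ^ 2)) has_fps_expansion FP * (fps_const (1 / c) * (1 - FE))"
      by (subst has_fps_expansion_cong) (auto elim: eventually_mono)
  qed
  have D0: "fps_nth D 0 = 1" by (simp add: D_def)
  define Q where "Q = FP * inverse D"
  have "inverse D * D = 1" using D0 by (intro inverse_mult_eq_1) auto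
  then have QD: "Q * D = FP" by (simp add: Q_def mult.assoc)
  have D_ne: "D \<noteq> 0" using D0 by auto
  have "Hd * D = (Q * FE) * D" using f1 QD by (simp add: mult_ac)
  then have Hd: "Hd = Q * FE" using D_ne by simp
  have "Gd * D = (Q * (fps_const (1 / c) * (1 - FE))) * D" using f2 QD by (metis mult.assoc mult.commute)
  then have Gd: "Gd = Q * (fps_const (1 / c) * (1 - FE))" using D_ne by simp
  have p0: "p 0 = l * \<zeta>" using h1 g1 by (simp add: p_def)
  have "\<bar>Re (p 0)\<bar> \<le> 1" using abs_Re_le_cmod[of "p 0"] l \<zeta> by (simp add: p0 norm_mult)
  then have FPn: "cmod (fps_nth FP n) \<le> 2" if "n \<ge> 1" for n
    using Caratheodory_coeff_bound[OF p _ that] pos l \<zeta> by (auto simp: FP_def p_def norm_mult norm_divide)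
  have FP0: "cmod (fps_nth FP 0) \<le> 1"
    using l \<zeta> by (simp add: FP_def fps_expansion_def p0)
  have Qn: "cmod (fps_nth Q n) \<le> real n + 1" for n
    by (rule fps_div_one_minus_square_bound[OF QD[unfolded D_def] _ FP0 FPn]) (simp_all add: d1)
  have \<omega>0: "\<omega> 0 = 0" using g1 by (simp add: \<omega>_def)
  have FE0: "fps_nth FE 0 = 1" by (simp add: FE_def fps_expansion_def E_def \<omega>0)
  \<comment> \<open>With w = c \<omega>, the function 2 E - 1 = (1 - w) / (1 + w) has nonnegative
    real part and value 1 at 0, so its coefficients are at most 2 in modulus.\<close>
  have FEn: "cmod (fps_nth FE n) \<le> 1" for n
  proof (cases "n = 0")
    case False
    define E2 where "E2 z = 2 * E z - 1" for z
    have "E2 holomorphic_on ball 0 1" unfolding E2_def using E by (intro holomorphic_intros)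
    moreover have "0 \<le> Re (E2 z)" if z: "cmod z < 1" for z
    proof -
      define w where "w = c * \<omega> z"
      have w: "cmod w < 1" "1 + w \<noteq> 0" using \<omega>1[OF z] nz[OF z] by (auto simp: w_def)
      have "E2 z = (1 - w) / (1 + w)" using w(2) by (simp add: E2_def E_def w_def[symmetric] field_simps)
      moreover have "Re ((1 - w) * cnj (1 + w)) = 1 - (cmod w)\<^sup>2"
        unfolding cmod_power2 by (simp add: power2_eq_square algebra_simps)
      then have "0 \<le> Re ((1 - w) * cnj (1 + w))" using w(1) by (simp add: power_le_one)
      ultimately show ?thesis by (simp only: Re_complex_div_ge_0)
    qed
    ultimately have "cmod (fps_nth (fps_expansion E2 0) n) \<le> 2 * Re (E2 0)"
      using False by (intro Caratheodory_coeff_bound) auto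
    moreover have "fps_expansion E2 0 = fps_const 2 * FE - 1"
      unfolding E2_def by (intro fps_expansion_eqI fps_expansion_intros xE)
    ultimately show ?thesis using False by (simp add: E2_def E_def \<omega>0 norm_mult)
  qed (simp add: FE0)
  have "cmod (fps_nth Hd n) \<le> (\<Sum>i=0..n. cmod (fps_nth Q i * fps_nth FE (n - i)))"
    unfolding Hd fps_mult_nth by (rule norm_sum)
  also have "\<dots> \<le> (\<Sum>i=0..n. (real i + 1) * 1)"
    unfolding norm_mult using Qn FEn by (intro sum_mono mult_mono) auto
  also have "\<dots> = real ((n + 1) * (n + 2)) / 2" using sum_Suc_le by simp
  also have "\<dots> = real (Suc n) * ((real n + 2) / 2)" by (simp add: algebra_simps)
  finally have "cmod (of_nat (Suc n) * fps_nth (fps_expansion h 0) (Suc n)) \<le> real (Suc n) * ((real n + 2) / 2)"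
    by (simp add: Hd_def)
  then have "real (Suc n) * cmod (fps_nth (fps_expansion h 0) (Suc n)) \<le> real (Suc n) * ((real n + 2) / 2)"
    by (simp only: norm_mult norm_of_nat)
  then show "cmod (fps_nth (fps_expansion h 0) (Suc n)) \<le> (real n + 2) / 2"
    by (rule mult_left_le_imp_le) simp
  define FW where "FW = fps_const (1 / c) * (1 - FE)"
  have FW: "cmod (fps_nth FW i) \<le> 1" "fps_nth FW 0 = 0" for i
    using FEn[of i] FE0 c1 by (cases "i = 0"; simp add: FW_def norm_mult norm_divide)+
  have "cmod (fps_nth Gd n) \<le> (\<Sum>i=0..n. cmod (fps_nth Q i * fps_nth FW (n - i)))"
    unfolding Gd FW_def[symmetric] fps_mult_nth by (rule norm_sum)
  \<comment> \<open>The constant coefficient of \<open>FW\<close> vanishes because \<omega> 0 = 0,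
    which removes the summand i = n. This is the factor z in the majorant z (1 - z)^(-3).\<close>
  also have "\<dots> = (\<Sum>i<n. cmod (fps_nth Q i * fps_nth FW (n - i)))"
    unfolding atLeast0AtMost by (subst lessThan_Suc_atMost[symmetric]) (simp add: FW(2))
  also have "\<dots> \<le> (\<Sum>i<n. (real i + 1) * 1)"
    unfolding norm_mult using Qn FW(1) by (intro sum_mono mult_mono) auto
  also have "\<dots> = real (Suc n) * (real n / 2)"
    by (induction n) (auto simp: field_simps)
  finally have "cmod (of_nat (Suc n) * fps_nth (fps_expansion g 0) (Suc n)) \<le> real (Suc n) * (real n / 2)"
    by (simp add: Gd_def)
  then have "real (Suc n) * cmod (fps_nth (fps_expansion g 0) (Suc n)) \<le> real (Suc n) * (real n / 2)"
    by (simp only: norm_mult norm_of_nat)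
  then show "cmod (fps_nth (fps_expansion g 0) (Suc n)) \<le> real n / 2"
    by (rule mult_left_le_imp_le) simp
qed

section \<open>Perturbations of the identity\<close>

text \<open>Composing the perturbation with the nearest-point projection onto the closed disc turns
  L into a bijection of the plane that is a translation along every radius outside the disc.\<close>

lemma identity_perturbation_close_to_convex:
  fixes L e :: "complex \<Rightarrow> complex"
  assumes k: "0 \<le> k" "k < 1"
    and lip: "\<And>z w. \<lbrakk>cmod z \<le> 1; cmod w \<le> 1\<rbrakk> \<Longrightarrow> cmod (e z - e w) \<le> k * cmod (z - w)"
    and L: "\<And>z. cmod z < 1 \<Longrightarrow> L z = z + e z"
  shows "inj_on L (ball 0 1)" and "close_to_convex (L ` ball 0 1)"
proof -
  define P where "P = closest_point (cball (0::complex) 1)"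
  have P_in: "cmod (P z) \<le> 1" for z
    using closest_point_in_set[of "cball (0::complex) 1" z] by (simp add: P_def)
  have P_id: "P z = z" if "cmod z \<le> 1" for z
    using that by (simp add: P_def closest_point_self)
  have P_ray: "P (of_real (1 + t) * \<zeta>) = \<zeta>" if "cmod \<zeta> = 1" "t \<ge> 0" for t \<zeta>
    unfolding P_def
  proof (rule closest_point_unique[symmetric], goal_cases)
    case (4)
    show ?case
    proof
      fix z :: complex assume "z \<in> cball 0 1"
      then have "cmod (of_real (1 + t) * \<zeta>) - cmod z \<ge> (1 + t) - 1"
        using that by (simp add: norm_mult del: of_real_add)
      moreover have "cmod (of_real (1 + t) * \<zeta>) - cmod z \<le> dist (of_real (1 + t) * \<zeta>) z"
        unfolding dist_norm by (rule norm_triangle_ineq2)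
      moreover have "of_real (1 + t) * \<zeta> - \<zeta> = of_real t * \<zeta>" by (simp add: algebra_simps)
      then have "dist (of_real (1 + t) * \<zeta>) \<zeta> = t" using that by (simp add: dist_norm norm_mult)
      ultimately show "dist (of_real (1 + t) * \<zeta>) \<zeta> \<le> dist (of_real (1 + t) * \<zeta>) z" by linarith
    qed
  qed (use that in auto)
  have P_lip: "cmod (P z - P w) \<le> cmod (z - w)" for z w
    using closest_point_lipschitz[of "cball (0::complex) 1" z w] by (simp add: P_def dist_norm)
  define E where "E z = z + e (P z)" for z
  have eP: "cmod (e (P z) - e (P w)) \<le> k * cmod (z - w)" for z w
    using lip[OF P_in P_in] mult_left_mono[OF P_lip k(1)] order_trans by blast
  \<comment> \<open>Solutions of E z = y are the fixed points of the contraction z \<mapsto> y - e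
    (P z), so injectivity and surjectivity come together.\<close>
  have uniq: "\<exists>!z. E z = y" for y
  proof -
    have "\<exists>!z. y - e (P z) = z"
    proof (rule banach_fix_type[OF k], intro allI)
      fix z w
      show "dist (y - e (P z)) (y - e (P w)) \<le> k * dist z w"
        using eP[of w z] by (simp add: dist_norm norm_minus_commute)
    qed
    moreover have "y - e (P z) = z \<longleftrightarrow> E z = y" for z by (auto simp: E_def algebra_simps)
    ultimately show ?thesis by simp
  qed
  have inj: "inj E" using uniq by (metis injI)
  have surj: "surj E" using uniq by (metis surj_def)
  have cont: "continuous_on UNIV E"
  proof -
    have "(1::real)-lipschitz_on UNIV (\<lambda>z. e (P z))"
    proof (rule lipschitz_onI)
      fix x y :: complex
      have "k * cmod (x - y) \<le> 1 * cmod (x - y)" using k by (intro mult_right_mono) auto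
      then show "dist (e (P x)) (e (P y)) \<le> 1 * dist x y" using eP[of x y] unfolding dist_norm by linarith
    qed simp
    then have "continuous_on UNIV (\<lambda>z. e (P z))" by (rule lipschitz_on_continuous_on)
    then show ?thesis unfolding E_def by (intro continuous_intros)
  qed
  have LE: "L z = E z" if "z \<in> ball 0 1" for z using that L by (simp add: E_def P_id)
  then have img: "L ` ball 0 1 = E ` ball 0 1" by simp
  show "inj_on L (ball 0 1)" using inj LE by (metis inj_eq inj_onI)
  have "open (E ` ball 0 1)"
    by (rule invariance_of_domain[OF continuous_on_subset[OF cont] _ inj_on_subset[OF inj]]) auto
  moreover have "connected (E ` ball 0 1)"
    by (intro connected_continuous_image continuous_on_subset[OF cont]) auto
  moreover have "E ` ball 0 1 \<noteq> {}" by simp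
  moreover have "\<exists>\<R>. (\<forall>R\<in>\<R>. half_line R) \<and>
         pairwise (\<lambda>R R'. disjnt (rel_interior R) (rel_interior R')) \<R> \<and> - (E ` ball 0 1) = \<Union>\<R>"
  proof -
    define ray where "ray \<zeta> = {E \<zeta> + of_real t * \<zeta> | t. t \<ge> 0}" for \<zeta>
    have E_ray: "E (of_real (1 + t) * \<zeta>) = E \<zeta> + of_real t * \<zeta>" if "cmod \<zeta> = 1" "t \<ge> 0" for t \<zeta>
      using P_ray[OF that] P_id[of \<zeta>] that by (simp add: E_def algebra_simps)
    have "half_line (ray \<zeta>)" if "cmod \<zeta> = 1" for \<zeta>
      unfolding half_line_def ray_def using that by (intro exI[of _ "E \<zeta>"] exI[of _ \<zeta>]) auto
    moreover have "disjnt (rel_interior (ray \<zeta>)) (rel_interior (ray \<zeta>'))"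
      if "cmod \<zeta> = 1" "cmod \<zeta>' = 1" "ray \<zeta> \<noteq> ray \<zeta>'" for \<zeta> \<zeta>'
    proof -
      \<comment> \<open>The half-lines are the images under the injective \<open>E\<close> of the
        radial half-lines outside the disc, and a point outside the disc determines its own
        radius.\<close>
      have "ray \<zeta> \<inter> ray \<zeta>' = {}"
      proof (rule ccontr)
        assume "ray \<zeta> \<inter> ray \<zeta>' \<noteq> {}"
        then obtain t t' where t: "t \<ge> 0" "t' \<ge> 0" "E \<zeta> + of_real t * \<zeta> = E \<zeta>' + of_real t' * \<zeta>'"
          by (auto simp: ray_def)
        have "E (of_real (1 + t) * \<zeta>) = E (of_real (1 + t') * \<zeta>')"
          unfolding E_ray[OF that(1) t(1)] E_ray[OF that(2) t(2)] by (rule t(3))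
        then have z: "of_real (1 + t) * \<zeta> = of_real (1 + t') * \<zeta>'" by (rule injD[OF inj])
        have "cmod (of_real (1 + t) * \<zeta>) = 1 + t" "cmod (of_real (1 + t') * \<zeta>') = 1 + t'"
          using that t(1,2) by (simp_all add: norm_mult del: of_real_add)
        then have "t = t'" using z by simp
        moreover have "complex_of_real (1 + t) \<noteq> 0" using t(1) by (simp only: of_real_eq_0_iff)
        ultimately have "\<zeta> = \<zeta>'" using z by (simp del: of_real_add)
        then show False using that by simp
      qed
      then show ?thesis using rel_interior_subset unfolding disjnt_def by blast
    qed
    moreover have "- (E ` ball 0 1) = \<Union> (ray ` sphere 0 1)"
    proof -
      have "- (E ` ball 0 1) = E ` (- ball 0 1)"
        using bij_image_Compl_eq[of E "ball 0 1"] inj surj by (simp add: bij_def)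
      also have "\<dots> = \<Union> (ray ` sphere 0 1)"
      proof (intro equalityI subsetI)
        fix w assume "w \<in> E ` (- ball 0 1)"
        then obtain z where z: "w = E z" "1 \<le> cmod z" by auto
        define \<zeta> where "\<zeta> = z / of_real (cmod z)"
        have \<zeta>: "cmod \<zeta> = 1" using z(2) by (auto simp: \<zeta>_def norm_divide)
        have "z = of_real (1 + (cmod z - 1)) * \<zeta>" using z(2) by (auto simp: \<zeta>_def)
        then have "w = E \<zeta> + of_real (cmod z - 1) * \<zeta>" using E_ray[OF \<zeta>, of "cmod z - 1"] z by simp
        then have "w \<in> ray \<zeta>" using z(2) unfolding ray_def by (intro CollectI exI[of _ "cmod z - 1"]) auto
        then show "w \<in> \<Union> (ray ` sphere 0 1)" using \<zeta> by auto
      next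
        fix w assume "w \<in> \<Union> (ray ` sphere 0 1)"
        then obtain \<zeta> t where t: "cmod \<zeta> = 1" "t \<ge> 0" "w = E \<zeta> + of_real t * \<zeta>" by (auto simp: ray_def)
        then have "w = E (of_real (1 + t) * \<zeta>)" using E_ray by simp
        moreover have "of_real (1 + t) * \<zeta> \<in> - ball 0 1" using t by (simp add: norm_mult del: of_real_add)
        ultimately show "w \<in> E ` (- ball 0 1)" by blast
      qed
      finally show ?thesis .
    qed
    ultimately show ?thesis
      by (intro exI[of _ "ray ` sphere 0 1"]) (auto simp: pairwise_def)
  qed
  ultimately show "close_to_convex (L ` ball 0 1)"
    unfolding img close_to_convex_def by blast
qed

section \<open>Coefficient criterion for close-to-convex harmonic maps\<close>

lemma harmonic_Jacobian:
  fixes f h g :: "complex \<Rightarrow> complex"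
  assumes hol: "h holomorphic_on ball 0 1" "g holomorphic_on ball 0 1"
    and eq: "\<And>z. z \<in> ball 0 1 \<Longrightarrow> f z = h z + cnj (g z)" and z: "z \<in> ball 0 1"
  shows "f differentiable (at z)"
    and "frechet_derivative f (at z) v = deriv h z * v + cnj (deriv g z * v)"
    and "Im (cnj (frechet_derivative f (at z) 1) * frechet_derivative f (at z) \<i>) = (cmod (deriv h z))\<^sup>2 - (cmod (deriv g z))\<^sup>2"
proof -
  have "(h has_field_derivative deriv h z) (at z)" "(g has_field_derivative deriv g z) (at z)"
    using hol z by (auto intro!: holomorphic_derivI[OF _ open_ball])
  then have "((\<lambda>w. h w + cnj (g w)) has_derivative (\<lambda>v. deriv h z * v + cnj (deriv g z * v))) (at z)"
    unfolding has_field_derivative_def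
    by (intro has_derivative_add has_derivative_cnj)
  then have "(f has_derivative (\<lambda>v. deriv h z * v + cnj (deriv g z * v))) (at z)"
    by (rule has_derivative_transform_within_open[OF _ open_ball z]) (simp add: eq)
  then have D: "f differentiable (at z)" "frechet_derivative f (at z) = (\<lambda>v. deriv h z * v + cnj (deriv g z * v))"
    by (auto simp: differentiable_def frechet_derivative_at[symmetric])
  show "f differentiable (at z)" by (rule D(1))
  show "frechet_derivative f (at z) v = deriv h z * v + cnj (deriv g z * v)" by (simp add: D(2))
  show "Im (cnj (frechet_derivative f (at z) 1) * frechet_derivative f (at z) \<i>) = (cmod (deriv h z))\<^sup>2 - (cmod (deriv g z))\<^sup>2"
    unfolding D(2) cmod_power2 by (simp add: power2_eq_square algebra_simps)
qed

text \<open>Because |z^n - w^n| \<le> n |z - w| on the closed disc, the sum of n (|a_n| + |b_n|) is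
  a Lipschitz constant for L minus the identity, up to the circle. The same sum bounds |A' - 1| +
  |B'|, so |B'| < 1 - |A' - 1| \<le> |A'|, which is sense preservation.\<close>

lemma coefficient_condition_close_to_convex:
  fixes A B :: "complex fps"
  assumes A: "fps_nth A 0 = 0" "fps_nth A 1 = 1" and B: "fps_nth B 0 = 0" "fps_nth B 1 = 0"
    and summ: "summable (\<lambda>m. real (m + 2) * (cmod (fps_nth A (m + 2)) + cmod (fps_nth B (m + 2))))"
    and k: "(\<Sum>m. real (m + 2) * (cmod (fps_nth A (m + 2)) + cmod (fps_nth B (m + 2)))) < 1"
    and L: "\<And>z. cmod z < 1 \<Longrightarrow> L z = eval_fps A z + cnj (eval_fps B z)"
  shows "L \<in> C_harmonic"
proof -
  define a where "a m = fps_nth A (m + 2)" for m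
  define b where "b m = fps_nth B (m + 2)" for m
  define c where "c m = real (m + 2) * (cmod (a m) + cmod (b m))" for m
  define k where "k = suminf c"
  have sc: "summable c" and k1: "k < 1" using summ k by (simp_all add: c_def[abs_def] k_def a_def b_def)
  have cn: "0 \<le> c m" for m by (simp add: c_def)
  have k0: "0 \<le> k" unfolding k_def by (rule suminf_nonneg[OF sc cn])
  have ac: "cmod (a m) \<le> c m" "cmod (b m) \<le> c m" "real (m + 2) * cmod (a m) \<le> c m" "real (m + 2) * cmod (b m) \<le> c m" for m
  proof -
    have "1 * (cmod (a m) + cmod (b m)) \<le> c m" unfolding c_def by (intro mult_right_mono) auto
    then show "cmod (a m) \<le> c m" "cmod (b m) \<le> c m"
      unfolding mult_1 using norm_ge_zero[of "a m"] norm_ge_zero[of "b m"] by (auto intro: order_trans[rotated])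
    show "real (m + 2) * cmod (a m) \<le> c m" "real (m + 2) * cmod (b m) \<le> c m"
      unfolding c_def by (intro mult_left_mono; simp)+
  qed
  have s1: "summable (\<lambda>m. a m * z ^ (m + 2))" "summable (\<lambda>m. b m * z ^ (m + 2))" if "cmod z \<le> 1" for z
  proof -
    have "cmod (a m * z ^ (m + 2)) \<le> c m" "cmod (b m * z ^ (m + 2)) \<le> c m" for m
      using mult_mono[OF ac(1)[of m] power_le_one[of "cmod z" "m + 2"]]
        mult_mono[OF ac(2)[of m] power_le_one[of "cmod z" "m + 2"]] that cn[of m]
      by (simp_all add: norm_mult norm_power)
    then show "summable (\<lambda>m. a m * z ^ (m + 2))" "summable (\<lambda>m. b m * z ^ (m + 2))"
      by (auto intro!: summable_comparison_test'[OF sc, of 0])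
  qed
  define e where "e z = (\<Sum>m. a m * z ^ (m + 2)) + cnj (\<Sum>m. b m * z ^ (m + 2))" for z
  have full: "summable (\<lambda>n. fps_nth A n * z ^ n)" "summable (\<lambda>n. fps_nth B n * z ^ n)" if "cmod z \<le> 1" for z
    using s1[OF that] summable_iff_shift[of "\<lambda>n. fps_nth A n * z ^ n" 2] summable_iff_shift[of "\<lambda>n. fps_nth B n * z ^ n" 2]
    by (simp_all add: a_def b_def)
  have Le: "L z = z + e z" if z: "cmod z < 1" for z
  proof -
    have "eval_fps A z = z + (\<Sum>m. a m * z ^ (m + 2))" "eval_fps B z = (\<Sum>m. b m * z ^ (m + 2))"
      using suminf_split_initial_segment[OF full(1), of z 2] suminf_split_initial_segment[OF full(2), of z 2] z A B
      by (simp_all add: eval_fps_def a_def b_def numeral_2_eq_2)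
    then show ?thesis using L[OF z] by (simp add: e_def)
  qed
  have lip: "cmod (e z - e w) \<le> k * cmod (z - w)" if zw: "cmod z \<le> 1" "cmod w \<le> 1" for z w
  proof -
    define D where "D = cmod (z - w)"
    define x where "x m = a m * z ^ (m + 2) - a m * w ^ (m + 2)" for m
    define y where "y m = b m * z ^ (m + 2) - b m * w ^ (m + 2)" for m
    have pw: "cmod (z ^ (m + 2) - w ^ (m + 2)) \<le> real (m + 2) * D" for m
      unfolding D_def by (rule norm_power_diff[OF zw])
    have xy: "cmod (x m) + cmod (y m) \<le> c m * D" for m
    proof -
      have "cmod (x m) + cmod (y m) = (cmod (a m) + cmod (b m)) * cmod (z ^ (m + 2) - w ^ (m + 2))"
        by (simp only: x_def y_def right_diff_distrib[symmetric] norm_mult distrib_right)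
      also have "\<dots> \<le> (cmod (a m) + cmod (b m)) * (real (m + 2) * D)"
        by (intro mult_left_mono pw) auto
      finally show ?thesis by (simp only: c_def mult_ac)
    qed
    have sD: "summable (\<lambda>m. c m * D)" using sc by (rule summable_mult2)
    have sx: "summable (\<lambda>m. cmod (x m))" and sy: "summable (\<lambda>m. cmod (y m))"
    proof -
      have "norm (cmod (x m)) \<le> c m * D" "norm (cmod (y m)) \<le> c m * D" for m
        using xy[of m] norm_ge_zero[of "x m"] norm_ge_zero[of "y m"] unfolding real_norm_def abs_norm_cancel by linarith+
      then show "summable (\<lambda>m. cmod (x m))" "summable (\<lambda>m. cmod (y m))"
        by (auto intro!: summable_comparison_test'[OF sD, of 0])
    qed
    have "e z - e w = suminf x + cnj (suminf y)"
      unfolding e_def x_def y_def using s1[OF zw(1)] s1[OF zw(2)]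
      by (simp add: suminf_diff[symmetric])
    then have "cmod (e z - e w) \<le> cmod (suminf x) + cmod (suminf y)"
      using norm_triangle_ineq[of "suminf x" "cnj (suminf y)"] by simp
    also have "\<dots> \<le> (\<Sum>m. cmod (x m)) + (\<Sum>m. cmod (y m))"
      by (intro add_mono summable_norm sx sy)
    also have "\<dots> = (\<Sum>m. cmod (x m) + cmod (y m))" by (rule suminf_add[OF sx sy])
    also have "\<dots> \<le> (\<Sum>m. c m * D)" by (intro suminf_le xy summable_add sx sy sD)
    also have "\<dots> = k * D" unfolding k_def by (rule suminf_mult2[OF sc, symmetric])
    finally show ?thesis by (simp add: D_def)
  qed
  note ctc = identity_perturbation_close_to_convex[OF k0 k1 lip Le]
  have rad: "fps_conv_radius A \<ge> 1" "fps_conv_radius B \<ge> 1"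
    unfolding fps_conv_radius_def
    using conv_radius_geI[of "fps_nth A" 1] conv_radius_geI[of "fps_nth B" 1] full[of 1] by (auto simp: one_ereal_def)
  have sub: "ball 0 1 \<subseteq> eball (0::complex) (fps_conv_radius A)" "ball 0 1 \<subseteq> eball (0::complex) (fps_conv_radius B)"
    using rad by (auto simp: in_eball_iff) (metis ereal_less(3) less_ereal.simps(1) one_ereal_def order_less_le_trans)+
  have hol: "eval_fps A holomorphic_on ball 0 1" "eval_fps B holomorphic_on ball 0 1"
    using sub by (auto intro!: holomorphic_on_eval_fps)
  have dser: "deriv (eval_fps F) z = (\<Sum>n. of_nat (Suc n) * fps_nth F (Suc n) * z ^ n)"
      "summable (\<lambda>n. of_nat (Suc n) * fps_nth F (Suc n) * z ^ n)"
    if "fps_conv_radius F \<ge> 1" "cmod z < 1" for F :: "complex fps" and z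
  proof -
    have zr: "ereal (cmod z) < fps_conv_radius F"
      using that by (metis less_ereal.simps(1) one_ereal_def order_less_le_trans)
    have "(eval_fps F has_field_derivative eval_fps (fps_deriv F) z) (at z)"
      using zr by (intro has_field_derivative_eval_fps) (simp add: in_eball_iff)
    then show "deriv (eval_fps F) z = (\<Sum>n. of_nat (Suc n) * fps_nth F (Suc n) * z ^ n)"
      by (simp add: DERIV_imp_deriv eval_fps_def)
    have "ereal (cmod z) < fps_conv_radius (fps_deriv F)"
      using zr fps_conv_radius_deriv[of F] by (rule order_less_le_trans)
    then show "summable (\<lambda>n. of_nat (Suc n) * fps_nth F (Suc n) * z ^ n)"
      using summable_fps[of z "fps_deriv F"] by simp
  qed
  have dA0: "deriv (eval_fps A) 0 = 1" and dB0: "deriv (eval_fps B) 0 = 0"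
    using dser(1)[OF rad(1), of 0] dser(1)[OF rad(2), of 0] A B by simp_all
  have sp: "cmod (deriv (eval_fps B) z) < cmod (deriv (eval_fps A) z)" if z: "cmod z < 1" for z
  proof -
    have tail: "cmod (deriv (eval_fps F) z - fps_nth F 1) \<le> (\<Sum>m. real (m + 2) * cmod (fps_nth F (m + 2)))"
      if "fps_conv_radius F \<ge> 1" "summable (\<lambda>m. real (m + 2) * cmod (fps_nth F (m + 2)))" for F :: "complex fps"
    proof -
      define t where "t n = of_nat (Suc n) * fps_nth F (Suc n) * z ^ n" for n
      have st: "summable t" using dser(2)[OF that(1) z] by (simp only: t_def[abs_def])
      have "suminf t = (\<Sum>n. t (n + 1)) + t 0"
        using suminf_split_initial_segment[OF st, of 1] by simp
      moreover have "t 0 = fps_nth F 1" by (simp add: t_def)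
      moreover have "deriv (eval_fps F) z = suminf t"
        using dser(1)[OF that(1) z] by (simp only: t_def[abs_def])
      ultimately have "deriv (eval_fps F) z - fps_nth F 1 = (\<Sum>m. t (m + 1))" by simp
      moreover have b: "cmod (t (m + 1)) \<le> real (m + 2) * cmod (fps_nth F (m + 2))" for m
      proof -
        have "cmod (t (m + 1)) = real (m + 2) * cmod (fps_nth F (m + 2)) * cmod z ^ (m + 1)"
          unfolding t_def norm_mult norm_power norm_of_nat by simp
        also have "\<dots> \<le> real (m + 2) * cmod (fps_nth F (m + 2)) * 1"
          using z by (intro mult_left_mono power_le_one) auto
        finally show ?thesis by simp
      qed
      moreover have sn: "summable (\<lambda>m. cmod (t (m + 1)))"
        by (rule summable_comparison_test'[OF that(2), of 0]) (use b in simp)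
      ultimately show ?thesis
        using summable_norm[OF sn] suminf_le[OF b sn that(2)] by simp
    qed
    have sa: "summable (\<lambda>m. real (m + 2) * cmod (a m))" and sb: "summable (\<lambda>m. real (m + 2) * cmod (b m))"
      using ac(3,4) by (auto intro!: summable_comparison_test'[OF sc, of 0] simp: abs_mult)
    have "(\<Sum>m. real (m + 2) * cmod (a m)) + (\<Sum>m. real (m + 2) * cmod (b m)) = k"
      unfolding k_def by (subst suminf_add[OF sa sb]) (simp add: c_def[abs_def] algebra_simps)
    then have "cmod (deriv (eval_fps A) z - 1) + cmod (deriv (eval_fps B) z) \<le> k"
      using tail[OF rad(1)] tail[OF rad(2)] sa sb A B by (simp add: a_def b_def)
    moreover have "1 - cmod (deriv (eval_fps A) z) \<le> cmod (deriv (eval_fps A) z - 1)"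
      using norm_triangle_ineq2[of 1 "deriv (eval_fps A) z"] by (simp add: norm_minus_commute)
    ultimately show ?thesis using k1 by linarith
  qed
  have parts: "harmonic_parts L (eval_fps A) (eval_fps B)"
    unfolding harmonic_parts_def using hol dA0 dB0 A B L by (simp add: eval_fps_at_0)
  have "sense_preserving_on (ball 0 1) L"
    unfolding sense_preserving_on_def
  proof
    fix z :: complex assume z: "z \<in> ball 0 1"
    have "(cmod (deriv (eval_fps B) z))\<^sup>2 < (cmod (deriv (eval_fps A) z))\<^sup>2"
      using sp[of z] z by (intro power_strict_mono) auto
    then show "L differentiable (at z) \<and> 0 < Im (cnj (frechet_derivative L (at z) 1) * frechet_derivative L (at z) \<i>)"
      using harmonic_Jacobian(1,3)[OF hol, of L z] L z by simp
  qed
  then show ?thesis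
    using parts ctc unfolding C_harmonic_def S_harmonic_def harmonic_class_def by blast
qed

section \<open>Wright coefficients and the operator L\<close>

lemma wright_fps_nth_pos:
  assumes "\<beta> \<ge> 0" "\<delta> \<ge> 0" "\<alpha> > 0" "\<gamma> > 0" "n \<ge> 1"
  shows "0 < fps_nth (wright_fps \<alpha> \<beta> \<gamma> \<delta> :: real fps) n"
proof -
  have "0 < \<alpha> + (real n - 1) * \<beta>" "0 < \<gamma> + (real n - 1) * \<delta>"
    using assms by (auto intro!: add_pos_nonneg mult_nonneg_nonneg)
  then show ?thesis
    using assms by (simp add: wright_fps_def Gamma_real_pos)
qed

lemma wright_fps_nth_complex:
  "fps_nth (wright_fps \<alpha> \<beta> \<gamma> \<delta> :: complex fps) n = of_real (fps_nth (wright_fps \<alpha> \<beta> \<gamma> \<delta> :: real fps) n)"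
  by (simp add: wright_fps_def)

theorem theorem8:
  fixes \<alpha>1 \<beta>1 \<gamma>1 \<delta>1 \<alpha>2 \<beta>2 \<gamma>2 \<delta>2 :: real
    and \<sigma> :: complex
    and f h g :: "complex \<Rightarrow> complex"
    and W1 W2 :: "real fps"
  defines "W1 \<equiv> wright_fps \<alpha>1 \<beta>1 \<gamma>1 \<delta>1"
    and "W2 \<equiv> wright_fps \<alpha>2 \<beta>2 \<gamma>2 \<delta>2"
  assumes "\<beta>1 \<ge> 0" "\<beta>2 \<ge> 0" "\<delta>1 \<ge> 0" "\<delta>2 \<ge> 0"
    and "\<alpha>1 > 0" "\<alpha>2 > 0" "\<gamma>1 > 0" "\<gamma>2 > 0"
    and "cmod \<sigma> < 1"
    and "f \<in> K_harmonic0"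
    and "harmonic_parts f h g"
    and "summable (fps_nth (fps_deriv W1))"
    and "summable (fps_nth (fps_deriv (fps_deriv W1)))"
    and "summable (fps_nth (fps_deriv (fps_deriv W2)))"
    and "eval_fps (fps_deriv (fps_deriv W1)) 1 + 2 * eval_fps (fps_deriv W1) 1
           + eval_fps (fps_deriv (fps_deriv W2)) 1 \<le> 4"
  shows "wright_operator \<alpha>1 \<beta>1 \<gamma>1 \<delta>1 \<alpha>2 \<beta>2 \<gamma>2 \<delta>2 \<sigma> h g \<in> C_harmonic"
proof -
  have hp: "h holomorphic_on ball 0 1" "g holomorphic_on ball 0 1" "h 0 = 0" "deriv h 0 = 1" "g 0 = 0"
    "\<And>z. z \<in> ball 0 1 \<Longrightarrow> f z = h z + cnj (g z)"
    using \<open>harmonic_parts f h g\<close> by (auto simp: harmonic_parts_def)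
  have K: "inj_on f (ball 0 1)" "convex (f ` ball 0 1)" "sense_preserving_on (ball 0 1) f"
    using \<open>f \<in> K_harmonic0\<close> by (auto simp: K_harmonic0_def S_harmonic0_def S_harmonic_def)
  obtain h0 g0 where "harmonic_parts f h0 g0" "deriv g0 0 = 0"
    using \<open>f \<in> K_harmonic0\<close> by (auto simp: K_harmonic0_def S_harmonic0_def)
  then have hp0: "h0 holomorphic_on ball 0 1" "g0 holomorphic_on ball 0 1" "deriv h0 0 = 1" "deriv g0 0 = 0"
    "\<And>z. z \<in> ball 0 1 \<Longrightarrow> f z = h0 z + cnj (g0 z)"
    by (auto simp: harmonic_parts_def)
  \<comment> \<open>Class membership gives the vanishing derivative for some decomposition of f.
    Both analytic parts have derivative 1 at 0, so the derivative of f in direction 1 transfers it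
    to the given g.\<close>
  have g1: "deriv g 0 = 0"
  proof -
    have "frechet_derivative f (at 0) 1 = deriv h 0 * 1 + cnj (deriv g 0 * 1)"
      by (rule harmonic_Jacobian(2)[OF hp(1,2,6)]) auto
    moreover have "frechet_derivative f (at 0) 1 = deriv h0 0 * 1 + cnj (deriv g0 0 * 1)"
      by (rule harmonic_Jacobian(2)[OF hp0(1,2,5)]) auto
    ultimately show ?thesis using hp(4) hp0(3,4) by simp
  qed
  have sp: "cmod (deriv g z) < cmod (deriv h z)" if "cmod z < 1" for z
  proof -
    have z: "z \<in> ball 0 1" using that by simp
    then have "0 < (cmod (deriv h z))\<^sup>2 - (cmod (deriv g z))\<^sup>2"
    proof -
      have "0 < Im (cnj (frechet_derivative f (at z) 1) * frechet_derivative f (at z) \<i>)"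
        using K(3) z unfolding sense_preserving_on_def by blast
      then show ?thesis by (simp only: harmonic_Jacobian(3)[OF hp(1,2,6) z])
    qed
    then have "(cmod (deriv g z))\<^sup>2 < (cmod (deriv h z))\<^sup>2" by simp
    then show ?thesis by (rule power2_less_imp_less) simp
  qed
  have f0: "f 0 = 0" using hp(6)[of 0] hp(3,5) by simp
  define A where "A n = fps_nth (fps_expansion h 0) n" for n
  define B where "B n = fps_nth (fps_expansion g 0) n" for n
  have bounds: "cmod (A (Suc n)) \<le> (real n + 2) / 2" "cmod (B (Suc n)) \<le> real n / 2" for n
    unfolding A_def B_def
    by (rule convex_harmonic_coeff_bounds[OF hp(1,2,6) f0 K(1,2) hp(4) g1 sp]; assumption)+
  have AB: "A 0 = 0" "A 1 = 1" "B 0 = 0" "B 1 = 0"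
    using hp g1 by (simp_all add: A_def B_def fps_expansion_def)
  define w1 where "w1 n = fps_nth W1 n" for n
  define w2 where "w2 n = fps_nth W2 n" for n
  have w_pos: "0 < w1 n" "0 < w2 n" if "n \<ge> 1" for n
    unfolding w1_def w2_def W1_def W2_def by (rule wright_fps_nth_pos; fact)+
  have w11: "w1 1 = 1" by (simp add: w1_def W1_def wright_fps_def)
  \<comment> \<open>With n = m + 2, these are the terms n (n - 1) w1 n, n w1 n and n (n - 1) w2 n;
    the term 1 of W1'(1) at n = 1 is left out of \<open>s2\<close>, which turns the bound 4 into
    2.\<close>
  define s1 where "s1 m = (real m + 1) * (real m + 2) * w1 (m + 2)" for m
  define s2 where "s2 m = (real m + 2) * w1 (m + 2)" for m
  define s3 where "s3 m = (real m + 1) * (real m + 2) * w2 (m + 2)" for m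
  have S1: "summable s1" "eval_fps (fps_deriv (fps_deriv W1)) 1 = suminf s1"
  proof -
    have "fps_nth (fps_deriv (fps_deriv W1)) = s1" by (auto simp: s1_def w1_def fun_eq_iff algebra_simps)
    then show "summable s1" "eval_fps (fps_deriv (fps_deriv W1)) 1 = suminf s1"
      using \<open>summable (fps_nth (fps_deriv (fps_deriv W1)))\<close> by (simp_all add: eval_fps_def)
  qed
  have S3: "summable s3" "eval_fps (fps_deriv (fps_deriv W2)) 1 = suminf s3"
  proof -
    have "fps_nth (fps_deriv (fps_deriv W2)) = s3" by (auto simp: s3_def w2_def fun_eq_iff algebra_simps)
    then show "summable s3" "eval_fps (fps_deriv (fps_deriv W2)) 1 = suminf s3"
      using \<open>summable (fps_nth (fps_deriv (fps_deriv W2)))\<close> by (simp_all add: eval_fps_def)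
  qed
  have S2: "summable s2" "eval_fps (fps_deriv W1) 1 = suminf s2 + 1"
  proof -
    have eq: "(\<lambda>m. fps_nth (fps_deriv W1) (m + 1)) = s2" by (auto simp: s2_def w1_def fun_eq_iff algebra_simps)
    then show "summable s2"
      using \<open>summable (fps_nth (fps_deriv W1))\<close> summable_iff_shift[of "fps_nth (fps_deriv W1)" 1] by simp
    show "eval_fps (fps_deriv W1) 1 = suminf s2 + 1"
    proof -
      have "suminf (fps_nth (fps_deriv W1)) = suminf s2 + fps_nth (fps_deriv W1) 0"
        using suminf_split_initial_segment[OF \<open>summable (fps_nth (fps_deriv W1))\<close>, of 1]
        unfolding eq by simp
      moreover have "fps_nth (fps_deriv W1) 0 = 1" using w11 by (simp add: w1_def)
      moreover have "eval_fps (fps_deriv W1) 1 = suminf (fps_nth (fps_deriv W1))"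
        by (simp only: eval_fps_def power_one mult_1_right)
      ultimately show ?thesis by (simp only:)
    qed
  qed
  have total: "suminf s1 + 2 * suminf s2 + suminf s3 \<le> 2"
    using \<open>eval_fps (fps_deriv (fps_deriv W1)) 1 + 2 * eval_fps (fps_deriv W1) 1
           + eval_fps (fps_deriv (fps_deriv W2)) 1 \<le> 4\<close> S1(2) S2(2) S3(2) by simp
  \<comment> \<open>Positivity of this sum is what lets |\<sigma>| < 1 produce a strict
    inequality.\<close>
  have s3_pos: "0 < suminf s3"
    using S3(1) w_pos(2) by (intro suminf_pos) (auto simp: s3_def)
  define HA where "HA = hadamard (fps_expansion h 0) (wright_fps \<alpha>1 \<beta>1 \<gamma>1 \<delta>1)"
  define GB where "GB = fps_const \<sigma> * hadamard (fps_expansion g 0) (wright_fps \<alpha>2 \<beta>2 \<gamma>2 \<delta>2)"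
  have nth: "fps_nth HA n = A n * of_real (w1 n)" "fps_nth GB n = \<sigma> * (B n * of_real (w2 n))" for n
    by (simp_all add: HA_def GB_def hadamard_def A_def B_def w1_def w2_def W1_def W2_def wright_fps_nth_complex)
  define c where "c m = real (m + 2) * (cmod (fps_nth HA (m + 2)) + cmod (fps_nth GB (m + 2)))" for m
  \<comment> \<open>The coefficient bounds at n = m + 2 inserted into \<open>c\<close>, with (m + 2)
    (m + 3) = (m + 1) (m + 2) + 2 (m + 2).\<close>
  define C where "C m = (s1 m + 2 * s2 m) / 2 + cmod \<sigma> * s3 m / 2" for m
  have cC: "c m \<le> C m" for m
  proof -
    have a: "cmod (A (m + 2)) \<le> (real m + 3) / 2" and b: "cmod (B (m + 2)) \<le> (real m + 1) / 2"
      using bounds[of "Suc m"] by simp_all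
    have "cmod (fps_nth HA (m + 2)) \<le> (real m + 3) / 2 * w1 (m + 2)"
      using mult_right_mono[OF a, of "w1 (m + 2)"] w_pos(1)[of "m + 2"] by (simp add: nth norm_mult)
    moreover have "cmod (fps_nth GB (m + 2)) \<le> cmod \<sigma> * ((real m + 1) / 2 * w2 (m + 2))"
      using mult_left_mono[OF mult_right_mono[OF b, of "w2 (m + 2)"], of "cmod \<sigma>"] w_pos(2)[of "m + 2"]
      by (simp add: nth norm_mult)
    ultimately have "c m \<le> real (m + 2) * ((real m + 3) / 2 * w1 (m + 2) + cmod \<sigma> * ((real m + 1) / 2 * w2 (m + 2)))"
      unfolding c_def by (intro mult_left_mono add_mono) auto
    also have "\<dots> = C m" by (simp add: C_def s1_def s2_def s3_def field_simps)
    finally show ?thesis .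
  qed
  have C_sums: "C sums ((suminf s1 + 2 * suminf s2) / 2 + cmod \<sigma> * suminf s3 / 2)"
    unfolding C_def using S1(1) S2(1) S3(1)
    by (intro sums_add sums_divide sums_mult summable_sums)
  have c_summable: "summable c"
    by (rule summable_comparison_test'[OF sums_summable[OF C_sums], of 0]) (use cC in \<open>auto simp: c_def\<close>)
  have "suminf c \<le> suminf C" by (rule suminf_le[OF cC c_summable sums_summable[OF C_sums]])
  also have "\<dots> = (suminf s1 + 2 * suminf s2) / 2 + cmod \<sigma> * suminf s3 / 2"
    using C_sums by (rule sums_unique[symmetric])
  also have "\<dots> < (suminf s1 + 2 * suminf s2) / 2 + 1 * suminf s3 / 2"
    using \<open>cmod \<sigma> < 1\<close> s3_pos by simp
  also have "\<dots> \<le> 1" using total by (simp add: add_divide_distrib[symmetric])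
  finally have c_less: "suminf c < 1" .
  \<comment> \<open>\<open>suminf\<close> commutes with the factor \<sigma> once the series for G
    itself is known to converge; comparison with \<open>s3\<close> shows this.\<close>
  have evalGB: "eval_fps GB z = \<sigma> * eval_fps (hadamard (fps_expansion g 0) (wright_fps \<alpha>2 \<beta>2 \<gamma>2 \<delta>2)) z"
    if z: "cmod z < 1" for z
  proof -
    define F where "F = hadamard (fps_expansion g 0) (wright_fps \<alpha>2 \<beta>2 \<gamma>2 \<delta>2 :: complex fps)"
    have Fn: "fps_nth F n = B n * of_real (w2 n)" for n
      by (simp add: F_def hadamard_def B_def w2_def W2_def wright_fps_nth_complex)
    have "cmod (fps_nth F (m + 2) * z ^ (m + 2)) \<le> s3 m" for m
    proof -
      have b: "cmod (B (m + 2)) \<le> (real m + 1) / 2" using bounds(2)[of "Suc m"] by simp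
      have w: "0 < w2 (m + 2)" by (rule w_pos) simp
      have "cmod (fps_nth F (m + 2) * z ^ (m + 2)) = cmod (B (m + 2)) * w2 (m + 2) * cmod z ^ (m + 2)"
        using w by (simp add: Fn norm_mult norm_power)
      also have "\<dots> \<le> ((real m + 1) / 2) * w2 (m + 2) * 1"
        using b w z by (intro mult_mono power_le_one) auto
      also have "\<dots> \<le> ((real m + 1) * (real m + 2)) * w2 (m + 2) * 1"
        using w by (intro mult_right_mono) (auto simp: field_simps)
      finally show ?thesis by (simp add: s3_def)
    qed
    then have "summable (\<lambda>m. fps_nth F (m + 2) * z ^ (m + 2))"
      by (intro summable_comparison_test'[OF S3(1), of 0])
    then have "summable (\<lambda>n. fps_nth F n * z ^ n)"
      by (simp only: summable_iff_shift[of "\<lambda>n. fps_nth F n * z ^ n" 2])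
    then show ?thesis
      using suminf_mult[of "\<lambda>n. fps_nth F n * z ^ n" \<sigma>]
      by (simp add: GB_def F_def[symmetric] eval_fps_def mult.assoc)
  qed
  show ?thesis
  proof (rule coefficient_condition_close_to_convex)
    show "fps_nth HA 0 = 0" "fps_nth HA 1 = 1" "fps_nth GB 0 = 0" "fps_nth GB 1 = 0"
      using AB w11 by (simp_all add: nth)
    show "summable (\<lambda>m. real (m + 2) * (cmod (fps_nth HA (m + 2)) + cmod (fps_nth GB (m + 2))))"
      using c_summable by (simp add: c_def[abs_def])
    show "(\<Sum>m. real (m + 2) * (cmod (fps_nth HA (m + 2)) + cmod (fps_nth GB (m + 2)))) < 1"
      using c_less by (simp add: c_def[abs_def])
    show "wright_operator \<alpha>1 \<beta>1 \<gamma>1 \<delta>1 \<alpha>2 \<beta>2 \<gamma>2 \<delta>2 \<sigma> h g z = eval_fps HA z + cnj (eval_fps GB z)"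
      if "cmod z < 1" for z
      using evalGB[OF that] by (simp add: wright_operator_def HA_def)
  qed
qed

end
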